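(* For each $n\in\mathbb N$ let $\{\nu^n_t\}_{t>0}$ be a continuous symmetric convolution semigroup of probability measures on $\mathbb R^d$ and let $\varphi_n$ be its characteristic function (exponent), i.e. $e^{-t\varphi_n(x)}=\int_{\mathbb R^d}e^{i\langle x,y\rangle}\nu^n_t(dy)$ for $x\in\mathbb R^d$, $t>0$. Assume that $\varphi_n$ converges to a function $\varphi$ locally in $L^1(\mathbb R^d)$, i.e. $\int_K|\varphi_n(x)-\varphi(x)|\,dx\to0$ for every compact $K\subset\mathbb R^d$. Define $$\mathcal E^n(u,v)=\int_{\mathbb R^d}\widehat u(x)\overline{\widehat v}(x)\varphi_n(x)\,dx,\qquad \mathcal F^n=\Bigl\{u\in L^2(\mathbb R^d):\int_{\mathbb R^d}|\widehat u(x)|^2\varphi_n(x)\,dx<\infty\Bigr\},$$ $$\mathcal E(u,v)=\int_{\mathbb R^d}\widehat u(x)\overline{\widehat v}(x)\varphi(x)\,dx,\qquad \mathcal F=\Bigl\{u\in L^2(\mathbb R^d):\int_{\mathbb R^d}|\widehat u(x)|^2\varphi(x)\,dx<\infty\Bigr\}.$$ Then $(\mathcal E^n,\mathcal F^n)$ converges to $(\mathcal E,\mathcal F)$ in the sense of Mosco on $L^2(\mathbb R^d)$.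
   Context: $L^2(\mathbb R^d)=L^2(\mathbb R^d;dx)$, $dx$ Lebesgue measure; $\widehat u$ is the Fourier transform of $u$, normalized to be unitary on $L^2$. A continuous symmetric convolution semigroup is a family $\{\nu_t\}_{t>0}$ of probability measures on $\mathbb R^d$ with $\nu_t*\nu_s=\nu_{t+s}$ for $t,s>0$, $\nu_t(A)=\nu_t(-A)$ for Borel $A$, and $\nu_t\to\delta$ (Dirac measure at the origin) weakly as $t\to0$. By the Lévy–Khinchin formula its characteristic function is $\varphi(x)=\frac12\langle Sx,x\rangle+\int_{\mathbb R^d\setminus\{0\}}(1-\cos\langle x,y\rangle)\,n(dy)$ with $S$ a nonnegative definite symmetric $d\times d$ matrix and $n$ a symmetric Borel measure on $\mathbb R^d\setminus\{0\}$ with $\int\frac{|x|^2}{1+|x|^2}n(dx)<\infty$. Mosco convergence: a closed form means a nonnegative definite symmetric closed form on a Hilbert space $\mathcal H$ (not necessarily densely defined), and it is extended by setting $\mathcal E(u,u)=\infty$ for $u\in\mathcal H\setminus\mathcal F$. A sequence of closed forms $\mathcal E^n$ on $\mathcal H$ converges to $\mathcal E$ in the sense of Mosco if (M1) for every $u\in\mathcal H$ and every sequence $\{u_n\}$ converging to $u$ weakly in $\mathcal H$, $\liminf_{n\to\infty}\mathcal E^n(u_n,u_n)\ge\mathcal E(u,u)$; and (M2) for every $u\in\mathcal H$ there exists a sequence $\{u_n\}$ converging to $u$ (strongly) in $\mathcal H$ such that $\limsup_{n\to\infty}\mathcal E^n(u_n,u_n)\le\mathcal E(u,u)$. Here $\mathcal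 H=L^2(\mathbb R^d)$. *)

theory Defs
  imports "HOL-Probability.Probability"
begin

section \<open>Convolution semigroups\<close>

text \<open>
  Only the measures with index \<open>t > 0\<close> matter. The infix \<open>\<star>\<close> is the library's
  convolution of measures. The last conjunct is weak convergence to the Dirac measure at the
  origin, tested against bounded continuous functions.
\<close>

definition symmetric_convolution_semigroup :: "(real \<Rightarrow> (real ^ 'd) measure) \<Rightarrow> bool" where
  "symmetric_convolution_semigroup \<nu> \<longleftrightarrow>
     (\<forall>t>0. prob_space (\<nu> t) \<and> sets (\<nu> t) = sets borel) \<and>
     (\<forall>t>0. \<forall>s>0. (\<nu> t \<star> \<nu> s) = \<nu> (t + s)) \<and>
     (\<forall>t>0. \<forall>A\<in>sets borel. measure (\<nu> t) A = measure (\<nu> t) (uminus ` A)) \<and>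
     (\<forall>f :: real ^ 'd \<Rightarrow> real. continuous_on UNIV f \<and> bounded (range f) \<longrightarrow>
        ((\<lambda>t. LINT y|\<nu> t. f y) \<longlongrightarrow> (LINT y|return borel 0. f y)) (at_right 0))"

definition characteristic_exponent :: "(real \<Rightarrow> (real ^ 'd) measure) \<Rightarrow> (real ^ 'd \<Rightarrow> real) \<Rightarrow> bool" where
  "characteristic_exponent \<nu> \<phi> \<longleftrightarrow>
     (\<forall>t>0. \<forall>x. complex_of_real (exp (- t * \<phi> x)) = (LINT y|\<nu> t. iexp (x \<bullet> y)))"


section \<open>The Hilbert space of square integrable functions\<close>

text \<open>
  Elements are represented by functions instead of almost-everywhere classes. The parameter
  \<open>K\<close> is the scalar field, regarded as a subset of the complex numbers: \<open>UNIV\<close> gives the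
  complex Hilbert space and \<open>\<real>\<close> the real one.
\<close>

definition L2 :: "complex set \<Rightarrow> (real ^ 'd \<Rightarrow> complex) set" where
  "L2 K = {u \<in> borel_measurable lebesgue.
             (\<forall>x. u x \<in> K) \<and> integrable lebesgue (\<lambda>x. (cmod (u x))\<^sup>2)}"

definition L2_inner :: "(real ^ 'd \<Rightarrow> complex) \<Rightarrow> (real ^ 'd \<Rightarrow> complex) \<Rightarrow> complex" where
  "L2_inner u v = (LINT x|lebesgue. u x * cnj (v x))"

definition L2_norm :: "(real ^ 'd \<Rightarrow> complex) \<Rightarrow> real" where
  "L2_norm u = sqrt (LINT x|lebesgue. (cmod (u x))\<^sup>2)"

definition L2_strong_conv ::
    "complex set \<Rightarrow> (nat \<Rightarrow> real ^ 'd \<Rightarrow> complex) \<Rightarrow> (real ^ 'd \<Rightarrow> complex) \<Rightarrow> bool" where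
  "L2_strong_conv K us u \<longleftrightarrow>
     (\<forall>n. us n \<in> L2 K) \<and> u \<in> L2 K \<and> (\<lambda>n. L2_norm (\<lambda>x. us n x - u x)) \<longlonglongrightarrow> 0"

definition L2_weak_conv ::
    "complex set \<Rightarrow> (nat \<Rightarrow> real ^ 'd \<Rightarrow> complex) \<Rightarrow> (real ^ 'd \<Rightarrow> complex) \<Rightarrow> bool" where
  "L2_weak_conv K us u \<longleftrightarrow>
     (\<forall>n. us n \<in> L2 K) \<and> u \<in> L2 K \<and>
     (\<forall>v\<in>L2 K. (\<lambda>n. L2_inner (us n) v) \<longlonglongrightarrow> L2_inner u v)"


section \<open>The unitary Fourier transform\<close>

definition fourier_integral :: "(real ^ 'd \<Rightarrow> complex) \<Rightarrow> real ^ 'd \<Rightarrow> complex" where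
  "fourier_integral f x =
     complex_of_real ((2 * pi) powr (- real CARD('d) / 2)) *
     (LINT y|lebesgue. iexp (- (x \<bullet> y)) * f y)"

text \<open>
  For square integrable \<open>u\<close> the Fourier integral need not converge. As usual, the Fourier
  transform is the \<open>L2\<close>-limit of the Fourier integrals of the (integrable) truncations of
  \<open>u\<close> to the balls of radius \<open>R\<close>; by Plancherel's theorem this limit exists. It is
  determined up to null sets, and \<open>SOME\<close> picks a representative.
\<close>

definition fourier :: "(real ^ 'd \<Rightarrow> complex) \<Rightarrow> real ^ 'd \<Rightarrow> complex" where
  "fourier u =
     (SOME v. L2_strong_conv UNIV
        (\<lambda>R::nat. fourier_integral (\<lambda>y. if y \<in> ball 0 (real R) then u y else 0)) v)"


section \<open>Closed forms and Mosco convergence\<close>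

text \<open>
  A form consists of its domain \<open>F\<close> and of \<open>E\<close>, of which only the values on \<open>F\<close> matter. The
  third and fourth conjuncts say that \<open>F\<close> and \<open>E\<close> are well defined on almost-everywhere
  classes. The domain is not required to be dense. The last conjunct is completeness of \<open>F\<close>
  with respect to \<open>E(u,u) + |u|\<^sup>2\<close>.
\<close>

definition closed_form ::
    "complex set \<Rightarrow> (real ^ 'd \<Rightarrow> complex) set \<Rightarrow>
     ((real ^ 'd \<Rightarrow> complex) \<Rightarrow> (real ^ 'd \<Rightarrow> complex) \<Rightarrow> complex) \<Rightarrow> bool" where
  "closed_form K F E \<longleftrightarrow>
     F \<subseteq> L2 K \<and>
     ((\<lambda>x. 0) \<in> F \<and> (\<forall>u\<in>F. \<forall>v\<in>F. (\<lambda>x. u x + v x) \<in> F) \<and> (\<forall>c\<in>K. \<forall>u\<in>F. (\<lambda>x. c * u x) \<in> F)) \<and>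
     (\<forall>u\<in>F. \<forall>u'\<in>L2 K. (AE x in lebesgue. u x = u' x) \<longrightarrow> u' \<in> F) \<and>
     (\<forall>u\<in>F. \<forall>u'\<in>F. \<forall>v\<in>F. (AE x in lebesgue. u x = u' x) \<longrightarrow> E u v = E u' v) \<and>
     (\<forall>u\<in>F. \<forall>v\<in>F. E u v \<in> K) \<and>
     (\<forall>u\<in>F. \<forall>v\<in>F. \<forall>w\<in>F. E (\<lambda>x. u x + v x) w = E u w + E v w) \<and>
     (\<forall>c\<in>K. \<forall>u\<in>F. \<forall>v\<in>F. E (\<lambda>x. c * u x) v = c * E u v) \<and>
     (\<forall>u\<in>F. \<forall>v\<in>F. E v u = cnj (E u v)) \<and>
     (\<forall>u\<in>F. 0 \<le> Re (E u u)) \<and>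
     (\<forall>us. (\<forall>n. us n \<in> F) \<and>
        (\<forall>e>0. \<exists>N. \<forall>m\<ge>N. \<forall>n\<ge>N.
           (let w = (\<lambda>x. us m x - us n x) in Re (E w w) + (L2_norm w)\<^sup>2 < e) ) \<longrightarrow>
        (\<exists>u\<in>F. (\<lambda>n. let w = (\<lambda>x. us n x - u x) in Re (E w w) + (L2_norm w)\<^sup>2) \<longlonglongrightarrow> 0))"

definition extended_form ::
    "(real ^ 'd \<Rightarrow> complex) set \<Rightarrow>
     ((real ^ 'd \<Rightarrow> complex) \<Rightarrow> (real ^ 'd \<Rightarrow> complex) \<Rightarrow> complex) \<Rightarrow>
     (real ^ 'd \<Rightarrow> complex) \<Rightarrow> ereal" where
  "extended_form F E u = (if u \<in> F then ereal (Re (E u u)) else \<infinity>)"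

definition mosco_convergent ::
    "complex set \<Rightarrow> (nat \<Rightarrow> (real ^ 'd \<Rightarrow> complex) set) \<Rightarrow>
     (nat \<Rightarrow> (real ^ 'd \<Rightarrow> complex) \<Rightarrow> (real ^ 'd \<Rightarrow> complex) \<Rightarrow> complex) \<Rightarrow>
     (real ^ 'd \<Rightarrow> complex) set \<Rightarrow>
     ((real ^ 'd \<Rightarrow> complex) \<Rightarrow> (real ^ 'd \<Rightarrow> complex) \<Rightarrow> complex) \<Rightarrow> bool" where
  "mosco_convergent K Fs Es F E \<longleftrightarrow>
     (\<forall>n. closed_form K (Fs n) (Es n)) \<and> closed_form K F E \<and>
     (\<forall>u\<in>L2 K. \<forall>us. L2_weak_conv K us u \<longrightarrow>
        extended_form F E u \<le> liminf (\<lambda>n. extended_form (Fs n) (Es n) (us n))) \<and>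
     (\<forall>u\<in>L2 K. \<exists>us. L2_strong_conv K us u \<and>
        limsup (\<lambda>n. extended_form (Fs n) (Es n) (us n)) \<le> extended_form F E u)"


section \<open>Forms given by a Fourier multiplier\<close>

definition multiplier_form ::
    "(real ^ 'd \<Rightarrow> real) \<Rightarrow> (real ^ 'd \<Rightarrow> complex) \<Rightarrow> (real ^ 'd \<Rightarrow> complex) \<Rightarrow> complex" where
  "multiplier_form \<phi> u v =
     (LINT x|lebesgue. fourier u x * cnj (fourier v x) * complex_of_real (\<phi> x))"

definition multiplier_domain ::
    "complex set \<Rightarrow> (real ^ 'd \<Rightarrow> real) \<Rightarrow> (real ^ 'd \<Rightarrow> complex) set" where
  "multiplier_domain K \<phi> =
     {u \<in> L2 K. (\<integral>\<^sup>+x. ennreal ((cmod (fourier u x))\<^sup>2 * \<phi> x) \<partial>lebesgue) < \<infinity>}"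

end

theory Submission
  imports Defs
begin

text \<open>
  Plancherel's theorem turns the statement into one about multiplication operators. For bounded
  \<open>f\<close> with bounded support, \<open>|f^|\<^sup>2\<close> integrated against a wide Gaussian equals the
  autocorrelation of \<open>f\<close> integrated against a narrow one, which tends to \<open>|f|\<^sup>2\<close>.

  For the lower bound write \<open>v\<close>, \<open>v\<^sub>n\<close> for the Fourier transforms of \<open>u\<close> and of a sequence
  weakly converging to \<open>u\<close>, let \<open>g\<close> be a bounded cutoff of \<open>v\<close> with compact support, and let
  \<open>\<psi>\<^sub>n \<le> \<phi>\<^sub>n\<close> be the clipped multipliers. Then
  \<open>\<integral>|v\<^sub>n|\<^sup>2 \<phi>\<^sub>n \<ge> 2 Re \<integral>v\<^sub>n g* \<psi>\<^sub>n - \<integral>|g|\<^sup>2 \<psi>\<^sub>n\<close>, and here one can pass to the limit because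
  \<open>g \<psi>\<^sub>n\<close> converges strongly. Removing cutoff and clipping gives the claim by monotone convergence.
  The recovery sequence has the cutoffs of \<open>v\<close> as Fourier transforms, with levels growing slowly
  enough for the error \<open>\<integral>|g|\<^sup>2 |\<phi>\<^sub>n - \<phi>|\<close> to vanish.
\<close>

section \<open>The space of square integrable functions\<close>

text \<open>L1 convergence on compact sets by itself gives no pointwise bound on the multipliers and
  says nothing at infinity. So energies are compared only through a \<open>g\<close> that is bounded
  and vanishes off a ball. Pairing with a weakly convergent sequence asks for more, namely a second
  factor that converges in L2, and this forces the clipping. The lower bound is a completed square:
  integrate \<open>|v\<^sub>n - g|^2 \<psi>\<^sub>n >= 0\<close>. The choice of scalar field shapes
  the rest. The transforms of real functions are exactly those with
  \<open>g (- x) = cnj (g x)\<close>, so the cutoff has to respect this symmetry, and the multiplier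
  has to be even for the form to be real. The limit \<open>\<phi>\<close> inherits nonnegativity and
  evenness only almost everywhere. Transforms are chosen representatives, so their algebraic rules
  hold almost everywhere. Mosco convergence includes closedness of all the forms involved, hence a
  completeness proof for a general multiplier form.\<close>

lemma L2_UNIV_iff:
  "u \<in> L2 UNIV \<longleftrightarrow> u \<in> borel_measurable lebesgue \<and> integrable lebesgue (\<lambda>x. (cmod (u x))\<^sup>2)"
  by (simp add: L2_def)

lemma L2_iff: "u \<in> L2 K \<longleftrightarrow> u \<in> L2 UNIV \<and> (\<forall>x. u x \<in> K)"
  by (auto simp: L2_def)

lemma L2_measurable: "u \<in> L2 K \<Longrightarrow> u \<in> borel_measurable lebesgue"
  by (simp add: L2_def)

lemma L2_integrable: "u \<in> L2 K \<Longrightarrow> integrable lebesgue (\<lambda>x. (cmod (u x))\<^sup>2)"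
  by (simp add: L2_def)

lemma L2_iff_nn_integral:
  assumes [measurable]: "u \<in> borel_measurable lebesgue"
  shows "u \<in> L2 UNIV \<longleftrightarrow> (\<integral>\<^sup>+x. ennreal ((cmod (u x))\<^sup>2) \<partial>lebesgue) < \<infinity>"
  by (auto simp: L2_UNIV_iff assms integrable_iff_bounded)

lemma nn_integral_L2:
  assumes "u \<in> L2 UNIV"
  shows "(\<integral>\<^sup>+x. ennreal ((cmod (u x))\<^sup>2) \<partial>lebesgue) = ennreal ((L2_norm u)\<^sup>2)"
  using nn_integral_eq_integral[OF L2_integrable[OF assms]] by (simp add: L2_norm_def)

lemma L2_norm_nonneg [simp]: "0 \<le> L2_norm u"
  by (simp add: L2_norm_def)

lemma L2_norm_power2: "(L2_norm u)\<^sup>2 = (LINT x|lebesgue. (cmod (u x))\<^sup>2)"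
  by (simp add: L2_norm_def)

lemma power2_norm_add_le: "(cmod (a + b))\<^sup>2 \<le> 2 * (cmod a)\<^sup>2 + 2 * (cmod b)\<^sup>2"
proof -
  have "(cmod (a + b))\<^sup>2 \<le> (cmod a + cmod b)\<^sup>2"
    by (intro power_mono norm_triangle_ineq) simp
  also have "\<dots> \<le> 2 * (cmod a)\<^sup>2 + 2 * (cmod b)\<^sup>2"
    using sum_squares_bound[of "cmod a" "cmod b"] by (simp add: power2_sum)
  finally show ?thesis .
qed

lemma L2_dominated:
  assumes "v \<in> L2 UNIV" and [measurable]: "u \<in> borel_measurable lebesgue"
    and "\<And>x. cmod (u x) \<le> cmod (v x)"
  shows "u \<in> L2 UNIV"
  unfolding L2_UNIV_iff
proof (intro conjI)
  show "integrable lebesgue (\<lambda>x. (cmod (u x))\<^sup>2)"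
    by (rule Bochner_Integration.integrable_bound[OF L2_integrable[OF assms(1)]])
      (use assms in \<open>auto intro: power_mono\<close>)
qed measurable

lemma L2_zero: "(\<lambda>x. 0) \<in> L2 UNIV"
  by (simp add: L2_UNIV_iff)

lemma L2_add:
  assumes "u \<in> L2 UNIV" "v \<in> L2 UNIV"
  shows "(\<lambda>x. u x + v x) \<in> L2 UNIV"
  unfolding L2_UNIV_iff
proof (intro conjI)
  note [measurable] = assms[THEN L2_measurable]
  show "(\<lambda>x. u x + v x) \<in> borel_measurable lebesgue" by measurable
  show "integrable lebesgue (\<lambda>x. (cmod (u x + v x))\<^sup>2)"
  proof (rule Bochner_Integration.integrable_bound)
    show "integrable lebesgue (\<lambda>x. 2 * (cmod (u x))\<^sup>2 + 2 * (cmod (v x))\<^sup>2)"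
      using assms by (auto simp: L2_UNIV_iff)
  qed (auto simp: power2_norm_add_le)
qed

lemma L2_cmult: "u \<in> L2 UNIV \<Longrightarrow> (\<lambda>x. c * u x) \<in> L2 UNIV"
  by (auto simp: L2_UNIV_iff norm_mult power_mult_distrib)

lemma L2_uminus: "u \<in> L2 UNIV \<Longrightarrow> (\<lambda>x. - u x) \<in> L2 UNIV"
  by (auto simp: L2_UNIV_iff)

lemma L2_diff: "u \<in> L2 UNIV \<Longrightarrow> v \<in> L2 UNIV \<Longrightarrow> (\<lambda>x. u x - v x) \<in> L2 UNIV"
  using L2_add[of u "\<lambda>x. - v x"] L2_uminus[of v] by simp

lemma borel_measurable_cnj [measurable]: "cnj \<in> borel_measurable borel"
  by (intro borel_measurable_continuous_onI continuous_intros)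

lemma L2_cnj: "u \<in> L2 UNIV \<Longrightarrow> (\<lambda>x. cnj (u x)) \<in> L2 UNIV"
  by (auto simp: L2_UNIV_iff)

lemma L2_norm_cnj: "L2_norm (\<lambda>x. cnj (u x)) = L2_norm u"
  by (simp add: L2_norm_def)

lemma L2_norm_cmult: "L2_norm (\<lambda>x. c * u x) = cmod c * L2_norm u"
  by (simp add: L2_norm_def norm_mult power_mult_distrib real_sqrt_mult)

lemma L2_norm_minus_commute: "L2_norm (\<lambda>x. u x - v x) = L2_norm (\<lambda>x. v x - u x)"
  by (simp add: L2_norm_def norm_minus_commute)

lemma L2_norm_cong_AE:
  assumes "AE x in lebesgue. u x = v x" "u \<in> L2 UNIV" "v \<in> L2 UNIV"
  shows "L2_norm u = L2_norm v"
proof -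
  note [measurable] = assms(2,3)[THEN L2_measurable]
  show ?thesis unfolding L2_norm_def using assms(1) by (intro arg_cong[where f=sqrt] integral_cong_AE) auto
qed

lemma L2_norm_eq_0_iff:
  assumes "u \<in> L2 UNIV"
  shows "L2_norm u = 0 \<longleftrightarrow> (AE x in lebesgue. u x = 0)"
  using integral_nonneg_eq_0_iff_AE[OF L2_integrable[OF assms]] by (simp add: L2_norm_def)

section \<open>Products of square integrable functions, Cauchy-Schwarz and the inner product\<close>

lemma integrable_L2_mult:
  assumes "u \<in> L2 UNIV" "v \<in> L2 UNIV"
  shows "integrable lebesgue (\<lambda>x. u x * v x)"
proof (rule Bochner_Integration.integrable_bound)
  note [measurable] = assms[THEN L2_measurable]
  show "integrable lebesgue (\<lambda>x. (cmod (u x))\<^sup>2 + (cmod (v x))\<^sup>2)"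
    using assms by (auto simp: L2_UNIV_iff)
  show "(\<lambda>x. u x * v x) \<in> borel_measurable lebesgue" by measurable
  have "cmod a * cmod b \<le> (cmod a)\<^sup>2 + (cmod b)\<^sup>2" for a b
    using sum_squares_bound[of "cmod a" "cmod b"] mult_nonneg_nonneg[OF norm_ge_zero norm_ge_zero, of a b]
    by linarith
  then show "AE x in lebesgue. norm (u x * v x) \<le> norm ((cmod (u x))\<^sup>2 + (cmod (v x))\<^sup>2)"
    by (simp add: norm_mult)
qed

lemma integral_norm_mult_le:
  assumes "u \<in> L2 UNIV" "v \<in> L2 UNIV"
  shows "(LINT x|lebesgue. cmod (u x) * cmod (v x)) \<le> L2_norm u * L2_norm v"
proof -
  note [measurable] = assms[THEN L2_measurable]
  have int: "integrable lebesgue (\<lambda>x. cmod (u x) * cmod (v x))"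
    using integrable_norm[OF integrable_L2_mult[OF assms]] by (simp add: norm_mult)
  have "(ennreal (LINT x|lebesgue. cmod (u x) * cmod (v x)))\<^sup>2 =
      (\<integral>\<^sup>+x. ennreal (cmod (u x)) * ennreal (cmod (v x)) \<partial>lebesgue)\<^sup>2"
    by (subst nn_integral_eq_integral[OF int, symmetric]) (simp_all add: ennreal_mult)
  also have "\<dots> \<le> (\<integral>\<^sup>+x. ennreal (cmod (u x)) ^ 2 \<partial>lebesgue) * (\<integral>\<^sup>+x. ennreal (cmod (v x)) ^ 2 \<partial>lebesgue)"
    by (intro Cauchy_Schwarz_nn_integral) auto
  also have "\<dots> = ennreal ((L2_norm u)\<^sup>2) * ennreal ((L2_norm v)\<^sup>2)"
    by (simp add: ennreal_power nn_integral_L2 assms)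
  finally have "(LINT x|lebesgue. cmod (u x) * cmod (v x))\<^sup>2 \<le> (L2_norm u * L2_norm v)\<^sup>2"
    by (simp add: ennreal_power ennreal_mult[symmetric] power_mult_distrib)
  then show ?thesis by (rule power2_le_imp_le) simp
qed

lemma L2_Cauchy_Schwarz:
  assumes "u \<in> L2 UNIV" "v \<in> L2 UNIV"
  shows "cmod (LINT x|lebesgue. u x * v x) \<le> L2_norm u * L2_norm v"
  using integral_norm_bound[of lebesgue "\<lambda>x. u x * v x"] integral_norm_mult_le[OF assms]
  by (simp add: norm_mult)

lemma norm_L2_inner_le:
  assumes "u \<in> L2 UNIV" "v \<in> L2 UNIV"
  shows "cmod (L2_inner u v) \<le> L2_norm u * L2_norm v"
  using L2_Cauchy_Schwarz[OF assms(1) L2_cnj[OF assms(2)]] by (simp add: L2_inner_def L2_norm_cnj)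

lemma L2_norm_triangle:
  assumes "u \<in> L2 UNIV" "v \<in> L2 UNIV"
  shows "L2_norm (\<lambda>x. u x + v x) \<le> L2_norm u + L2_norm v"
proof (rule power2_le_imp_le)
  have int: "integrable lebesgue (\<lambda>x. cmod (u x) * cmod (v x))"
    using integrable_norm[OF integrable_L2_mult[OF assms]] by (simp add: norm_mult)
  have "(L2_norm (\<lambda>x. u x + v x))\<^sup>2 \<le>
      (LINT x|lebesgue. (cmod (u x))\<^sup>2 + (cmod (v x))\<^sup>2 + 2 * (cmod (u x) * cmod (v x)))"
    unfolding L2_norm_power2
  proof (intro integral_mono)
    fix x
    have "(cmod (u x + v x))\<^sup>2 \<le> (cmod (u x) + cmod (v x))\<^sup>2"
      by (intro power_mono norm_triangle_ineq) simp
    then show "(cmod (u x + v x))\<^sup>2 \<le> (cmod (u x))\<^sup>2 + (cmod (v x))\<^sup>2 + 2 * (cmod (u x) * cmod (v x))"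
      by (simp add: power2_sum)
  qed (use L2_integrable[OF L2_add[OF assms]] assms[THEN L2_integrable] int in auto)
  also have "\<dots> = (L2_norm u)\<^sup>2 + (L2_norm v)\<^sup>2 + 2 * (LINT x|lebesgue. cmod (u x) * cmod (v x))"
    using assms[THEN L2_integrable] int by (simp add: L2_norm_power2)
  also have "\<dots> \<le> (L2_norm u + L2_norm v)\<^sup>2"
    using integral_norm_mult_le[OF assms] by (simp add: power2_sum)
  finally show "(L2_norm (\<lambda>x. u x + v x))\<^sup>2 \<le> (L2_norm u + L2_norm v)\<^sup>2" .
qed simp

lemma L2_norm_triangle_diff:
  assumes "u \<in> L2 UNIV" "v \<in> L2 UNIV" "w \<in> L2 UNIV"
  shows "L2_norm (\<lambda>x. u x - w x) \<le> L2_norm (\<lambda>x. u x - v x) + L2_norm (\<lambda>x. v x - w x)"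
  using L2_norm_triangle[OF L2_diff[OF assms(1,2)] L2_diff[OF assms(2,3)]] by simp

lemma L2_norm_diff_ge:
  assumes "u \<in> L2 UNIV" "v \<in> L2 UNIV"
  shows "\<bar>L2_norm u - L2_norm v\<bar> \<le> L2_norm (\<lambda>x. u x - v x)"
  using L2_norm_triangle_diff[OF assms L2_zero] L2_norm_triangle_diff[OF assms(2,1) L2_zero]
  by (simp add: L2_norm_minus_commute[of v u])

lemma L2_inner_self: "L2_inner u u = of_real ((L2_norm u)\<^sup>2)"
  unfolding L2_inner_def L2_norm_power2 integral_complex_of_real[symmetric]
  by (intro Bochner_Integration.integral_cong) (auto simp: complex_norm_square[symmetric])

lemma L2_inner_diff_left:
  assumes "u \<in> L2 UNIV" "v \<in> L2 UNIV" "w \<in> L2 UNIV"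
  shows "L2_inner (\<lambda>x. u x - v x) w = L2_inner u w - L2_inner v w"
  using assms by (simp add: L2_inner_def left_diff_distrib integrable_L2_mult L2_cnj)

lemma L2_inner_add_left:
  assumes "u \<in> L2 UNIV" "v \<in> L2 UNIV" "w \<in> L2 UNIV"
  shows "L2_inner (\<lambda>x. u x + v x) w = L2_inner u w + L2_inner v w"
  using assms by (simp add: L2_inner_def distrib_right integrable_L2_mult L2_cnj)

lemma L2_inner_cmult_left: "L2_inner (\<lambda>x. c * u x) w = c * L2_inner u w"
  by (simp add: L2_inner_def mult.assoc)

lemma L2_inner_commute: "L2_inner v u = cnj (L2_inner u v)"
  using Bochner_Integration.integral_cnj[of lebesgue "\<lambda>x. u x * cnj (v x)"] by (simp add: L2_inner_def mult.commute)

text \<open>Applied to an image under the Fourier transform, this expansion turns isometry of the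
  transform and of its adjoint into surjectivity.\<close>

lemma L2_norm_diff_power2:
  assumes "u \<in> L2 UNIV" "v \<in> L2 UNIV"
  shows "(L2_norm (\<lambda>x. u x - v x))\<^sup>2 = (L2_norm u)\<^sup>2 - 2 * Re (L2_inner u v) + (L2_norm v)\<^sup>2"
proof -
  let ?d = "\<lambda>x. u x - v x"
  have d: "?d \<in> L2 UNIV" using assms by (rule L2_diff)
  have "complex_of_real ((L2_norm ?d)\<^sup>2) = L2_inner u ?d - L2_inner v ?d"
    using assms d by (simp only: L2_inner_self[symmetric] L2_inner_diff_left)
  also have "L2_inner u ?d = cnj (L2_inner u u) - cnj (L2_inner v u)"
    using assms d by (subst L2_inner_commute) (simp add: L2_inner_diff_left)
  also have "L2_inner v ?d = cnj (L2_inner u v) - cnj (L2_inner v v)"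
    using assms d by (subst L2_inner_commute) (simp add: L2_inner_diff_left)
  finally have "Re (complex_of_real ((L2_norm ?d)\<^sup>2)) =
      Re (L2_inner u u) - Re (L2_inner v u) - Re (L2_inner u v) + Re (L2_inner v v)"
    by simp
  moreover have "Re (L2_inner v u) = Re (L2_inner u v)"
    by (subst L2_inner_commute) simp
  ultimately show ?thesis by (simp add: L2_inner_self)
qed

subsection \<open>Completeness\<close>

text \<open>With steps of norm at most \<open>2^-k\<close>, the sum of \<open>2^k |d k|^2\<close> is
  still integrable, hence finite almost everywhere, and \<open>|d| <= 2^-k + 2^k |d|^2\<close> turns
  this into absolute summability of the steps. The weight \<open>2^k\<close> replaces Minkowski's
  inequality for infinite sums.\<close>

lemma L2_Cauchy_AE_subseq:
  assumes us: "\<And>n. us n \<in> L2 UNIV"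
    and cauchy: "\<And>e. e > 0 \<Longrightarrow> \<exists>N. \<forall>m\<ge>N. \<forall>n\<ge>N. L2_norm (\<lambda>x. us m x - us n x) < e"
  obtains r where "strict_mono (r :: nat \<Rightarrow> nat)" "AE x in lebesgue. convergent (\<lambda>k. us (r k) x)"
proof -
  have ex: "\<exists>N. \<forall>m\<ge>N. \<forall>n\<ge>N. L2_norm (\<lambda>x. us m x - us n x) < (1/2)^k" for k
    by (rule cauchy) simp
  then obtain N where N: "\<And>k m n. m \<ge> N k \<Longrightarrow> n \<ge> N k \<Longrightarrow> L2_norm (\<lambda>x. us m x - us n x) < (1/2)^k"
    by metis
  have "\<exists>r. \<forall>k. r k \<ge> N k \<and> r k < r (Suc k)"
  proof (rule dependent_nat_choice)
    show "\<exists>y. N (Suc k) \<le> y \<and> x < y" for x k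
      by (rule exI[of _ "N (Suc k) + Suc x"]) simp
  qed auto
  then obtain r where r: "\<And>k. r k \<ge> N k" "\<And>k. r k < r (Suc k)" by auto
  have mono: "strict_mono r" using r(2) by (rule strict_mono_Suc_iff[THEN iffD2, rule_format])
  define d where "d k x = us (r (Suc k)) x - us (r k) x" for k x
  have d: "d k \<in> L2 UNIV" for k unfolding d_def by (intro L2_diff us)
  note [measurable] = L2_measurable[OF d]
  have dn: "L2_norm (d k) \<le> (1/2)^k" for k
  proof -
    have "r (Suc k) \<ge> N k" using r(1)[of k] r(2)[of k] by simp
    then show ?thesis unfolding d_def using N r(1)[of k] less_imp_le by blast
  qed
  have "(\<integral>\<^sup>+x. (\<Sum>k. ennreal (2^k * (cmod (d k x))\<^sup>2)) \<partial>lebesgue) =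
      (\<Sum>k. (\<integral>\<^sup>+x. ennreal (2^k * (cmod (d k x))\<^sup>2) \<partial>lebesgue))"
    by (intro nn_integral_suminf) auto
  also have "\<dots> = (\<Sum>k. ennreal (2^k * (L2_norm (d k))\<^sup>2))"
    by (intro suminf_cong) (simp add: ennreal_mult nn_integral_cmult nn_integral_L2[OF d])
  also have "\<dots> \<le> (\<Sum>k. ennreal ((1/2)^k))"
  proof (intro suminf_le allI ennreal_leI)
    fix k
    have "(2::real)^k * (L2_norm (d k))\<^sup>2 \<le> 2^k * ((1/2)^k)\<^sup>2"
      by (intro mult_left_mono power_mono dn) auto
    also have "\<dots> = (1/2)^k" by (simp add: power2_eq_square power_divide)
    finally show "2^k * (L2_norm (d k))\<^sup>2 \<le> (1/2)^k" .
  qed auto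
  also have "\<dots> < \<infinity>"
    by (subst suminf_ennreal2) (auto simp: summable_geometric)
  finally have fin: "AE x in lebesgue. (\<Sum>k. ennreal (2^k * (cmod (d k x))\<^sup>2)) \<noteq> \<infinity>"
    by (intro nn_integral_PInf_AE) auto
  have "AE x in lebesgue. convergent (\<lambda>k. us (r k) x)"
    using fin
  proof eventually_elim
    case (elim x)
    have s1: "summable (\<lambda>k. 2^k * (cmod (d k x))\<^sup>2)"
      by (rule summable_suminf_not_top) (use elim in auto)
    have "summable (\<lambda>k. (1/2)^k + 2^k * (cmod (d k x))\<^sup>2)"
      by (intro summable_add s1 summable_geometric) auto
    then have "summable (\<lambda>k. d k x)"
    proof (rule summable_comparison_test'[where N=0])
      fix k
      have "0 \<le> (1 - 2^k * cmod (d k x))\<^sup>2" by simp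
      then have "2 * (2^k * cmod (d k x)) \<le> 1 + 2^k * (2^k * (cmod (d k x))\<^sup>2)"
        by (simp add: power2_diff power_mult_distrib power2_eq_square algebra_simps)
      moreover have "2^k * cmod (d k x) \<ge> 0" by simp
      ultimately have "2^k * cmod (d k x) \<le> 1 + 2^k * (2^k * (cmod (d k x))\<^sup>2)" by linarith
      also have "\<dots> = 2^k * ((1/2)^k + 2^k * (cmod (d k x))\<^sup>2)"
        by (simp add: distrib_left power_divide)
      finally show "norm (d k x) \<le> (1/2)^k + 2^k * (cmod (d k x))\<^sup>2"
        by (simp add: mult_le_cancel_left_pos)
    qed
    then have "convergent (\<lambda>n. \<Sum>k<n. d k x)" by (simp add: summable_iff_convergent)
    moreover have "(\<Sum>k<n. d k x) = us (r n) x - us (r 0) x" for n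
      using sum_lessThan_telescope[of "\<lambda>k. us (r k) x" n] by (simp add: d_def)
    ultimately have "convergent (\<lambda>n. us (r n) x - us (r 0) x)" by simp
    then have "convergent (\<lambda>n. (us (r n) x - us (r 0) x) + us (r 0) x)"
      by (intro convergent_add convergent_const)
    then show ?case by simp
  qed
  with mono show thesis by (rule that)
qed

lemma L2_AE_limit_Fatou:
  assumes us: "\<And>n. us n \<in> L2 UNIV" and [measurable]: "u \<in> borel_measurable lebesgue"
    and lim: "AE x in lebesgue. (\<lambda>n. us n x) \<longlonglongrightarrow> u x"
    and bd: "\<forall>\<^sub>F n in sequentially. L2_norm (us n) \<le> B"
  shows "u \<in> L2 UNIV" "L2_norm u \<le> B"
proof -
  note [measurable] = L2_measurable[OF us]
  have B: "0 \<le> B"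
    using eventually_happens[OF bd] order_trans[OF L2_norm_nonneg] by auto
  have "(\<integral>\<^sup>+x. ennreal ((cmod (u x))\<^sup>2) \<partial>lebesgue) =
      (\<integral>\<^sup>+x. liminf (\<lambda>n. ennreal ((cmod (us n x))\<^sup>2)) \<partial>lebesgue)"
  proof (rule nn_integral_cong_AE, use lim in eventually_elim)
    case (elim x)
    then have "(\<lambda>n. ennreal ((cmod (us n x))\<^sup>2)) \<longlonglongrightarrow> ennreal ((cmod (u x))\<^sup>2)"
      by (intro tendsto_intros)
    then show ?case by (rule lim_imp_Liminf[OF trivial_limit_sequentially, symmetric])
  qed
  also have "\<dots> \<le> liminf (\<lambda>n. (\<integral>\<^sup>+x. ennreal ((cmod (us n x))\<^sup>2) \<partial>lebesgue))"
    by (intro nn_integral_liminf) auto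
  also have "\<dots> \<le> liminf (\<lambda>n. ennreal (B\<^sup>2))"
    by (intro Liminf_mono eventually_mono[OF bd])
      (auto simp: nn_integral_L2[OF us] intro!: ennreal_leI power_mono)
  finally have le: "(\<integral>\<^sup>+x. ennreal ((cmod (u x))\<^sup>2) \<partial>lebesgue) \<le> ennreal (B\<^sup>2)"
    by (simp add: Liminf_const)
  then show u: "u \<in> L2 UNIV"
    by (simp add: L2_iff_nn_integral le_less_trans)
  have "(L2_norm u)\<^sup>2 \<le> B\<^sup>2" using le by (simp add: nn_integral_L2[OF u])
  with B show "L2_norm u \<le> B" by (rule power2_le_imp_le[rotated])
qed

text \<open>Fatou in the second index: for fixed \<open>n\<close>, the bound on
  \<open>us n - us (r k)\<close> survives the limit in \<open>k\<close>. The almost everywhere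
  convergent subsequence is returned too, because closedness of the forms needs it on the Fourier
  side.\<close>

lemma L2_complete_AE:
  assumes us: "\<And>n. us n \<in> L2 UNIV"
    and cauchy: "\<And>e. e > 0 \<Longrightarrow> \<exists>N. \<forall>m\<ge>N. \<forall>n\<ge>N. L2_norm (\<lambda>x. us m x - us n x) < e"
  obtains u r where "L2_strong_conv UNIV us u" "strict_mono (r :: nat \<Rightarrow> nat)"
    "AE x in lebesgue. (\<lambda>k. us (r k) x) \<longlonglongrightarrow> u x"
proof -
  obtain r where r: "strict_mono r" and conv: "AE x in lebesgue. convergent (\<lambda>k. us (r k) x)"
    using L2_Cauchy_AE_subseq[OF assms] by blast
  note [measurable] = L2_measurable[OF us]
  \<comment> \<open>On the null set where the subsequence diverges, \<open>lim\<close> has some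
    unspecified value; only measurability matters there.\<close>
  define u where "u x = lim (\<lambda>k. us (r k) x)" for x
  have um [measurable]: "u \<in> borel_measurable lebesgue" unfolding u_def by measurable
  have lim: "AE x in lebesgue. (\<lambda>k. us (r k) x) \<longlonglongrightarrow> u x"
    using conv by eventually_elim (simp add: u_def convergent_LIMSEQ_iff)
  have key: "(\<lambda>x. us n x - u x) \<in> L2 UNIV \<and> L2_norm (\<lambda>x. us n x - u x) \<le> e"
    if N: "\<forall>m\<ge>N. \<forall>n\<ge>N. L2_norm (\<lambda>x. us m x - us n x) < e" and n: "n \<ge> N" for n N e
  proof -
    have 1: "(\<lambda>x. us n x - us (r k) x) \<in> L2 UNIV" for k by (intro L2_diff us)
    have 2: "AE x in lebesgue. (\<lambda>k. us n x - us (r k) x) \<longlonglongrightarrow> us n x - u x"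
      using lim by eventually_elim (intro tendsto_intros)
    have 3: "\<forall>\<^sub>F k in sequentially. L2_norm (\<lambda>x. us n x - us (r k) x) \<le> e"
      using eventually_ge_at_top[of N]
    proof eventually_elim
      case (elim k)
      then have "r k \<ge> N" using seq_suble[OF r, of k] by simp
      then show ?case using N n less_imp_le by blast
    qed
    show ?thesis using L2_AE_limit_Fatou[OF 1 _ 2 3] by simp
  qed
  obtain N1 where "\<forall>m\<ge>N1. \<forall>n\<ge>N1. L2_norm (\<lambda>x. us m x - us n x) < 1"
    using cauchy[of 1] by auto
  from key[OF this order_refl] have "(\<lambda>x. us N1 x - u x) \<in> L2 UNIV" by simp
  from L2_diff[OF us[of N1] this] have u: "u \<in> L2 UNIV" by simp
  have "(\<lambda>n. L2_norm (\<lambda>x. us n x - u x)) \<longlonglongrightarrow> 0"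
  proof (rule LIMSEQ_I)
    fix e :: real assume "e > 0"
    then obtain N where "\<forall>m\<ge>N. \<forall>n\<ge>N. L2_norm (\<lambda>x. us m x - us n x) < e / 2"
      using cauchy[of "e / 2"] by auto
    from key[OF this] \<open>e > 0\<close> show "\<exists>N. \<forall>n\<ge>N. norm (L2_norm (\<lambda>x. us n x - u x) - 0) < e"
      by (intro exI[of _ N]) force
  qed
  then have "L2_strong_conv UNIV us u" by (simp add: L2_strong_conv_def us u)
  then show thesis using r lim by (rule that)
qed

section \<open>Properties of strong convergence; real-valued limits\<close>

lemma L2_strong_conv_Cauchy:
  assumes "L2_strong_conv UNIV us u" "e > 0"
  shows "\<exists>N. \<forall>m\<ge>N. \<forall>n\<ge>N. L2_norm (\<lambda>x. us m x - us n x) < e"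
proof -
  from assms have us: "\<And>n. us n \<in> L2 UNIV" and u: "u \<in> L2 UNIV"
    and lim: "(\<lambda>n. L2_norm (\<lambda>x. us n x - u x)) \<longlonglongrightarrow> 0"
    by (auto simp: L2_strong_conv_def)
  obtain N where N: "\<And>n. n \<ge> N \<Longrightarrow> L2_norm (\<lambda>x. us n x - u x) < e / 2"
    using order_tendstoD(2)[OF lim, of "e / 2"] assms(2) by (auto simp: eventually_sequentially)
  have "L2_norm (\<lambda>x. us m x - us n x) < e" if "m \<ge> N" "n \<ge> N" for m n
    using L2_norm_triangle_diff[OF us[of m] u us[of n]] N[OF that(1)] N[OF that(2)]
    by (simp add: L2_norm_minus_commute[of u])
  then show ?thesis by blast
qed

text \<open>Linearity and the conjugation rule for \<open>fourier\<close> are proved through this: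
  both sides are strong limits of the same Fourier integrals, whatever representative was
  chosen.\<close>

lemma L2_strong_conv_unique:
  assumes "L2_strong_conv UNIV us u" "L2_strong_conv UNIV us v"
  shows "AE x in lebesgue. u x = v x"
proof -
  from assms have us: "\<And>n. us n \<in> L2 UNIV" and u: "u \<in> L2 UNIV" and v: "v \<in> L2 UNIV"
    and lim: "(\<lambda>n. L2_norm (\<lambda>x. us n x - u x)) \<longlonglongrightarrow> 0" "(\<lambda>n. L2_norm (\<lambda>x. us n x - v x)) \<longlonglongrightarrow> 0"
    by (auto simp: L2_strong_conv_def)
  have "L2_norm (\<lambda>x. u x - v x) \<le> L2_norm (\<lambda>x. us n x - u x) + L2_norm (\<lambda>x. us n x - v x)" for n
    using L2_norm_triangle_diff[OF u us[of n] v] by (simp add: L2_norm_minus_commute[of u])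
  then have "L2_norm (\<lambda>x. u x - v x) \<le> 0 + 0"
    by (intro LIMSEQ_le_const[OF tendsto_add[OF lim]]) auto
  then have "L2_norm (\<lambda>x. u x - v x) = 0" using L2_norm_nonneg[of "\<lambda>x. u x - v x"] by linarith
  then show ?thesis using L2_norm_eq_0_iff[OF L2_diff[OF u v]] by simp
qed

lemma L2_strong_conv_add:
  assumes "L2_strong_conv UNIV us u" "L2_strong_conv UNIV vs v"
  shows "L2_strong_conv UNIV (\<lambda>n x. us n x + vs n x) (\<lambda>x. u x + v x)"
proof -
  have "(\<lambda>n. L2_norm (\<lambda>x. (us n x + vs n x) - (u x + v x))) \<longlonglongrightarrow> 0"
  proof (rule tendsto_sandwich[OF _ _ tendsto_const])
    show "(\<lambda>n. L2_norm (\<lambda>x. us n x - u x) + L2_norm (\<lambda>x. vs n x - v x)) \<longlonglongrightarrow> 0"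
      using tendsto_add[of _ 0 sequentially _ 0] assms by (auto simp: L2_strong_conv_def)
    have "L2_norm (\<lambda>x. (us n x + vs n x) - (u x + v x)) \<le> L2_norm (\<lambda>x. us n x - u x) + L2_norm (\<lambda>x. vs n x - v x)" for n
      using L2_norm_triangle[OF L2_diff L2_diff, of "us n" u "vs n" v] assms
      by (simp add: L2_strong_conv_def algebra_simps)
    then show "\<forall>\<^sub>F n in sequentially. L2_norm (\<lambda>x. (us n x + vs n x) - (u x + v x)) \<le> L2_norm (\<lambda>x. us n x - u x) + L2_norm (\<lambda>x. vs n x - v x)"
      by simp
  qed simp
  with assms show ?thesis by (auto simp: L2_strong_conv_def L2_add)
qed

lemma L2_strong_conv_cmult:
  assumes "L2_strong_conv UNIV us u"
  shows "L2_strong_conv UNIV (\<lambda>n x. c * us n x) (\<lambda>x. c * u x)"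
proof -
  have "(\<lambda>n. cmod c * L2_norm (\<lambda>x. us n x - u x)) \<longlonglongrightarrow> 0"
    using assms by (auto simp: L2_strong_conv_def intro!: tendsto_mult_right_zero)
  then have "(\<lambda>n. L2_norm (\<lambda>x. c * us n x - c * u x)) \<longlonglongrightarrow> 0"
    using L2_norm_cmult[of c "\<lambda>x. us _ x - u x"] by (simp add: right_diff_distrib)
  with assms show ?thesis by (auto simp: L2_strong_conv_def L2_cmult)
qed

lemma L2_strong_conv_norm:
  assumes "L2_strong_conv UNIV us u"
  shows "(\<lambda>n. L2_norm (us n)) \<longlonglongrightarrow> L2_norm u"
proof (rule LIM_zero_cancel, rule Lim_null_comparison)
  show "\<forall>\<^sub>F n in sequentially. norm (L2_norm (us n) - L2_norm u) \<le> L2_norm (\<lambda>x. us n x - u x)"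
    using assms L2_norm_diff_ge[of "us _" u] by (auto simp: L2_strong_conv_def)
qed (use assms in \<open>simp add: L2_strong_conv_def\<close>)

text \<open>Bilinear, without a conjugate, because the multiplication formula for the Fourier
  transform is.\<close>

lemma L2_strong_conv_integral_mult:
  assumes "L2_strong_conv UNIV us u" "L2_strong_conv UNIV vs v"
  shows "(\<lambda>n. LINT x|lebesgue. us n x * vs n x) \<longlonglongrightarrow> (LINT x|lebesgue. u x * v x)"
proof -
  from assms have us: "\<And>n. us n \<in> L2 UNIV" and u: "u \<in> L2 UNIV"
    and vs: "\<And>n. vs n \<in> L2 UNIV" and v: "v \<in> L2 UNIV"
    by (auto simp: L2_strong_conv_def)
  have "(\<lambda>n. (LINT x|lebesgue. us n x * vs n x) - (LINT x|lebesgue. u x * v x)) \<longlonglongrightarrow> 0"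
  proof (rule Lim_null_comparison)
    show "(\<lambda>n. L2_norm (\<lambda>x. us n x - u x) * L2_norm (vs n) + L2_norm u * L2_norm (\<lambda>x. vs n x - v x)) \<longlonglongrightarrow> 0"
      using assms L2_strong_conv_norm[OF assms(2)]
      by (auto simp: L2_strong_conv_def intro!: tendsto_eq_intros)
    have "(LINT x|lebesgue. us n x * vs n x) - (LINT x|lebesgue. u x * v x) =
      (LINT x|lebesgue. (us n x - u x) * vs n x) + (LINT x|lebesgue. u x * (vs n x - v x))" for n
      by (simp add: us u vs v integrable_L2_mult left_diff_distrib right_diff_distrib)
    moreover have "cmod (LINT x|lebesgue. (us n x - u x) * vs n x) \<le> L2_norm (\<lambda>x. us n x - u x) * L2_norm (vs n)" for n
      by (intro L2_Cauchy_Schwarz L2_diff us u vs)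
    moreover have "cmod (LINT x|lebesgue. u x * (vs n x - v x)) \<le> L2_norm u * L2_norm (\<lambda>x. vs n x - v x)" for n
      by (intro L2_Cauchy_Schwarz L2_diff vs u v)
    ultimately show "\<forall>\<^sub>F n in sequentially. norm ((LINT x|lebesgue. us n x * vs n x) - (LINT x|lebesgue. u x * v x)) \<le>
       L2_norm (\<lambda>x. us n x - u x) * L2_norm (vs n) + L2_norm u * L2_norm (\<lambda>x. vs n x - v x)"
      by (intro always_eventually allI) (simp only:, intro norm_triangle_le add_mono)
  qed
  then show ?thesis by (rule LIM_zero_cancel)
qed

text \<open>Taking real parts is a contraction that fixes real functions, so a complex limit of real
  functions can be made real at every point, as \<open>L2 \<real>\<close> demands.\<close>

lemma L2_norm_Re_diff_le:
  assumes "u \<in> L2 UNIV" "v \<in> L2 \<real>"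
  shows "(\<lambda>x. complex_of_real (Re (u x))) \<in> L2 \<real>"
    "L2_norm (\<lambda>x. v x - complex_of_real (Re (u x))) \<le> L2_norm (\<lambda>x. v x - u x)"
proof -
  note [measurable] = L2_measurable[OF assms(1)]
  have R: "(\<lambda>x. complex_of_real (Re (u x))) \<in> L2 UNIV"
    by (rule L2_dominated[OF assms(1)]) (auto simp: abs_Re_le_cmod)
  then show "(\<lambda>x. complex_of_real (Re (u x))) \<in> L2 \<real>" by (subst L2_iff) auto
  have v: "v \<in> L2 UNIV" using assms(2) by (subst (asm) L2_iff) simp
  have "cmod (v x - complex_of_real (Re (u x))) \<le> cmod (v x - u x)" for x
  proof -
    have "v x \<in> \<real>" using assms(2) by (auto simp: L2_def)
    then have "v x - complex_of_real (Re (u x)) = of_real (Re (v x - u x))"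
      by (auto elim!: Reals_cases)
    then show ?thesis by (metis abs_Re_le_cmod norm_of_real)
  qed
  then show "L2_norm (\<lambda>x. v x - complex_of_real (Re (u x))) \<le> L2_norm (\<lambda>x. v x - u x)"
    unfolding L2_norm_def
    by (intro real_sqrt_le_mono integral_mono L2_integrable[OF L2_diff[OF v R]]
        L2_integrable[OF L2_diff[OF v assms(1)]] power_mono) auto
qed

lemma L2_complete:
  assumes K: "K = UNIV \<or> K = \<real>" and us: "\<And>n. us n \<in> L2 K"
    and cauchy: "\<And>e. e > 0 \<Longrightarrow> \<exists>N. \<forall>m\<ge>N. \<forall>n\<ge>N. L2_norm (\<lambda>x. us m x - us n x) < e"
  obtains u where "L2_strong_conv K us u"
proof -
  have us': "us n \<in> L2 UNIV" for n using us[of n] by (subst (asm) L2_iff) simp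
  obtain u where u: "L2_strong_conv UNIV us u"
    using L2_complete_AE[OF us' cauchy] by blast
  show thesis
  proof (cases "K = UNIV")
    case False
    then have K: "K = \<real>" using K by simp
    let ?v = "\<lambda>x. complex_of_real (Re (u x))"
    have "(\<lambda>n. L2_norm (\<lambda>x. us n x - ?v x)) \<longlonglongrightarrow> 0"
      by (rule tendsto_sandwich[of "\<lambda>_. 0" _ _ "\<lambda>n. L2_norm (\<lambda>x. us n x - u x)"])
        (use u L2_norm_Re_diff_le(2)[of u "us _"] us in \<open>auto simp: K L2_strong_conv_def\<close>)
    then have "L2_strong_conv K us ?v"
      using us L2_norm_Re_diff_le(1)[of u "us 0"] u by (auto simp: L2_strong_conv_def K)
    then show thesis by (rule that)
  qed (use u that in auto)
qed

subsection \<open>Weak convergence\<close>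

text \<open>
  Uniform boundedness without Baire's theorem: with steps of length \<open>3\<^sup>-\<^sup>k\<close> along a sequence of
  norm larger than \<open>4\<^sup>k\<close>, the sign of each step can be chosen such that the limit has unbounded
  inner products with the sequence.
\<close>

lemma L2_uniform_boundedness:
  assumes us: "\<And>n. us n \<in> L2 UNIV"
    and bd: "\<And>v. v \<in> L2 UNIV \<Longrightarrow> \<exists>C. \<forall>n. cmod (L2_inner (us n) v) \<le> C"
  shows "\<exists>B. \<forall>n::nat. L2_norm (us n) \<le> B"
proof (rule ccontr)
  assume "\<not> ?thesis"
  then have "\<forall>k. \<exists>n. L2_norm (us n) > 4^k" by (metis not_le)
  then obtain m where m: "\<And>k. L2_norm (us (m k)) > 4^k" by metis
  define w where "w k = us (m k)" for k :: nat
  have w: "w k \<in> L2 UNIV" for k by (simp add: w_def us)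
  have wn: "L2_norm (w k) > 4^k" for k by (simp add: w_def m)
  have wpos: "L2_norm (w k) > 0" for k using wn[of k] by (rule less_trans[rotated]) simp
  define a where "a k = (1/3)^k / L2_norm (w k)" for k
  define s where "s k f = (if cmod (L2_inner (w k) (\<lambda>x. f x + of_real (a k) * w k x)) \<ge> (1/3)^k * L2_norm (w k)
      then a k else - a k)" for k f
  define v where "v = rec_nat (\<lambda>x. 0) (\<lambda>k f x. f x + of_real (s k f) * w k x)"
  have v0: "v 0 = (\<lambda>x. 0)" and vS: "v (Suc k) = (\<lambda>x. v k x + of_real (s k (v k)) * w k x)" for k
    by (simp_all add: v_def)
  have v: "v k \<in> L2 UNIV" for k
    by (induction k) (auto simp: v0 vS intro!: L2_zero L2_add[OF _ L2_cmult[OF w]])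
  have large: "cmod (L2_inner (w k) (v (Suc k))) \<ge> (1/3)^k * L2_norm (w k)" for k
  proof (cases "s k (v k) = a k \<and> cmod (L2_inner (w k) (\<lambda>x. v k x + of_real (a k) * w k x)) \<ge> (1/3)^k * L2_norm (w k)")
    case False
    then have s: "s k (v k) = - a k"
      and lt: "cmod (L2_inner (w k) (\<lambda>x. v k x + of_real (a k) * w k x)) < (1/3)^k * L2_norm (w k)"
      by (auto simp: s_def split: if_splits)
    have comm: "cmod (L2_inner (w k) f) = cmod (L2_inner f (w k))" for f
      by (subst L2_inner_commute) simp
    have ex: "L2_inner (\<lambda>x. v k x + of_real c * w k x) (w k) = L2_inner (v k) (w k) + of_real (c * (L2_norm (w k))\<^sup>2)" for c
      by (simp add: L2_inner_add_left L2_inner_cmult_left L2_inner_self v w L2_cmult)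
    let ?p = "L2_inner (v k) (w k)" let ?q = "complex_of_real (a k * (L2_norm (w k))\<^sup>2)"
    have q: "cmod ?q = (1/3)^k * L2_norm (w k)"
      using wpos[of k] by (simp add: a_def power2_eq_square norm_mult norm_divide norm_power)
    \<comment> \<open>The two candidate inner products \<open>?p + ?q\<close> and
      \<open>?p - ?q\<close> differ by \<open>2 * ?q\<close>, so they cannot both be smaller than
      \<open>?q\<close> in modulus: if the plus sign fails, the minus sign works.\<close>
    have "cmod (2 * ?q) = cmod ((?p + ?q) - (?p - ?q))" by simp
    also have "\<dots> \<le> cmod (?p + ?q) + cmod (?p - ?q)" by (rule norm_triangle_ineq4)
    finally have "2 * cmod ?q \<le> cmod (?p + ?q) + cmod (?p - ?q)" by (simp only: norm_mult norm_numeral)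
    moreover have "cmod (?p + ?q) < (1/3)^k * L2_norm (w k)" using lt unfolding comm ex .
    ultimately have "cmod (?p - ?q) \<ge> (1/3)^k * L2_norm (w k)" unfolding q by linarith
    moreover have "L2_inner (v (Suc k)) (w k) = ?p - ?q" unfolding vS s ex by simp
    ultimately show ?thesis unfolding comm by simp
  qed (simp add: vS)
  have step: "L2_norm (\<lambda>x. v (Suc k) x - v k x) = (1/3)^k" for k
    using wpos[of k] L2_norm_cmult[of "of_real (s k (v k))" "w k"] by (simp add: vS) (simp add: s_def a_def)
  \<comment> \<open>The right-hand side is the exact partial sum of the geometric series of step
    lengths; the factor \<open>1 - (1/3)^j\<close> is what lets the induction close.\<close>
  have tail: "L2_norm (\<lambda>x. v (k + j) x - v k x) \<le> 3/2 * (1/3)^k * (1 - (1/3)^j)" for k j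
  proof (induction j)
    case 0 then show ?case by (simp add: L2_norm_def)
  next
    case (Suc j)
    have "L2_norm (\<lambda>x. v (k + Suc j) x - v k x) \<le> (1/3)^(k+j) + L2_norm (\<lambda>x. v (k + j) x - v k x)"
      using L2_norm_triangle_diff[OF v[of "Suc (k+j)"] v[of "k+j"] v[of k]] step[of "k+j"] by simp
    also have "\<dots> \<le> 3/2 * (1/3)^k * (1 - (1/3)^Suc j)"
      using Suc by (simp add: power_add algebra_simps)
    finally show ?case .
  qed
  have tail': "L2_norm (\<lambda>x. v n x - v k x) \<le> 3/2 * (1/3)^k" if "k \<le> n" for k n
  proof -
    have "L2_norm (\<lambda>x. v n x - v k x) \<le> 3/2 * (1/3)^k * (1 - (1/3)^(n-k))"
      using tail[of k "n - k"] that by simp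
    also have "\<dots> \<le> 3/2 * (1/3)^k * 1" by (intro mult_left_mono) auto
    finally show ?thesis by simp
  qed
  have "\<exists>N. \<forall>m\<ge>N. \<forall>n\<ge>N. L2_norm (\<lambda>x. v m x - v n x) < e" if "e > 0" for e
  proof -
    have "(\<lambda>k. 3 * (1/3::real)^k) \<longlonglongrightarrow> 3 * 0" by (intro tendsto_intros LIMSEQ_power_zero) auto
    from order_tendstoD(2)[OF this, of e] that obtain N where N: "3 * (1/3::real)^N < e"
      by (auto simp: eventually_sequentially)
    have "L2_norm (\<lambda>x. v m x - v n x) < e" if "m \<ge> N" "n \<ge> N" for m n
      using L2_norm_triangle_diff[OF v[of m] v[of N] v[of n]] tail'[OF that(1)] tail'[OF that(2)] N
      by (simp add: L2_norm_minus_commute[of "v N"])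
    then show ?thesis by blast
  qed
  from L2_complete_AE[OF v this] obtain f where "L2_strong_conv UNIV v f" by blast
  then have f: "f \<in> L2 UNIV" and lim: "(\<lambda>n. L2_norm (\<lambda>x. v n x - f x)) \<longlonglongrightarrow> 0"
    by (auto simp: L2_strong_conv_def)
  have near: "L2_norm (\<lambda>x. f x - v k x) \<le> 3/2 * (1/3)^k" for k
  proof -
    have "L2_norm (\<lambda>x. f x - v k x) \<le> L2_norm (\<lambda>x. v n x - f x) + 3/2 * (1/3)^k" if "n \<ge> k" for n
      using L2_norm_triangle_diff[OF f v[of n] v[of k]] tail'[OF that] by (simp add: L2_norm_minus_commute[of f])
    then have "L2_norm (\<lambda>x. f x - v k x) \<le> 0 + 3/2 * (1/3)^k"
      by (intro LIMSEQ_le_const[OF tendsto_add[OF lim tendsto_const]]) auto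
    then show ?thesis by simp
  qed
  obtain C where C: "\<And>n. cmod (L2_inner (us n) f) \<le> C" using bd[OF f] by auto
  \<comment> \<open>After step \<open>k\<close> the inner product with \<open>w k\<close> is at
    least \<open>(1/3)^k * L2_norm (w k)\<close>. All later steps together have length at most
    \<open>3/2 * (1/3)^(k+1)\<close>, half of \<open>(1/3)^k\<close>, and so destroy at most half of
    it. The norm of \<open>w k\<close> beats \<open>4^k\<close>, which leaves
    \<open>(4/3)^k / 2\<close>.\<close>
  have "(4/3)^k / 2 \<le> C" for k
  proof -
    have "L2_inner (w k) f = cnj (L2_inner f (w k))" by (rule L2_inner_commute)
    also have "L2_inner f (w k) = L2_inner (v (Suc k)) (w k) + L2_inner (\<lambda>x. f x - v (Suc k) x) (w k)"
      by (simp only: L2_inner_diff_left f v w) simp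
    finally have "cmod (L2_inner (w k) f) = cmod (L2_inner (v (Suc k)) (w k) + L2_inner (\<lambda>x. f x - v (Suc k) x) (w k))"
      by (simp only: complex_mod_cnj)
    moreover have "cmod (L2_inner (v (Suc k)) (w k)) = cmod (L2_inner (w k) (v (Suc k)))"
      by (subst L2_inner_commute) simp
    moreover have "cmod (L2_inner (\<lambda>x. f x - v (Suc k) x) (w k)) \<le> (1/3)^k * L2_norm (w k) / 2"
    proof -
      have "cmod (L2_inner (\<lambda>x. f x - v (Suc k) x) (w k)) \<le> L2_norm (\<lambda>x. f x - v (Suc k) x) * L2_norm (w k)"
        by (intro norm_L2_inner_le L2_diff f v w)
      also have "\<dots> \<le> (3/2 * (1/3)^Suc k) * L2_norm (w k)"
        by (intro mult_right_mono near) simp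
      finally show ?thesis by simp
    qed
    moreover have "cmod (L2_inner (v (Suc k)) (w k)) \<le>
        cmod (L2_inner (v (Suc k)) (w k) + L2_inner (\<lambda>x. f x - v (Suc k) x) (w k))
        + cmod (L2_inner (\<lambda>x. f x - v (Suc k) x) (w k))"
      by (metis add_diff_cancel_right' norm_triangle_ineq4)
    ultimately have "(1/3)^k * L2_norm (w k) / 2 \<le> cmod (L2_inner (w k) f)"
      using large[of k] by linarith
    moreover have "(4/3)^k = (1/3)^k * (4::real)^k" by (simp add: power_divide)
    moreover have "(1/3)^k * (4::real)^k \<le> (1/3)^k * L2_norm (w k)"
      by (intro mult_left_mono less_imp_le[OF wn]) auto
    ultimately show ?thesis using C[of "m k", folded w_def] by linarith
  qed
  moreover obtain k where "2 * C < (4/3::real)^k" using real_arch_pow[of "4/3" "2 * C"] by auto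
  ultimately show False by (metis field_sum_of_halves mult.commute not_le divide_less_eq_numeral1(1) less_divide_eq_numeral1(1))
qed

lemma L2_weak_conv_bounded:
  fixes us :: "nat \<Rightarrow> real ^ 'd \<Rightarrow> complex"
  assumes "L2_weak_conv UNIV us u"
  shows "\<exists>B. \<forall>n. L2_norm (us n) \<le> B"
proof (rule L2_uniform_boundedness)
  fix v :: "real ^ 'd \<Rightarrow> complex" assume "v \<in> L2 UNIV"
  then have "convergent (\<lambda>n. L2_inner (us n) v)" using assms by (auto simp: L2_weak_conv_def convergent_def)
  then show "\<exists>C. \<forall>n. cmod (L2_inner (us n) v) \<le> C" by (auto dest!: convergent_imp_Bseq elim!: BseqE)
qed (use assms in \<open>simp add: L2_weak_conv_def\<close>)

text \<open>A complex test function is \<open>a + \<i> b\<close> with \<open>a\<close> and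
  \<open>b\<close> real, and the inner product is conjugate linear in it. The real case of the lower
  bound thereby reduces to the complex one.\<close>

lemma L2_weak_conv_UNIV:
  fixes us :: "nat \<Rightarrow> real ^ 'd \<Rightarrow> complex"
  assumes K: "K = UNIV \<or> K = \<real>" and conv: "L2_weak_conv K us u"
  shows "L2_weak_conv UNIV us u"
proof (cases "K = UNIV")
  case False
  then have K: "K = \<real>" using K by simp
  have us: "us n \<in> L2 UNIV" for n
    using conv L2_iff[of "us n" K] by (simp add: L2_weak_conv_def)
  have u: "u \<in> L2 UNIV"
    using conv L2_iff[of u K] by (simp add: L2_weak_conv_def)
  have "(\<lambda>n. L2_inner (us n) v) \<longlonglongrightarrow> L2_inner u v" if v: "v \<in> L2 UNIV" for v :: "real ^ 'd \<Rightarrow> complex"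
  proof -
    let ?a = "\<lambda>x. complex_of_real (Re (v x))" and ?b = "\<lambda>x. complex_of_real (Re (- \<i> * v x))"
    have zero: "(\<lambda>x. 0) \<in> L2 \<real>" using L2_zero L2_iff by fastforce
    have a: "?a \<in> L2 \<real>" by (rule L2_norm_Re_diff_le(1)[OF v zero])
    have b: "?b \<in> L2 \<real>" by (rule L2_norm_Re_diff_le(1)[OF L2_cmult[OF v] zero])
    have a': "?a \<in> L2 UNIV" and b': "?b \<in> L2 UNIV" using a b L2_iff by blast+
    have v_eq: "v = (\<lambda>x. ?a x + \<i> * ?b x)" by (auto simp: complex_eq_iff)
    have split: "L2_inner f v = L2_inner f ?a - \<i> * L2_inner f ?b" if f: "f \<in> L2 UNIV" for f
    proof -
      have "L2_inner v f = L2_inner ?a f + \<i> * L2_inner ?b f"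
        by (subst v_eq) (simp only: L2_inner_add_left[OF a' L2_cmult[OF b'] f] L2_inner_cmult_left)
      then show ?thesis
        by (metis (no_types, lifting) L2_inner_commute complex_cnj_add complex_cnj_i complex_cnj_mult
            diff_conv_add_uminus mult_minus_left)
    qed
    have "(\<lambda>n. L2_inner (us n) ?a - \<i> * L2_inner (us n) ?b) \<longlonglongrightarrow> L2_inner u ?a - \<i> * L2_inner u ?b"
      using conv a b unfolding K L2_weak_conv_def by (intro tendsto_intros) auto
    then show ?thesis by (simp only: split us u)
  qed
  then show ?thesis using us u by (auto simp: L2_weak_conv_def)
qed (use conv in simp)

text \<open>The error \<open>L2_inner (us n) (vs n - v)\<close> is controlled by norm boundedness of
  the weakly convergent sequence, the reason for the uniform boundedness principle above.\<close>

lemma L2_weak_strong_inner: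
  fixes us :: "nat \<Rightarrow> real ^ 'd \<Rightarrow> complex"
  assumes us: "L2_weak_conv UNIV us u" and vs: "L2_strong_conv UNIV vs v"
  shows "(\<lambda>n. L2_inner (us n) (vs n)) \<longlonglongrightarrow> L2_inner u v"
proof -
  have u2: "us n \<in> L2 UNIV" and v2: "vs n \<in> L2 UNIV" "v \<in> L2 UNIV"
    and vlim: "(\<lambda>n. L2_norm (\<lambda>x. vs n x - v x)) \<longlonglongrightarrow> 0" for n
    using us vs by (auto simp: L2_weak_conv_def L2_strong_conv_def)
  obtain B where B: "\<And>n. L2_norm (us n) \<le> B" using L2_weak_conv_bounded[OF us] by blast
  have "(\<lambda>n. L2_inner (us n) (\<lambda>x. vs n x - v x)) \<longlonglongrightarrow> 0"
  proof (rule Lim_null_comparison)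
    show "(\<lambda>n. B * L2_norm (\<lambda>x. vs n x - v x)) \<longlonglongrightarrow> 0" by (intro tendsto_mult_right_zero vlim)
    have "cmod (L2_inner (us n) (\<lambda>x. vs n x - v x)) \<le> B * L2_norm (\<lambda>x. vs n x - v x)" for n
      by (rule order_trans[OF norm_L2_inner_le[OF u2 L2_diff[OF v2]] mult_right_mono[OF B]]) simp
    then show "\<forall>\<^sub>F n in sequentially. norm (L2_inner (us n) (\<lambda>x. vs n x - v x)) \<le> B * L2_norm (\<lambda>x. vs n x - v x)"
      by simp
  qed
  moreover have "(\<lambda>n. L2_inner (us n) v) \<longlonglongrightarrow> L2_inner u v" using us v2 by (auto simp: L2_weak_conv_def)
  ultimately have "(\<lambda>n. L2_inner (us n) (\<lambda>x. vs n x - v x) + L2_inner (us n) v) \<longlonglongrightarrow> 0 + L2_inner u v"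
    by (rule tendsto_add)
  moreover have "L2_inner (us n) (\<lambda>x. vs n x - v x) + L2_inner (us n) v = L2_inner (us n) (vs n)" for n
    using L2_inner_diff_left[OF v2(1)[of n] v2(2) u2[of n]]
    by (simp only: L2_inner_commute[of "us n"] complex_cnj_diff) simp
  ultimately show ?thesis by simp
qed

section \<open>Gaussian regularization\<close>

text \<open>The kernel is dominated by a constant, so the product of two integrable functions
  dominates the integrand. A general kernel is kept because it is used both for exponentials and for
  translates of a bounded function.\<close>

lemma Fubini_bounded_kernel:
  fixes a b :: "real ^ 'd \<Rightarrow> complex" and k :: "real ^ 'd \<Rightarrow> real ^ 'd \<Rightarrow> complex"
  assumes a: "integrable lborel a" and b: "integrable lborel b"
    and k [measurable]: "(\<lambda>(x, y). k x y) \<in> borel_measurable (borel \<Otimes>\<^sub>M borel)"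
    and bd: "\<And>x y. cmod (k x y) \<le> B"
  shows "(LINT x|lborel. a x * (LINT y|lborel. k x y * b y)) =
    (LINT y|lborel. (LINT x|lborel. a x * k x y) * b y)"
proof -
  have [measurable]: "a \<in> borel_measurable borel" "b \<in> borel_measurable borel"
    using a b by (auto dest: borel_measurable_integrable)
  have B: "0 \<le> B" using bd[of 0 0] norm_ge_zero order_trans by blast
  have le: "cmod (a x * k x y * b y) \<le> B * cmod (a x) * cmod (b y)" for x y
    using mult_right_mono[OF bd[of x y], of "cmod (a x) * cmod (b y)"] by (simp add: norm_mult mult_ac)
  have int2: "integrable lborel (\<lambda>y. a x * k x y * b y)" for x
    by (rule Bochner_Integration.integrable_bound[of _ "\<lambda>y. B * cmod (a x) * cmod (b y)"])
      (use b le[of x] B in \<open>auto\<close>)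
  have "integrable (lborel \<Otimes>\<^sub>M lborel) (\<lambda>(x, y). a x * k x y * b y)"
  proof (rule lborel_pair.Fubini_integrable)
    show "integrable lborel (\<lambda>x. LINT y|lborel. norm (case (x, y) of (x, y) \<Rightarrow> a x * k x y * b y))"
    proof (rule Bochner_Integration.integrable_bound)
      show "integrable lborel (\<lambda>x. B * (LINT y|lborel. cmod (b y)) * cmod (a x))"
        using a by auto
      have "(LINT y|lborel. cmod (a x * k x y * b y)) \<le> (LINT y|lborel. B * cmod (a x) * cmod (b y))" for x
        using b int2[of x] le[of x] by (intro integral_mono) auto
      then show "AE x in lborel. norm (LINT y|lborel. norm (case (x, y) of (x, y) \<Rightarrow> a x * k x y * b y))
          \<le> norm (B * (LINT y|lborel. cmod (b y)) * cmod (a x))"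
        using B by (simp add: abs_mult mult_ac)
    qed measurable
  qed (use int2 in auto)
  from lborel_pair.Fubini_integral[OF this]
  have "(LINT y|lborel. (LINT x|lborel. a x * k x y * b y)) = (LINT x|lborel. (LINT y|lborel. a x * k x y * b y))" .
  moreover have "(LINT y|lborel. a x * k x y * b y) = a x * (LINT y|lborel. k x y * b y)" for x
    by (simp add: mult.assoc)
  ultimately show ?thesis by simp
qed

section \<open>Affine substitution, product integrals and the Gaussian\<close>

lemma lborel_integral_affine:
  fixes f :: "real ^ 'd \<Rightarrow> 'b::{banach, second_countable_topology}"
  assumes [measurable]: "f \<in> borel_measurable borel" and "c \<noteq> 0"
  shows "(LINT x|lborel. f x) = \<bar>c\<bar> ^ CARD('d) *\<^sub>R (LINT x|lborel. f (t + c *\<^sub>R x))"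
  by (subst lborel_affine[OF assms(2), of t])
    (simp add: integral_density integral_distr)

lemma lborel_integrable_affine:
  fixes f :: "real ^ 'd \<Rightarrow> 'b::{banach, second_countable_topology}"
  assumes f: "integrable lborel f" and "c \<noteq> 0"
  shows "integrable lborel (\<lambda>x. f (t + c *\<^sub>R x))"
proof -
  have [measurable]: "f \<in> borel_measurable borel"
    using f by (auto dest: borel_measurable_integrable)
  have "integrable (density (distr lborel borel (\<lambda>x. t + c *\<^sub>R x)) (\<lambda>_. ennreal (\<bar>c\<bar> ^ CARD('d)))) f"
    using f lborel_affine[OF assms(2), of t] by simp
  then have "integrable lborel (\<lambda>x. (1 / \<bar>c\<bar> ^ CARD('d)) *\<^sub>R \<bar>c\<bar> ^ CARD('d) *\<^sub>R f (t + c *\<^sub>R x))"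
    by - (rule integrable_scaleR_right, simp add: integrable_density integrable_distr_eq)
  moreover have "(1 / \<bar>c\<bar> ^ CARD('d)) *\<^sub>R \<bar>c\<bar> ^ CARD('d) *\<^sub>R v = v" for v :: 'b
    using assms(2) by simp
  ultimately show ?thesis by (simp only:)
qed

lemma
  fixes f :: "(real ^ 'd) \<Rightarrow> real \<Rightarrow> complex"
  assumes f: "\<And>b. b \<in> Basis \<Longrightarrow> integrable lborel (f b)"
  shows integrable_lborel_prod: "integrable lborel (\<lambda>z. \<Prod>b\<in>Basis. f b (z \<bullet> b))"
    and integral_lborel_prod: "(LINT z|lborel. (\<Prod>b\<in>Basis. f b (z \<bullet> b))) = (\<Prod>b\<in>Basis. (LINT t|lborel. f b t))"
proof -
  interpret product_sigma_finite "\<lambda>_. lborel :: real measure" ..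
  have [measurable]: "f b \<in> borel_measurable borel" if "b \<in> Basis" for b
    using f[OF that] by (auto dest: borel_measurable_integrable)
  have eq: "(\<Prod>b\<in>Basis. f b ((\<Sum>i\<in>Basis. g i *\<^sub>R i) \<bullet> b)) = (\<Prod>b\<in>Basis. f b (g b))" for g :: "real ^ 'd \<Rightarrow> real"
    by (intro prod.cong refl) (simp add: inner_sum_left inner_Basis if_distrib cong: if_cong)
  show "integrable lborel (\<lambda>z. \<Prod>b\<in>Basis. f b (z \<bullet> b))"
    by (subst lborel_eq) (simp add: integrable_distr_eq eq product_integrable_prod f)
  show "(LINT z|lborel. (\<Prod>b\<in>Basis. f b (z \<bullet> b))) = (\<Prod>b\<in>Basis. (LINT t|lborel. f b t))"
    by (subst lborel_eq) (simp add: integral_distr eq product_integral_prod f)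
qed

text \<open>The standard normal density in dimension \<open>d\<close>, written as a product over
  coordinates so that its transform follows from the one-dimensional characteristic
  function.\<close>

definition gauss :: "real ^ 'd \<Rightarrow> real" where
  "gauss z = (\<Prod>b\<in>Basis. std_normal_density (z \<bullet> b))"

text \<open>The normalization in \<open>fourier_integral\<close> is also the prefactor of
  \<open>gauss\<close>; this coincidence makes the constants cancel in
  \<open>regularized_Plancherel\<close>.\<close>

abbreviation fourier_const :: "'d::finite itself \<Rightarrow> real" where
  "fourier_const _ \<equiv> (2 * pi) powr (- real CARD('d) / 2)"

lemma borel_measurable_gauss [measurable]: "gauss \<in> borel_measurable borel"
  unfolding gauss_def by measurable

lemma gauss_nonneg: "0 \<le> gauss z"
  by (simp add: gauss_def prod_nonneg)

lemma gauss_eq: "gauss (z :: real ^ 'd) = fourier_const TYPE('d) * exp (- (norm z)\<^sup>2 / 2)"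
proof -
  have "gauss z = (\<Prod>b\<in>(Basis :: (real ^ 'd) set). 1 / sqrt (2 * pi)) * exp (\<Sum>b\<in>Basis. - (z \<bullet> b)\<^sup>2 / 2)"
    by (simp add: gauss_def std_normal_density_def exp_sum prod_dividef power_divide)
  also have "(\<Prod>b\<in>(Basis :: (real ^ 'd) set). 1 / sqrt (2 * pi)) = fourier_const TYPE('d)"
    by (simp add: powr_half_sqrt[symmetric] powr_minus_divide[symmetric] powr_realpow[symmetric] powr_powr)
  also have "(\<Sum>b\<in>Basis. - (z \<bullet> b)\<^sup>2 / 2) = - (norm z)\<^sup>2 / 2"
    unfolding power2_norm_eq_inner euclidean_inner[of z z]
    by (simp add: sum_negf sum_divide_distrib power2_eq_square)
  finally show ?thesis .
qed

lemma
  fixes x :: "real ^ 'd"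
  shows integrable_iexp_gauss: "integrable lborel (\<lambda>z. iexp (x \<bullet> z) * complex_of_real (gauss z))"
    and integral_iexp_gauss: "(LINT z|lborel. iexp (x \<bullet> z) * complex_of_real (gauss z)) = complex_of_real (exp (- (norm x)\<^sup>2 / 2))"
proof -
  let ?f = "\<lambda>b t. iexp ((x \<bullet> b) * t) * complex_of_real (std_normal_density t)"
  have int: "integrable lborel (?f b)" for b
    by (rule Bochner_Integration.integrable_bound[of _ std_normal_density])
      (auto simp: norm_mult integrable_normal_density)
  have 1: "(LINT t|lborel. ?f b t) = complex_of_real (exp (- (x \<bullet> b)\<^sup>2 / 2))" for b
    using fun_cong[OF char_std_normal_distribution, of "x \<bullet> b"]
    by (simp add: char_def integral_density scaleR_conv_of_real mult.commute)
  have eq: "(\<Prod>b\<in>Basis. ?f b (z \<bullet> b)) = iexp (x \<bullet> z) * complex_of_real (gauss z)" for z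
  proof -
    have "(\<Prod>b\<in>Basis. iexp ((x \<bullet> b) * (z \<bullet> b))) = iexp (x \<bullet> z)"
      by (subst euclidean_inner) (simp add: exp_sum[symmetric] sum_distrib_left)
    then show ?thesis by (simp add: gauss_def prod.distrib)
  qed
  show "integrable lborel (\<lambda>z. iexp (x \<bullet> z) * complex_of_real (gauss z))"
    using integrable_lborel_prod[of ?f, OF int] by (simp only: eq)
  have "(LINT z|lborel. iexp (x \<bullet> z) * complex_of_real (gauss z)) =
      (\<Prod>b\<in>(Basis :: (real ^ 'd) set). complex_of_real (exp (- (x \<bullet> b)\<^sup>2 / 2)))"
    using integral_lborel_prod[of ?f, OF int] by (simp only: eq 1)
  also have "\<dots> = complex_of_real (exp (\<Sum>b\<in>Basis. - (x \<bullet> b)\<^sup>2 / 2))"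
    by (simp only: exp_sum[OF finite_Basis] of_real_prod)
  also have "(\<Sum>b\<in>Basis. - (x \<bullet> b)\<^sup>2 / 2) = - (norm x)\<^sup>2 / 2"
    unfolding power2_norm_eq_inner euclidean_inner[of x x]
    by (simp add: sum_negf sum_divide_distrib power2_eq_square)
  finally show "(LINT z|lborel. iexp (x \<bullet> z) * complex_of_real (gauss z)) = complex_of_real (exp (- (norm x)\<^sup>2 / 2))" .
qed

lemma integrable_gauss: "integrable lborel gauss"
  using integrable_iexp_gauss[of 0] by (simp add: complex_of_real_integrable_eq)

lemma integral_gauss: "(LINT z|lborel. gauss z) = 1"
proof -
  have "complex_of_real (LINT z|lborel. gauss (z :: real ^ 'a)) = complex_of_real 1"
    using integral_iexp_gauss[of 0] by simp
  then show ?thesis by (simp only: of_real_eq_iff)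
qed

lemma fourier_integral_borel:
  assumes [measurable]: "f \<in> borel_measurable borel"
  shows "fourier_integral (f :: real ^ 'd \<Rightarrow> complex) x =
    of_real (fourier_const TYPE('d)) * (LINT y|lborel. iexp (- (x \<bullet> y)) * f y)"
  unfolding fourier_integral_def by (subst integral_completion) auto

text \<open>The squared transform is not yet known to be integrable; the Gaussian weight makes the
  interchanges of integrals legitimate. The Gaussian is its own transform up to scale, so a weight
  of width \<open>1/e\<close> in frequency returns as an average of the autocorrelation over shifts
  of size \<open>e\<close>.\<close>

lemma regularized_Plancherel:
  fixes f :: "real ^ 'd \<Rightarrow> complex"
  assumes f: "integrable lborel f" and M: "\<And>x. cmod (f x) \<le> M" and e: "e \<noteq> 0"
  shows "complex_of_real (LINT \<xi>|lborel. (cmod (fourier_integral f \<xi>))\<^sup>2 * exp (- (norm (e *\<^sub>R \<xi>))\<^sup>2 / 2)) =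
    (LINT z|lborel. (LINT x|lborel. f x * cnj (f (x + e *\<^sub>R z))) * complex_of_real (gauss z))"
proof -
  have fm [measurable]: "f \<in> borel_measurable borel"
    using f by (auto dest: borel_measurable_integrable)
  let ?C = "fourier_const TYPE('d)" and ?d = "CARD('d)"
  define F where "F \<xi> = (LINT y|lborel. iexp (- (\<xi> \<bullet> y)) * f y)" for \<xi>
  define w where "w \<xi> = gauss (e *\<^sub>R \<xi>)" for \<xi> :: "real ^ 'd"
  have [measurable]: "F \<in> borel_measurable borel" unfolding F_def by measurable
  have [measurable]: "w \<in> borel_measurable borel" unfolding w_def by measurable
  have FI: "fourier_integral f \<xi> = of_real ?C * F \<xi>" for \<xi>
    by (simp add: fourier_integral_borel F_def)
  have cF: "cnj (F \<xi>) = (LINT y|lborel. iexp (\<xi> \<bullet> y) * cnj (f y))" for \<xi>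
    unfolding F_def by (subst Bochner_Integration.integral_cnj[symmetric])
      (intro Bochner_Integration.integral_cong, auto simp: exp_cnj)
  have Fb: "cmod (F \<xi>) \<le> (LINT y|lborel. cmod (f y))" for \<xi>
    unfolding F_def by (rule order_trans[OF integral_norm_bound]) (simp add: norm_mult)
  have w_int: "integrable lborel (\<lambda>\<xi>. complex_of_real (w \<xi>))"
    using lborel_integrable_affine[OF integrable_of_real[OF integrable_gauss] e, of 0]
    by (simp add: w_def)
  have wF_int: "integrable lborel (\<lambda>\<xi>. complex_of_real (w \<xi>) * cnj (F \<xi>))"
  proof (rule Bochner_Integration.integrable_bound)
    show "integrable lborel (\<lambda>\<xi>. (LINT y|lborel. cmod (f y)) * complex_of_real (w \<xi>))"
      using w_int by auto
    show "AE \<xi> in lborel. norm (complex_of_real (w \<xi>) * cnj (F \<xi>)) \<le> norm ((LINT y|lborel. cmod (f y)) * complex_of_real (w \<xi>))"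
      using Fb by (auto simp: norm_mult mult.commute intro!: mult_left_mono)
  qed measurable
  have eq: "complex_of_real ((cmod (fourier_integral f \<xi>))\<^sup>2 * exp (- (norm (e *\<^sub>R \<xi>))\<^sup>2 / 2)) =
      of_real ?C * ((of_real (w \<xi>) * cnj (F \<xi>)) * F \<xi>)" for \<xi>
    unfolding FI w_def gauss_eq norm_mult power_mult_distrib of_real_mult complex_norm_square
    by (simp add: power2_eq_square mult_ac)
  have inner: "(LINT \<xi>|lborel. (of_real (w \<xi>) * cnj (F \<xi>)) * iexp (- (\<xi> \<bullet> x))) =
      of_real (1 / ?C) * (LINT z|lborel. cnj (f (x + e *\<^sub>R z)) * of_real (gauss z))" for x
  proof -
    \<comment> \<open>The frequency integral left after the exchange, a Gaussian centred at
      \<open>x\<close>. Substituting \<open>y = x + e z\<close> normalizes it, and the Jacobian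
      \<open>|e|^d\<close> cancels the one from rescaling \<open>\<xi>\<close>.\<close>
    define G where "G y = (LINT \<xi>|lborel. (of_real (w \<xi>) * iexp (- (\<xi> \<bullet> x))) * iexp (\<xi> \<bullet> y))" for y
    have [measurable]: "G \<in> borel_measurable borel" unfolding G_def by measurable
    have G: "of_real (\<bar>e\<bar> ^ ?d) * G (x + e *\<^sub>R z) = of_real (1 / ?C) * of_real (gauss z)" for z
    proof -
      have "of_real (\<bar>e\<bar> ^ ?d) * G (x + e *\<^sub>R z) =
          of_real (\<bar>e\<bar> ^ ?d) * (LINT \<xi>|lborel. iexp (z \<bullet> (0 + e *\<^sub>R \<xi>)) * of_real (gauss (0 + e *\<^sub>R \<xi>)))"
      proof -
        have "iexp (- (\<xi> \<bullet> x)) * iexp (\<xi> \<bullet> (x + e *\<^sub>R z)) = iexp (z \<bullet> (0 + e *\<^sub>R \<xi>))" for \<xi>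
          unfolding exp_add[symmetric]
          by (simp add: inner_add_right inner_commute[of z] distrib_left)
        then show ?thesis
          unfolding G_def w_def by (simp add: mult.assoc) (simp add: mult.commute)
      qed
      also have "\<dots> = (LINT \<xi>|lborel. iexp (z \<bullet> \<xi>) * of_real (gauss \<xi>))"
        by (subst (2) lborel_integral_affine[OF _ e, of _ 0]) (auto simp: scaleR_conv_of_real[where 'a=complex])
      also have "\<dots> = of_real (1 / ?C) * of_real (gauss z)"
        unfolding integral_iexp_gauss by (simp add: gauss_eq)
      finally show ?thesis .
    qed
    have "(LINT \<xi>|lborel. (of_real (w \<xi>) * cnj (F \<xi>)) * iexp (- (\<xi> \<bullet> x))) =
        (LINT \<xi>|lborel. (of_real (w \<xi>) * iexp (- (\<xi> \<bullet> x))) * (LINT y|lborel. iexp (\<xi> \<bullet> y) * cnj (f y)))"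
      by (simp add: cF mult_ac)
    also have "\<dots> = (LINT y|lborel. G y * cnj (f y))"
      unfolding G_def
    proof (rule Fubini_bounded_kernel[where B=1])
      show "integrable lborel (\<lambda>\<xi>. complex_of_real (w \<xi>) * iexp (- (\<xi> \<bullet> x)))"
        by (rule Bochner_Integration.integrable_bound[OF w_int]) (auto simp: norm_mult)
    qed (use f in auto)
    also have "\<dots> = (LINT z|lborel. (of_real (\<bar>e\<bar> ^ ?d) * G (x + e *\<^sub>R z)) * cnj (f (x + e *\<^sub>R z)))"
      by (subst lborel_integral_affine[OF _ e, of _ x]) (auto simp: mult.assoc scaleR_conv_of_real[where 'a=complex])
    also have "\<dots> = of_real (1 / ?C) * (LINT z|lborel. cnj (f (x + e *\<^sub>R z)) * of_real (gauss z))"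
      unfolding G by (simp add: mult_ac)
    finally show ?thesis .
  qed
  have "complex_of_real (LINT \<xi>|lborel. (cmod (fourier_integral f \<xi>))\<^sup>2 * exp (- (norm (e *\<^sub>R \<xi>))\<^sup>2 / 2)) =
      of_real ?C * (LINT \<xi>|lborel. (of_real (w \<xi>) * cnj (F \<xi>)) * (LINT x|lborel. iexp (- (\<xi> \<bullet> x)) * f x))"
    by (simp only: integral_complex_of_real[symmetric] eq F_def[symmetric]) simp
  also have "\<dots> = of_real ?C * (LINT x|lborel. (LINT \<xi>|lborel. (of_real (w \<xi>) * cnj (F \<xi>)) * iexp (- (\<xi> \<bullet> x))) * f x)"
    by (subst Fubini_bounded_kernel[OF wF_int f, where B=1]) auto
  also have "\<dots> = (LINT x|lborel. f x * (LINT z|lborel. cnj (f (x + e *\<^sub>R z)) * of_real (gauss z)))"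
    unfolding inner by (simp add: mult_ac)
  \<comment> \<open>Here the bounded kernel is the translate \<open>cnj (f (x + e z))\<close>, with
    bound \<open>M\<close>.\<close>
  also have "\<dots> = (LINT z|lborel. (LINT x|lborel. f x * cnj (f (x + e *\<^sub>R z))) * of_real (gauss z))"
    by (rule Fubini_bounded_kernel[where B=M]) (use f integrable_gauss M in auto)
  finally show ?thesis .
qed

section \<open>Continuity of translations and the limit of the regularized identity\<close>

lemma integrable_indicator_ball:
  "integrable lborel (\<lambda>x. c * indicator (ball 0 r) (x :: real ^ 'd) :: real)"
  by (intro integrable_mult_right integrable_real_indicator) (use emeasure_bounded_finite[OF bounded_ball, of 0 r] in auto)

text \<open>Boundedness of \<open>f\<close> does not make it integrable on the whole space, so
  everything is localized to a ball. There \<open>f\<close> is approximated in L1 by continuous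
  functions, for which dominated convergence applies; the approximation error of the translate is
  handled by translation invariance.\<close>

lemma translation_continuous:
  fixes f :: "real ^ 'd \<Rightarrow> complex"
  assumes [measurable]: "f \<in> borel_measurable borel" and M: "\<And>x. cmod (f x) \<le> M"
    and zs: "zs \<longlonglongrightarrow> 0"
  shows "(\<lambda>n. LINT x|lborel. indicator (ball 0 r) x * cmod (f (x + zs n) - f x)) \<longlonglongrightarrow> 0"
proof -
  have M0: "0 \<le> M" using M[of 0] norm_ge_zero order_trans by blast
  \<comment> \<open>One unit larger than the ball of the claim: once \<open>norm (zs k) < 1\<close>,
    both \<open>x\<close> and \<open>x + zs k\<close> lie in \<open>B\<close>.\<close>
  define B :: "(real ^ 'd) set" where "B = ball 0 (r + 1)"
  have [measurable]: "B \<in> sets borel" "ball (0 :: real ^ 'd) r \<in> sets borel" by (simp_all add: B_def)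
  have ind_int: "integrable lborel (\<lambda>x. c * indicator (ball 0 s) (x :: real ^ 'd) :: real)" for c s
    by (rule integrable_indicator_ball)
  have "f \<in> borel_measurable lebesgue" by (simp add: measurable_completion)
  \<comment> \<open>By its definition, \<open>measurable_on\<close> supplies continuous functions
    converging to \<open>f\<close> off a negligible set.\<close>
  then have "f measurable_on UNIV" by (simp add: lebesgue_measurable_imp_measurable_on)
  then obtain N g where N: "negligible N" and g: "\<And>n. continuous_on UNIV (g n)"
    and lim: "\<And>x. x \<notin> N \<Longrightarrow> (\<lambda>n. g n x) \<longlonglongrightarrow> f x"
    unfolding measurable_on_def by auto
  \<comment> \<open>Projecting onto the disc of radius \<open>M\<close> keeps continuity and the
    limit, and makes the approximants uniformly bounded, as dominated convergence requires.\<close>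
  define G where "G n x = closest_point (cball 0 M) (g n x)" for n x
  have cp: "continuous_on UNIV (closest_point (cball (0::complex) M))"
    using M0 by (intro continuous_on_closest_point) auto
  have G: "continuous_on UNIV (G n)" for n
    unfolding G_def by (rule continuous_on_compose2[OF cp g]) auto
  then have [measurable]: "G n \<in> borel_measurable borel" for n
    by (rule borel_measurable_continuous_onI)
  have GM: "cmod (G n x) \<le> M" for n x
    using closest_point_in_set[of "cball (0::complex) M" "g n x"] M0 by (simp add: G_def)
  have Glim: "(\<lambda>n. G n x) \<longlonglongrightarrow> f x" if "x \<notin> N" for x
  proof -
    have "(\<lambda>n. G n x) \<longlonglongrightarrow> closest_point (cball 0 M) (f x)"
      unfolding G_def using cp by (intro isCont_tendsto_compose[OF _ lim[OF that]]) (simp add: continuous_on_eq_continuous_at)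
    then show ?thesis using M[of x] by (simp add: closest_point_self)
  qed
  have AEN: "AE x in lborel. x \<notin> N"
    using AE_not_in[of N lebesgue] N by (simp add: negligible_iff_null_sets AE_completion_iff)
  have dist2: "cmod (a - b) \<le> 2 * M" if "cmod a \<le> M" "cmod b \<le> M" for a b
    using norm_triangle_ineq4[of a b] that by linarith
  have L1: "(\<lambda>n. LINT x|lborel. indicator B x * cmod (f x - G n x)) \<longlonglongrightarrow> (LINT x|(lborel :: (real ^ 'd) measure). 0)"
  proof (rule integral_dominated_convergence)
    show "integrable lborel (\<lambda>x. 2 * M * indicator B x)" unfolding B_def by (rule ind_int)
    show "AE x in lborel. (\<lambda>n. indicator B x * cmod (f x - G n x)) \<longlonglongrightarrow> 0"
      using AEN
    proof eventually_elim
      case (elim x)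
      have "(\<lambda>n. indicator B x * cmod (f x - G n x)) \<longlonglongrightarrow> indicator B x * cmod (f x - f x)"
        by (intro tendsto_intros Glim elim)
      then show ?case by simp
    qed
    show "AE x in lborel. norm (indicator B x * cmod (f x - G n x)) \<le> 2 * M * indicator B x" for n
      using dist2[OF M GM] by (auto simp: indicator_def)
  qed measurable
  show ?thesis
  proof (rule LIMSEQ_I)
    fix e :: real assume e: "0 < e"
    from L1 have "\<forall>\<^sub>F n in sequentially. (LINT x|lborel. indicator B x * cmod (f x - G n x)) < e / 3"
      using e by (intro order_tendstoD) auto
    then obtain n where n: "(LINT x|lborel. indicator B x * cmod (f x - G n x)) < e / 3"
      by (auto simp: eventually_sequentially)
    define h where "h x = indicator B x * cmod (f x - G n x)" for x
    have hm [measurable]: "h \<in> borel_measurable borel" unfolding h_def by measurable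
    have h_int: "integrable lborel h"
      by (rule Bochner_Integration.integrable_bound[OF ind_int[of "2 * M" "r + 1"]])
        (use dist2[OF M GM] M0 in \<open>auto simp: h_def B_def indicator_def\<close>)
    have h_int': "integrable lborel (\<lambda>x. h (x + z))" for z
      using lborel_integrable_affine[OF h_int, of 1 z] by (simp add: add.commute)
    have h_eq: "(LINT x|lborel. h (x + z)) = (LINT x|lborel. h x)" for z
      using lborel_integral_affine[OF hm, of 1 z] by (simp add: add.commute)
    have "(\<lambda>k. LINT x|lborel. indicator (ball 0 r) x * cmod (G n (x + zs k) - G n x)) \<longlonglongrightarrow> (LINT x|(lborel :: (real ^ 'd) measure). 0)"
    proof (rule integral_dominated_convergence)
      show "integrable lborel (\<lambda>x. 2 * M * indicator (ball 0 r) (x :: real ^ 'd))" by (rule ind_int)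
      show "AE x in lborel. (\<lambda>k. indicator (ball 0 r) x * cmod (G n (x + zs k) - G n x)) \<longlonglongrightarrow> 0"
      proof (intro always_eventually allI)
        fix x
        have "(\<lambda>k. G n (x + zs k)) \<longlonglongrightarrow> G n (x + 0)"
          using G by (intro isCont_tendsto_compose[where g="G n"] tendsto_intros zs) (simp add: continuous_on_eq_continuous_at)
        then have "(\<lambda>k. indicator (ball 0 r) x * cmod (G n (x + zs k) - G n x)) \<longlonglongrightarrow> indicator (ball 0 r) x * cmod (G n (x + 0) - G n x)"
          by (intro tendsto_intros)
        then show "(\<lambda>k. indicator (ball 0 r) x * cmod (G n (x + zs k) - G n x)) \<longlonglongrightarrow> 0" by simp
      qed
      show "AE x in lborel. norm (indicator (ball 0 r) x * cmod (G n (x + zs k) - G n x)) \<le> 2 * M * indicator (ball 0 r) x" for k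
        using dist2[OF GM GM] by (auto simp: indicator_def)
    qed measurable
    then have "\<forall>\<^sub>F k in sequentially. (LINT x|lborel. indicator (ball 0 r) x * cmod (G n (x + zs k) - G n x)) < e / 3"
      using e by (intro order_tendstoD) auto
    moreover have "\<forall>\<^sub>F k in sequentially. norm (zs k) < 1"
      using tendsto_norm[OF zs] by (intro order_tendstoD) auto
    ultimately have "\<forall>\<^sub>F k in sequentially. (LINT x|lborel. indicator (ball 0 r) x * cmod (f (x + zs k) - f x)) < e"
    proof eventually_elim
      case (elim k)
      have G_int: "integrable lborel (\<lambda>x. indicator (ball 0 r) x * cmod (G n (x + zs k) - G n x))"
        by (rule Bochner_Integration.integrable_bound[OF ind_int[of "2 * M" r]])
          (use dist2[OF GM GM] M0 in \<open>auto simp: indicator_def\<close>)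
      have f_int: "integrable lborel (\<lambda>x. indicator (ball 0 r) x * cmod (f (x + zs k) - f x))"
        by (rule Bochner_Integration.integrable_bound[OF ind_int[of "2 * M" r]])
          (use dist2[OF M M] M0 in \<open>auto simp: indicator_def\<close>)
      have "(LINT x|lborel. indicator (ball 0 r) x * cmod (f (x + zs k) - f x)) \<le>
          (LINT x|lborel. h (x + zs k) + indicator (ball 0 r) x * cmod (G n (x + zs k) - G n x) + h x)"
      proof (intro integral_mono f_int Bochner_Integration.integrable_add h_int h_int' G_int)
        fix x
        have "cmod (f (x + zs k) - f x) \<le> cmod (f (x + zs k) - G n (x + zs k)) + cmod (G n (x + zs k) - G n x) + cmod (f x - G n x)"
          using norm_triangle_ineq[of "f (x + zs k) - G n (x + zs k)" "G n (x + zs k) - G n x"]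
            norm_triangle_ineq[of "f (x + zs k) - G n x" "G n x - f x"] norm_minus_commute[of "f x" "G n x"]
          by simp
        moreover have "x \<in> B \<and> x + zs k \<in> B" if "x \<in> ball 0 r"
          using that norm_triangle_ineq[of x "zs k"] elim by (auto simp: B_def)
        ultimately show "indicator (ball 0 r) x * cmod (f (x + zs k) - f x) \<le>
            h (x + zs k) + indicator (ball 0 r) x * cmod (G n (x + zs k) - G n x) + h x"
          by (auto simp: h_def indicator_def)
      qed
      also have "\<dots> = (LINT x|lborel. h x) + (LINT x|lborel. indicator (ball 0 r) x * cmod (G n (x + zs k) - G n x)) + (LINT x|lborel. h x)"
        by (simp add: h_int h_int' G_int h_eq)
      also have "\<dots> < e" using elim n by (simp add: h_def)
      finally show ?case .
    qed
    moreover have "0 \<le> (LINT x|lborel. indicator (ball 0 r) x * cmod (f (x + zs k) - f x))" for k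
      by (intro integral_nonneg_AE) (auto simp: indicator_def)
    ultimately show "\<exists>k0. \<forall>k\<ge>k0. norm ((LINT x|lborel. indicator (ball 0 r) x * cmod (f (x + zs k) - f x)) - 0) < e"
      by (auto simp: eventually_sequentially)
  qed
qed

text \<open>The unshifted factor confines the integral to the ball and is at most \<open>M\<close>
  there, so local continuity of translations suffices.\<close>

lemma autocorrelation_tendsto:
  fixes f :: "real ^ 'd \<Rightarrow> complex"
  assumes fm [measurable]: "f \<in> borel_measurable borel" and M: "\<And>x. cmod (f x) \<le> M"
    and supp: "\<And>x. x \<notin> ball 0 r \<Longrightarrow> f x = 0" and int: "integrable lborel f" and zs: "zs \<longlonglongrightarrow> 0"
  shows "(\<lambda>n. LINT x|lborel. f x * cnj (f (x + zs n))) \<longlonglongrightarrow> (LINT x|lborel. f x * cnj (f x))"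
proof (rule LIM_zero_cancel, rule Lim_null_comparison)
  have M0: "0 \<le> M" using M[of 0] norm_ge_zero order_trans by blast
  have f_int: "integrable lborel (\<lambda>x. f x * cnj (f (x + z)))" for z
    by (rule Bochner_Integration.integrable_bound[of _ "\<lambda>x. f x * of_real M"])
      (use int M M0 in \<open>auto simp: norm_mult intro!: mult_left_mono\<close>)
  show "(\<lambda>n. M * (LINT x|lborel. indicator (ball 0 r) x * cmod (f (x + zs n) - f x))) \<longlonglongrightarrow> 0"
    by (intro tendsto_mult_right_zero translation_continuous[OF fm M zs])
  have "cmod ((LINT x|lborel. f x * cnj (f (x + zs n))) - (LINT x|lborel. f x * cnj (f x))) \<le>
      M * (LINT x|lborel. indicator (ball 0 r) x * cmod (f (x + zs n) - f x))" for n
  proof -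
    have "(LINT x|lborel. f x * cnj (f (x + zs n))) - (LINT x|lborel. f x * cnj (f x)) =
        (LINT x|lborel. f x * cnj (f (x + zs n) - f x))"
      using f_int[of 0] f_int[of "zs n"] by (simp add: right_diff_distrib)
    also have "cmod \<dots> \<le> (LINT x|lborel. M * (indicator (ball 0 r) x * cmod (f (x + zs n) - f x)))"
    proof (rule order_trans[OF integral_norm_bound integral_mono])
      show "integrable lborel (\<lambda>x. norm (f x * cnj (f (x + zs n) - f x)))"
        using f_int[of 0] f_int[of "zs n"] by (intro integrable_norm) (simp add: right_diff_distrib)
      have "integrable lborel (\<lambda>x. 2 * M * indicator (ball 0 r) (x :: real ^ 'd))"
        by (rule integrable_indicator_ball)
      then have "integrable lborel (\<lambda>x. indicator (ball 0 r) x * cmod (f (x + zs n) - f x))"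
      proof (rule Bochner_Integration.integrable_bound)
        have "cmod (f (x + zs n) - f x) \<le> 2 * M" for x
          using norm_triangle_ineq4[of "f (x + zs n)" "f x"] M[of x] M[of "x + zs n"] by linarith
        then show "AE x in lborel. norm (indicator (ball 0 r) x * cmod (f (x + zs n) - f x)) \<le> norm (2 * M * indicator (ball 0 r) x)"
          using M0 by (auto simp: indicator_def)
        have [measurable]: "ball (0 :: real ^ 'd) r \<in> sets borel" by simp
        show "(\<lambda>x. indicator (ball 0 r) x * cmod (f (x + zs n) - f x)) \<in> borel_measurable lborel"
          by measurable
      qed
      then show "integrable lborel (\<lambda>x. M * (indicator (ball 0 r) x * cmod (f (x + zs n) - f x)))" by simp
      fix x
      show "norm (f x * cnj (f (x + zs n) - f x)) \<le> M * (indicator (ball 0 r) x * cmod (f (x + zs n) - f x))"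
      proof (cases "x \<in> ball 0 r")
        case True
        have "cmod (cnj (f (x + zs n)) - cnj (f x)) = cmod (f (x + zs n) - f x)"
          by (metis complex_cnj_diff complex_mod_cnj)
        with True M[of x] show ?thesis by (auto simp: norm_mult intro!: mult_right_mono)
      qed (simp add: supp)
    qed
    finally show ?thesis by simp
  qed
  then show "\<forall>\<^sub>F n in sequentially. norm ((LINT x|lborel. f x * cnj (f (x + zs n))) - (LINT x|lborel. f x * cnj (f x))) \<le>
      M * (LINT x|lborel. indicator (ball 0 r) x * cmod (f (x + zs n) - f x))"
    by simp
qed

text \<open>As \<open>e n\<close> decreases to \<open>0\<close>, the weights on the frequency side
  increase to \<open>1\<close>, so monotone convergence gives the limit without knowing it to be
  finite. On the other side the autocorrelation is bounded and continuous at \<open>0\<close>, and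
  \<open>gauss\<close> dominates.\<close>

lemma Plancherel_bounded_borel:
  fixes f :: "real ^ 'd \<Rightarrow> complex"
  assumes fm [measurable]: "f \<in> borel_measurable borel" and M: "\<And>x. cmod (f x) \<le> M"
    and supp: "\<And>x. x \<notin> ball 0 r \<Longrightarrow> f x = 0"
  shows "(\<integral>\<^sup>+\<xi>. ennreal ((cmod (fourier_integral f \<xi>))\<^sup>2) \<partial>lborel) = ennreal (LINT x|lborel. (cmod (f x))\<^sup>2)"
proof -
  have M0: "0 \<le> M" using M[of 0] norm_ge_zero order_trans by blast
  have int: "integrable lborel f"
  proof (rule Bochner_Integration.integrable_bound)
    show "integrable lborel (\<lambda>x. M * indicator (ball 0 r) (x :: real ^ 'd))"
      by (rule integrable_indicator_ball)
    show "AE x in lborel. norm (f x) \<le> norm (M * indicator (ball 0 r) x)"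
      using M M0 supp by (auto simp: indicator_def)
  qed auto
  define e where "e n = 1 / real (Suc n)" for n
  have e: "e n > 0" for n by (simp add: e_def)
  have e_lim: "e \<longlonglongrightarrow> 0" unfolding e_def by (rule LIMSEQ_Suc[OF lim_1_over_n])
  let ?A = "\<lambda>z. LINT x|lborel. f x * cnj (f (x + z))"
  let ?L = "\<lambda>n \<xi>. (cmod (fourier_integral f \<xi>))\<^sup>2 * exp (- (norm (e n *\<^sub>R \<xi>))\<^sup>2 / 2)"
  have FIm [measurable]: "fourier_integral f \<in> borel_measurable borel"
    unfolding fourier_integral_borel[OF fm] by measurable
  have A_bd: "cmod (?A z) \<le> M * (LINT x|lborel. cmod (f x))" for z
  proof -
    have "cmod (?A z) \<le> (LINT x|lborel. M * cmod (f x))"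
    proof (rule order_trans[OF integral_norm_bound integral_mono])
      show "integrable lborel (\<lambda>x. norm (f x * cnj (f (x + z))))"
        by (rule Bochner_Integration.integrable_bound[of _ "\<lambda>x. f x * of_real M"])
          (use int M M0 in \<open>auto simp: norm_mult intro!: mult_left_mono\<close>)
    qed (use int M in \<open>auto simp: norm_mult mult.commute[of M] intro!: mult_left_mono\<close>)
    then show ?thesis by simp
  qed
  have "(\<lambda>n. LINT z|lborel. ?A (e n *\<^sub>R z) * of_real (gauss z)) \<longlonglongrightarrow>
      (LINT z|lborel. ?A 0 * of_real (gauss (z :: real ^ 'd)))"
  proof (rule integral_dominated_convergence)
    show "integrable lborel (\<lambda>z. M * (LINT x|lborel. cmod (f x)) * gauss (z :: real ^ 'd))"
      by (simp add: integrable_gauss)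
    show "AE z in lborel. (\<lambda>n. ?A (e n *\<^sub>R z) * of_real (gauss z)) \<longlonglongrightarrow> ?A 0 * of_real (gauss z)"
    proof (intro always_eventually allI)
      fix z :: "real ^ 'd"
      have "(\<lambda>n. e n *\<^sub>R z) \<longlonglongrightarrow> 0 *\<^sub>R z" by (intro tendsto_intros e_lim)
      then have "(\<lambda>n. ?A (e n *\<^sub>R z)) \<longlonglongrightarrow> ?A 0"
        using autocorrelation_tendsto[OF fm M supp int] by simp
      then show "(\<lambda>n. ?A (e n *\<^sub>R z) * of_real (gauss z)) \<longlonglongrightarrow> ?A 0 * of_real (gauss z)"
        by (intro tendsto_intros)
    qed
    show "AE z in lborel. norm (?A (e n *\<^sub>R z) * of_real (gauss z)) \<le> M * (LINT x|lborel. cmod (f x)) * gauss z" for n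
      using A_bd by (auto simp: norm_mult gauss_nonneg intro!: mult_right_mono)
  qed measurable
  also have "(LINT z|lborel. ?A 0 * of_real (gauss (z :: real ^ 'd))) = ?A 0"
    using integrable_gauss by (simp add: integral_gauss)
  also have "?A 0 = of_real (LINT x|lborel. (cmod (f x))\<^sup>2)"
    unfolding integral_complex_of_real[symmetric]
    by (intro Bochner_Integration.integral_cong) (auto simp flip: complex_norm_square)
  finally have lim: "(\<lambda>n. LINT \<xi>|lborel. ?L n \<xi>) \<longlonglongrightarrow> (LINT x|lborel. (cmod (f x))\<^sup>2)"
    by (simp only: regularized_Plancherel[OF int M less_imp_neq[OF e, symmetric], symmetric] tendsto_of_real_iff)
  \<comment> \<open>The transform is bounded by a multiple of the L1 norm of \<open>f\<close>, so
    the Gaussian weight gives integrability; this links the limit of the \<open>LINT\<close>s to the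
    nonnegative integrals.\<close>
  have L_int: "integrable lborel (?L n)" for n
  proof -
    let ?C = "fourier_const TYPE('d)"
    have "integrable lborel (\<lambda>\<xi>. gauss (e n *\<^sub>R \<xi> :: real ^ 'd))"
      using lborel_integrable_affine[OF integrable_gauss, of "e n" 0] e[of n] by simp
    then have "integrable lborel (\<lambda>\<xi>. (?C * (LINT y|lborel. cmod (f y)))\<^sup>2 * (1 / ?C * gauss (e n *\<^sub>R \<xi> :: real ^ 'd)))"
      by (intro integrable_mult_right)
    then show ?thesis
    proof (rule Bochner_Integration.integrable_bound)
      have "cmod (fourier_integral f \<xi>) \<le> ?C * (LINT y|lborel. cmod (f y))" for \<xi>
        unfolding fourier_integral_borel[OF fm] norm_mult
        by (intro mult_mono order_trans[OF integral_norm_bound]) (auto simp: norm_mult)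
      then have "(cmod (fourier_integral f \<xi>))\<^sup>2 \<le> (?C * (LINT y|lborel. cmod (f y)))\<^sup>2" for \<xi>
        by (intro power_mono) auto
      moreover have "1 / ?C * gauss (e n *\<^sub>R \<xi>) = exp (- (norm (e n *\<^sub>R \<xi>))\<^sup>2 / 2)" for \<xi> :: "real ^ 'd"
        by (simp add: gauss_eq)
      ultimately show "AE \<xi> in lborel. norm (?L n \<xi>) \<le> norm ((?C * (LINT y|lborel. cmod (f y)))\<^sup>2 * (1 / ?C * gauss (e n *\<^sub>R \<xi>)))"
        by (intro always_eventually allI) (simp only: abs_mult real_norm_def abs_exp_cancel abs_power2 mult_right_mono exp_ge_zero)
    qed measurable
  qed
  have "(\<lambda>n. \<integral>\<^sup>+\<xi>. ennreal (?L n \<xi>) \<partial>lborel) \<longlonglongrightarrow> (\<integral>\<^sup>+\<xi>. ennreal ((cmod (fourier_integral f \<xi>))\<^sup>2) \<partial>lborel)"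
  proof (rule nn_integral_LIMSEQ)
    show "incseq (\<lambda>n \<xi>. ennreal (?L n \<xi>))"
    proof (intro incseq_SucI le_funI ennreal_leI mult_left_mono)
      fix n \<xi>
      have "e (Suc n) \<le> e n" by (simp add: e_def field_simps)
      then have "(norm (e (Suc n) *\<^sub>R \<xi>))\<^sup>2 \<le> (norm (e n *\<^sub>R \<xi>))\<^sup>2"
        using e[of n] e[of "Suc n"] by (intro power_mono) (auto intro!: mult_right_mono)
      then show "exp (- (norm (e (Suc n) *\<^sub>R \<xi>))\<^sup>2 / 2) \<ge> exp (- (norm (e n *\<^sub>R \<xi>))\<^sup>2 / 2)" by simp
    qed simp
    fix \<xi>
    have "(\<lambda>n. ?L n \<xi>) \<longlonglongrightarrow> (cmod (fourier_integral f \<xi>))\<^sup>2 * exp (- (norm (0 *\<^sub>R \<xi>))\<^sup>2 / 2)"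
      by (intro tendsto_intros e_lim) auto
    then show "(\<lambda>n. ennreal (?L n \<xi>)) \<longlonglongrightarrow> ennreal ((cmod (fourier_integral f \<xi>))\<^sup>2)"
      by (intro tendsto_ennrealI) simp
  qed measurable
  moreover have "(\<lambda>n. \<integral>\<^sup>+\<xi>. ennreal (?L n \<xi>) \<partial>lborel) \<longlonglongrightarrow> ennreal (LINT x|lborel. (cmod (f x))\<^sup>2)"
  proof -
    have "(\<integral>\<^sup>+\<xi>. ennreal (?L n \<xi>) \<partial>lborel) = ennreal (LINT \<xi>|lborel. ?L n \<xi>)" for n
      by (rule nn_integral_eq_integral[OF L_int]) simp
    then show ?thesis by (simp only: tendsto_ennrealI[OF lim])
  qed
  ultimately show ?thesis by (rule LIMSEQ_unique)
qed

section \<open>Plancherel's theorem\<close>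

lemma L2_strong_conv_dominated:
  assumes u: "u \<in> L2 UNIV" and [measurable]: "\<And>k. us k \<in> borel_measurable lebesgue"
    and lim: "\<And>x. (\<lambda>k. us k x) \<longlonglongrightarrow> u x" and le: "\<And>k x. cmod (us k x) \<le> cmod (u x)"
  shows "L2_strong_conv UNIV us u"
proof -
  note [measurable] = L2_measurable[OF u]
  have us: "us k \<in> L2 UNIV" for k
    by (rule L2_dominated[OF u]) (auto simp: le)
  have "(\<lambda>k. LINT x|lebesgue. (cmod (us k x - u x))\<^sup>2) \<longlonglongrightarrow> (LINT x|(lebesgue :: (real ^ 'a) measure). 0)"
  proof (rule integral_dominated_convergence)
    show "integrable lebesgue (\<lambda>x. 4 * (cmod (u x))\<^sup>2)" using L2_integrable[OF u] by simp
    show "AE x in lebesgue. (\<lambda>k. (cmod (us k x - u x))\<^sup>2) \<longlonglongrightarrow> 0"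
    proof (intro always_eventually allI)
      fix x
      have "(\<lambda>k. (cmod (us k x - u x))\<^sup>2) \<longlonglongrightarrow> (cmod (u x - u x))\<^sup>2"
        by (intro tendsto_intros lim)
      then show "(\<lambda>k. (cmod (us k x - u x))\<^sup>2) \<longlonglongrightarrow> 0" by simp
    qed
    show "AE x in lebesgue. norm ((cmod (us k x - u x))\<^sup>2) \<le> 4 * (cmod (u x))\<^sup>2" for k
    proof (intro always_eventually allI)
      fix x
      have "cmod (us k x - u x) \<le> 2 * cmod (u x)"
        using norm_triangle_ineq4[of "us k x" "u x"] le[of k x] by linarith
      then have "(cmod (us k x - u x))\<^sup>2 \<le> (2 * cmod (u x))\<^sup>2" by (intro power_mono) auto
      then show "norm ((cmod (us k x - u x))\<^sup>2) \<le> 4 * (cmod (u x))\<^sup>2" by (simp add: power_mult_distrib)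
    qed
  qed measurable
  then have "(\<lambda>k. sqrt (LINT x|lebesgue. (cmod (us k x - u x))\<^sup>2)) \<longlonglongrightarrow> sqrt 0"
    by (intro tendsto_real_sqrt) simp
  then show ?thesis using us u by (auto simp: L2_strong_conv_def L2_norm_def)
qed

text \<open>Fubini and the substitutions work over \<open>lborel\<close>, while elements of
  \<open>L2\<close> are only Lebesgue measurable; this is the passage between the two.\<close>

lemma lebesgue_complex_borel_version:
  fixes f :: "real ^ 'd \<Rightarrow> complex"
  assumes [measurable]: "f \<in> borel_measurable lebesgue"
  obtains g where "g \<in> borel_measurable borel" "AE x in lebesgue. f x = g x"
proof -
  have "(\<lambda>x. Re (f x)) \<in> borel_measurable lebesgue" "(\<lambda>x. Im (f x)) \<in> borel_measurable lebesgue" by measurable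
  from this[THEN completion_ex_borel_measurable_real] obtain a b
    where [measurable]: "a \<in> borel_measurable borel" "b \<in> borel_measurable borel"
      and ae: "AE x in lborel. Re (f x) = a x" "AE x in lborel. Im (f x) = b x" by auto
  have "AE x in lebesgue. f x = Complex (a x) (b x)"
    unfolding AE_completion_iff using ae by eventually_elim (simp add: complex_eq_iff)
  moreover have "(\<lambda>x. Complex (a x) (b x)) \<in> borel_measurable borel"
    unfolding Complex_eq by measurable
  ultimately show thesis using that by blast
qed

lemma measurable_ident_lebesgue_borel [measurable]: "(\<lambda>x. x) \<in> borel_measurable lebesgue"
  by (intro measurable_completion) simp

section \<open>The Fourier integral on integrable functions and its isometry\<close>

lemma fourier_integral_cong_AE:
  assumes [measurable]: "f \<in> borel_measurable lebesgue" "g \<in> borel_measurable lebesgue"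
    and "AE x in lebesgue. f x = g x"
  shows "fourier_integral f = fourier_integral g"
proof
  fix x
  show "fourier_integral f x = fourier_integral g x"
    unfolding fourier_integral_def
    by (intro arg_cong2[where f="(*)"] refl integral_cong_AE) (use assms(3) in auto)
qed

lemma borel_measurable_fourier_integral:
  assumes "f \<in> borel_measurable lebesgue"
  shows "fourier_integral f \<in> borel_measurable borel"
proof -
  obtain g where g [measurable]: "g \<in> borel_measurable borel" and ae: "AE x in lebesgue. f x = g x"
    using lebesgue_complex_borel_version[OF assms] .
  have "fourier_integral f = fourier_integral g"
    using assms ae by (intro fourier_integral_cong_AE) (auto simp: measurable_completion)
  also have "\<dots> \<in> borel_measurable borel"
    unfolding fourier_integral_borel[OF g] by measurable
  finally show ?thesis .
qed

lemma integrable_iexp_mult: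
  assumes "integrable lebesgue f"
  shows "integrable lebesgue (\<lambda>y. iexp (- (x \<bullet> y)) * f y)"
proof (rule Bochner_Integration.integrable_bound[OF assms])
  have [measurable]: "f \<in> borel_measurable lebesgue" using assms by (rule borel_measurable_integrable)
  show "(\<lambda>y. iexp (- (x \<bullet> y)) * f y) \<in> borel_measurable lebesgue" by measurable
qed (simp add: norm_mult)

lemma fourier_integral_add:
  assumes "integrable lebesgue f" "integrable lebesgue g"
  shows "fourier_integral (\<lambda>x. f x + g x) x = fourier_integral f x + fourier_integral g x"
  using assms[THEN integrable_iexp_mult] by (simp add: fourier_integral_def distrib_left)

lemma fourier_integral_diff:
  assumes "integrable lebesgue f" "integrable lebesgue g"
  shows "fourier_integral (\<lambda>x. f x - g x) x = fourier_integral f x - fourier_integral g x"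
  using assms[THEN integrable_iexp_mult] by (simp add: fourier_integral_def right_diff_distrib)

lemma fourier_integral_cmult:
  "fourier_integral (\<lambda>x. c * f x) x = c * fourier_integral f x"
  by (simp add: fourier_integral_def mult.left_commute[of _ c])

lemma fourier_integral_cnj:
  "fourier_integral (\<lambda>x. cnj (f x)) x = cnj (fourier_integral f (- x))"
proof -
  have "iexp (- (x \<bullet> y)) * cnj (f y) = cnj (iexp (- (- x \<bullet> y)) * f y)" for y
    by (simp add: exp_cnj)
  then have "(LINT y|lebesgue. iexp (- (x \<bullet> y)) * cnj (f y)) = cnj (LINT y|lebesgue. iexp (- (- x \<bullet> y)) * f y)"
    by (simp only: Bochner_Integration.integral_cnj)
  then show ?thesis
    unfolding fourier_integral_def by (simp only: complex_cnj_mult complex_cnj_complex_of_real)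
qed

lemma Plancherel_bounded:
  fixes f :: "real ^ 'd \<Rightarrow> complex"
  assumes fm [measurable]: "f \<in> borel_measurable lebesgue" and M: "\<And>x. cmod (f x) \<le> M"
    and supp: "\<And>x. x \<notin> ball 0 r \<Longrightarrow> f x = 0" and f: "f \<in> L2 UNIV"
  shows "fourier_integral f \<in> L2 UNIV" "L2_norm (fourier_integral f) = L2_norm f"
proof -
  obtain g where [measurable]: "g \<in> borel_measurable borel" and ae: "AE x in lebesgue. f x = g x"
    using lebesgue_complex_borel_version[OF fm] .
  \<comment> \<open>The Borel version \<open>g\<close> may break the bound and the support condition
    on a null set; \<open>h\<close> restores both at every point.\<close>
  define h where "h x = (if x \<in> ball 0 r \<and> cmod (g x) \<le> M then g x else 0)" for x
  have [measurable]: "ball (0 :: real ^ 'd) r \<in> sets borel" by simp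
  have hm [measurable]: "h \<in> borel_measurable borel" unfolding h_def by measurable
  have hm' [measurable]: "h \<in> borel_measurable lebesgue" by (simp add: measurable_completion)
  have M0: "0 \<le> M" using M[of 0] norm_ge_zero order_trans by blast
  have ae': "AE x in lebesgue. f x = h x"
    using ae
  proof eventually_elim
    case (elim x)
    then show ?case using supp[of x] M[of x] by (auto simp: h_def)
  qed
  have FI: "fourier_integral f = fourier_integral h"
    by (rule fourier_integral_cong_AE) (use ae' in auto)
  have FIm [measurable]: "fourier_integral f \<in> borel_measurable lebesgue"
    by (intro measurable_completion) (simp add: borel_measurable_fourier_integral fm)
  have "(\<integral>\<^sup>+\<xi>. ennreal ((cmod (fourier_integral h \<xi>))\<^sup>2) \<partial>lborel) = ennreal (LINT x|lborel. (cmod (h x))\<^sup>2)"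
    by (rule Plancherel_bounded_borel[OF hm, of M r]) (use M0 in \<open>auto simp: h_def\<close>)
  also have "(LINT x|lborel. (cmod (h x))\<^sup>2) = (LINT x|lebesgue. (cmod (h x))\<^sup>2)"
    by (subst integral_completion) auto
  also have "\<dots> = (LINT x|lebesgue. (cmod (f x))\<^sup>2)"
    by (rule integral_cong_AE) (use ae' in auto)
  finally have eq: "(\<integral>\<^sup>+\<xi>. ennreal ((cmod (fourier_integral f \<xi>))\<^sup>2) \<partial>lebesgue) = ennreal ((L2_norm f)\<^sup>2)"
    by (simp add: nn_integral_completion FI L2_norm_power2)
  then show F: "fourier_integral f \<in> L2 UNIV" by (simp add: L2_iff_nn_integral)
  from eq have "(L2_norm (fourier_integral f))\<^sup>2 = (L2_norm f)\<^sup>2" by (simp add: nn_integral_L2[OF F])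
  then show "L2_norm (fourier_integral f) = L2_norm f" by (simp add: power2_eq_iff_nonneg)
qed

text \<open>On the ball \<open>|f| <= 1 + |f|^2\<close>, so bounded support turns square
  integrability into integrability.\<close>

lemma integrable_L2_ball:
  fixes f :: "real ^ 'd \<Rightarrow> complex"
  assumes f: "f \<in> L2 UNIV" and supp: "\<And>x. x \<notin> ball 0 r \<Longrightarrow> f x = 0"
  shows "integrable lebesgue f"
proof (rule Bochner_Integration.integrable_bound)
  have "integrable lebesgue (\<lambda>x. 1 * indicator (ball 0 r) (x :: real ^ 'd) :: real)"
    using integrable_indicator_ball[of 1 r] by (subst integrable_completion) auto
  then show "integrable lebesgue (\<lambda>x. 1 * indicator (ball 0 r) x + (cmod (f x))\<^sup>2)"
    using L2_integrable[OF f] by (rule Bochner_Integration.integrable_add)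
  have "cmod (f x) \<le> 1 * indicator (ball 0 r) x + (cmod (f x))\<^sup>2" for x
  proof (cases "x \<in> ball 0 r")
    case True
    have "2 * cmod (f x) \<le> 1 + (cmod (f x))\<^sup>2"
      using sum_squares_bound[of 1 "cmod (f x)"] by simp
    then have "cmod (f x) \<le> 1 + (cmod (f x))\<^sup>2"
      using norm_ge_zero[of "f x"] by linarith
    with True show ?thesis by simp
  qed (simp add: supp)
  then show "AE x in lebesgue. norm (f x) \<le> norm (1 * indicator (ball 0 r) x + (cmod (f x))\<^sup>2)"
    by (intro always_eventually allI) (smt (verit) real_norm_def)
qed (rule L2_measurable[OF f])

text \<open>Discarding large values reduces to bounded functions. The transforms converge pointwise
  because \<open>f\<close> is integrable, and Fatou yields a contraction; applied to the discarded
  part, the contraction gives the reverse inequality.\<close>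

lemma Plancherel_compact:
  fixes f :: "real ^ 'd \<Rightarrow> complex"
  assumes f: "f \<in> L2 UNIV" and supp: "\<And>x. x \<notin> ball 0 r \<Longrightarrow> f x = 0"
  shows "fourier_integral f \<in> L2 UNIV" "L2_norm (fourier_integral f) = L2_norm f"
proof -
  \<comment> \<open>\<open>f\<close> is a parameter here and in the next facts so that the
    contraction bound is available for the difference \<open>t k f - f\<close> as well.\<close>
  define t where "t k f x = (if cmod (f x) \<le> real k then f x else 0)" for k and f :: "real ^ 'd \<Rightarrow> complex" and x
  have contr: "fourier_integral f \<in> L2 UNIV \<and> L2_norm (fourier_integral f) \<le> L2_norm f"
    and tconv: "L2_strong_conv UNIV (\<lambda>k. t k f) f"
    and tn: "fourier_integral (t k f) \<in> L2 UNIV \<and> L2_norm (fourier_integral (t k f)) = L2_norm (t k f)"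
    if f: "f \<in> L2 UNIV" and supp: "\<And>x. x \<notin> ball 0 r \<Longrightarrow> f x = 0" for f k
  proof -
    note [measurable] = L2_measurable[OF f]
    have tm [measurable]: "t k f \<in> borel_measurable lebesgue" for k unfolding t_def by measurable
    have tle: "cmod (t k f x) \<le> cmod (f x)" for k x by (simp add: t_def)
    have t2: "t k f \<in> L2 UNIV" for k by (rule L2_dominated[OF f tm tle])
    have tsupp: "t k f x = 0" if "x \<notin> ball 0 r" for k x using supp[OF that] by (simp add: t_def)
    have tlim: "(\<lambda>k. t k f x) \<longlonglongrightarrow> f x" for x
    proof (rule tendsto_eventually)
      obtain k where "cmod (f x) \<le> real k" using real_arch_simple by blast
      then show "\<forall>\<^sub>F k in sequentially. t k f x = f x"
        by (intro eventually_sequentiallyI[of k]) (auto simp: t_def)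
    qed
    have Pn: "fourier_integral (t k f) \<in> L2 UNIV" "L2_norm (fourier_integral (t k f)) = L2_norm (t k f)" for k
      by (rule Plancherel_bounded[OF tm, of k "real k" r], use tsupp t2 in \<open>auto simp: t_def\<close>)+
    show "L2_strong_conv UNIV (\<lambda>k. t k f) f"
      by (rule L2_strong_conv_dominated[OF f tm tlim tle])
    show "fourier_integral (t k f) \<in> L2 UNIV \<and> L2_norm (fourier_integral (t k f)) = L2_norm (t k f)"
      using Pn by simp
    have int: "integrable lebesgue f" by (rule integrable_L2_ball[OF f supp])
    have FIlim: "(\<lambda>k. fourier_integral (t k f) x) \<longlonglongrightarrow> fourier_integral f x" for x
      unfolding fourier_integral_def
    proof (intro tendsto_intros integral_dominated_convergence)
      show "integrable lebesgue (\<lambda>y. cmod (f y))" using int by simp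
    qed (use tle in \<open>auto simp: norm_mult intro!: tendsto_intros tlim\<close>)
    have "L2_norm (t k f) \<le> L2_norm f" for k
      unfolding L2_norm_def using L2_integrable[OF t2] L2_integrable[OF f] tle
      by (intro real_sqrt_le_mono integral_mono power_mono) auto
    with L2_AE_limit_Fatou[where us="\<lambda>k. fourier_integral (t k f)" and u="fourier_integral f" and B="L2_norm f", OF Pn(1)]
    show "fourier_integral f \<in> L2 UNIV \<and> L2_norm (fourier_integral f) \<le> L2_norm f"
      using FIlim Pn(2) by (simp add: measurable_completion borel_measurable_fourier_integral)
  qed
  show F: "fourier_integral f \<in> L2 UNIV" using contr[OF assms] by simp
  have conv: "L2_strong_conv UNIV (\<lambda>k. t k f) f" using tconv[OF assms] .
  then have t2: "t k f \<in> L2 UNIV" for k by (simp add: L2_strong_conv_def)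
  have tsupp: "t k f x = 0" if "x \<notin> ball 0 r" for k x using supp[OF that] by (simp add: t_def)
  have le: "L2_norm (t k f) \<le> L2_norm (fourier_integral f) + L2_norm (\<lambda>x. t k f x - f x)" for k
  proof -
    have "fourier_integral (\<lambda>x. t k f x - f x) = (\<lambda>x. fourier_integral (t k f) x - fourier_integral f x)"
      by (intro ext fourier_integral_diff integrable_L2_ball[of _ r] t2 f tsupp supp)
    then have "L2_norm (\<lambda>x. fourier_integral (t k f) x - fourier_integral f x) \<le> L2_norm (\<lambda>x. t k f x - f x)"
      using contr[OF L2_diff[OF t2 f], of k] supp tsupp by simp
    moreover have "\<bar>L2_norm (fourier_integral (t k f)) - L2_norm (fourier_integral f)\<bar> \<le>
        L2_norm (\<lambda>x. fourier_integral (t k f) x - fourier_integral f x)"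
      using tn[OF assms] F by (intro L2_norm_diff_ge) auto
    ultimately show ?thesis using tn[OF assms, of k] by simp
  qed
  have "L2_norm f \<le> L2_norm (fourier_integral f) + 0"
    by (rule LIMSEQ_le[OF L2_strong_conv_norm[OF conv] tendsto_add[OF tendsto_const]])
      (use conv le in \<open>auto simp: L2_strong_conv_def\<close>)
  then show "L2_norm (fourier_integral f) = L2_norm f" using contr[OF assms] by simp
qed

section \<open>The Fourier transform as a unitary operator\<close>

text \<open>The truncation built into \<open>fourier\<close>, acting on the original side;
  \<open>cutoff\<close> is its counterpart on the Fourier side and also removes large
  values.\<close>

definition truncate :: "(real ^ 'd \<Rightarrow> complex) \<Rightarrow> nat \<Rightarrow> real ^ 'd \<Rightarrow> complex" where
  "truncate u R y = (if y \<in> ball 0 (real R) then u y else 0)"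

lemma truncate_strong_conv:
  assumes u: "u \<in> L2 UNIV"
  shows "L2_strong_conv UNIV (truncate u) (u :: real ^ 'd \<Rightarrow> complex)"
proof (rule L2_strong_conv_dominated[OF u])
  note [measurable] = L2_measurable[OF u]
  have [measurable]: "ball (0 :: real ^ 'd) r \<in> sets lebesgue" for r by simp
  show "truncate u R \<in> borel_measurable lebesgue" for R
    unfolding truncate_def by measurable
  show "(\<lambda>R. truncate u R x) \<longlonglongrightarrow> u x" for x
  proof (rule tendsto_eventually)
    obtain R where "norm x < real R" using reals_Archimedean2 by blast
    then show "\<forall>\<^sub>F R in sequentially. truncate u R x = u x"
      by (intro eventually_sequentiallyI[of R]) (auto simp: truncate_def)
  qed
qed (simp add: truncate_def)

lemma L2_truncate: "u \<in> L2 UNIV \<Longrightarrow> truncate u R \<in> L2 UNIV"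
  using truncate_strong_conv by (auto simp: L2_strong_conv_def)

lemma truncate_outside: "y \<notin> ball 0 (real R) \<Longrightarrow> truncate u R y = 0"
  unfolding truncate_def by (rule if_not_P)

lemma integrable_truncate: "u \<in> L2 UNIV \<Longrightarrow> integrable lebesgue (truncate u R)"
  by (rule integrable_L2_ball[OF L2_truncate truncate_outside])

text \<open>The existence claim behind \<open>SOME\<close>. Two truncations differ by a function
  supported in the larger ball, where the Fourier integral is isometric, so the Cauchy property
  carries over from the truncations.\<close>

lemma fourier_strong_conv:
  assumes u: "u \<in> L2 UNIV"
  shows "L2_strong_conv UNIV (\<lambda>R. fourier_integral (truncate u R)) (fourier (u :: real ^ 'd \<Rightarrow> complex))"
proof -
  have F: "fourier_integral (truncate u R) \<in> L2 UNIV" for R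
    by (rule Plancherel_compact(1)[OF L2_truncate[OF u] truncate_outside])
  have iso: "L2_norm (\<lambda>x. fourier_integral (truncate u R) x - fourier_integral (truncate u S) x) =
      L2_norm (\<lambda>x. truncate u R x - truncate u S x)" for R S
    unfolding fourier_integral_diff[OF integrable_truncate[OF u] integrable_truncate[OF u], symmetric]
  proof (rule Plancherel_compact(2)[where r="real (max R S)"])
    show "(\<lambda>x. truncate u R x - truncate u S x) \<in> L2 UNIV" by (intro L2_diff L2_truncate u)
  qed (auto simp: truncate_def)
  have cauchy: "\<exists>N. \<forall>m\<ge>N. \<forall>n\<ge>N. L2_norm (\<lambda>x. fourier_integral (truncate u m) x - fourier_integral (truncate u n) x) < e"
    if "e > 0" for e
    unfolding iso using L2_strong_conv_Cauchy[OF truncate_strong_conv[OF u] that] .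
  obtain v where "L2_strong_conv UNIV (\<lambda>R. fourier_integral (truncate u R)) v"
    using L2_complete_AE[where us="\<lambda>R. fourier_integral (truncate u R)", OF F cauchy] by blast
  then have ex: "\<exists>v. L2_strong_conv UNIV (\<lambda>R. fourier_integral (truncate u R)) v" by blast
  have eq: "fourier u = (SOME v. L2_strong_conv UNIV (\<lambda>R. fourier_integral (truncate u R)) v)"
    unfolding fourier_def truncate_def ..
  show ?thesis unfolding eq using ex by (rule someI_ex)
qed

lemma L2_fourier: "u \<in> L2 UNIV \<Longrightarrow> fourier u \<in> L2 UNIV"
  using fourier_strong_conv by (auto simp: L2_strong_conv_def)

lemma L2_norm_fourier:
  assumes u: "u \<in> L2 UNIV"
  shows "L2_norm (fourier u) = L2_norm u"
proof (rule LIMSEQ_unique)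
  show "(\<lambda>R. L2_norm (fourier_integral (truncate u R))) \<longlonglongrightarrow> L2_norm (fourier u)"
    by (rule L2_strong_conv_norm[OF fourier_strong_conv[OF u]])
  show "(\<lambda>R. L2_norm (fourier_integral (truncate u R))) \<longlonglongrightarrow> L2_norm u"
  proof -
    have "L2_norm (fourier_integral (truncate u R)) = L2_norm (truncate u R)" for R
      by (rule Plancherel_compact(2)[OF L2_truncate[OF u] truncate_outside])
    then show ?thesis using L2_strong_conv_norm[OF truncate_strong_conv[OF u]] by simp
  qed
qed

section \<open>Linearity, the multiplication formula and the adjoint\<close>

lemma fourier_add:
  assumes u: "u \<in> L2 UNIV" and v: "v \<in> L2 UNIV"
  shows "AE x in lebesgue. fourier (\<lambda>x. u x + v x) x = fourier u x + fourier v x"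
proof (rule L2_strong_conv_unique)
  show "L2_strong_conv UNIV (\<lambda>R. fourier_integral (truncate (\<lambda>x. u x + v x) R)) (fourier (\<lambda>x. u x + v x))"
    by (intro fourier_strong_conv L2_add u v)
  have "truncate (\<lambda>x. u x + v x) R = (\<lambda>x. truncate u R x + truncate v R x)" for R
    by (auto simp: truncate_def)
  then have "fourier_integral (truncate (\<lambda>x. u x + v x) R) =
      (\<lambda>x. fourier_integral (truncate u R) x + fourier_integral (truncate v R) x)" for R
    by (auto simp: fourier_integral_add integrable_truncate u v)
  then show "L2_strong_conv UNIV (\<lambda>R. fourier_integral (truncate (\<lambda>x. u x + v x) R)) (\<lambda>x. fourier u x + fourier v x)"
    using L2_strong_conv_add[OF fourier_strong_conv[OF u] fourier_strong_conv[OF v]] by simp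
qed

lemma fourier_cmult:
  assumes u: "u \<in> L2 UNIV"
  shows "AE x in lebesgue. fourier (\<lambda>x. c * u x) x = c * fourier u x"
proof (rule L2_strong_conv_unique)
  show "L2_strong_conv UNIV (\<lambda>R. fourier_integral (truncate (\<lambda>x. c * u x) R)) (fourier (\<lambda>x. c * u x))"
    by (intro fourier_strong_conv L2_cmult u)
  have "truncate (\<lambda>x. c * u x) R = (\<lambda>x. c * truncate u R x)" for R
    by (auto simp: truncate_def)
  then have "fourier_integral (truncate (\<lambda>x. c * u x) R) = (\<lambda>x. c * fourier_integral (truncate u R) x)" for R
    by (auto simp: fourier_integral_cmult)
  then show "L2_strong_conv UNIV (\<lambda>R. fourier_integral (truncate (\<lambda>x. c * u x) R)) (\<lambda>x. c * fourier u x)"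
    using L2_strong_conv_cmult[OF fourier_strong_conv[OF u]] by simp
qed

lemma fourier_diff:
  assumes u: "u \<in> L2 UNIV" and v: "v \<in> L2 UNIV"
  shows "AE x in lebesgue. fourier (\<lambda>x. u x - v x) x = fourier u x - fourier v x"
  using fourier_add[OF u L2_cmult[OF v, of "-1"]] fourier_cmult[OF v, of "-1"]
  by eventually_elim simp

text \<open>Equality at every point: the Fourier integrals of the truncations coincide exactly, so
  \<open>SOME\<close> is applied to the same predicate.\<close>

lemma fourier_cong_AE:
  assumes u: "u \<in> borel_measurable lebesgue" and v: "v \<in> borel_measurable lebesgue"
    and ae: "AE x in lebesgue. u x = v x"
  shows "fourier u = fourier (v :: real ^ 'd \<Rightarrow> complex)"
proof -
  note [measurable] = u v
  have [measurable]: "ball (0 :: real ^ 'd) r \<in> sets lebesgue" for r by simp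
  have "fourier_integral (\<lambda>y. if y \<in> ball 0 (real R) then u y else 0) =
      fourier_integral (\<lambda>y. if y \<in> ball 0 (real R) then v y else 0)" for R
  proof (rule fourier_integral_cong_AE)
    show "AE y in lebesgue. (if y \<in> ball 0 (real R) then u y else 0) = (if y \<in> ball 0 (real R) then v y else 0)"
      using ae by eventually_elim simp
  qed measurable
  then show ?thesis by (simp add: fourier_def)
qed

text \<open>Both sides are one double integral, because the kernel
  \<open>iexp (- (x \<bullet> y))\<close> is symmetric in \<open>x\<close> and \<open>y\<close>.
  Borel versions of both functions make Fubini applicable.\<close>

lemma fourier_integral_multiplication:
  fixes f g :: "real ^ 'd \<Rightarrow> complex"
  assumes f: "integrable lebesgue f" and g: "integrable lebesgue g"
  shows "(LINT x|lebesgue. fourier_integral f x * g x) = (LINT x|lebesgue. f x * fourier_integral g x)"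
proof -
  note fm [measurable] = borel_measurable_integrable[OF f] and gm [measurable] = borel_measurable_integrable[OF g]
  obtain a where am [measurable]: "a \<in> borel_measurable borel" and a: "AE x in lebesgue. f x = a x"
    using lebesgue_complex_borel_version[OF borel_measurable_integrable[OF f]] .
  obtain b where bm [measurable]: "b \<in> borel_measurable borel" and b: "AE x in lebesgue. g x = b x"
    using lebesgue_complex_borel_version[OF borel_measurable_integrable[OF g]] .
  have [measurable]: "a \<in> borel_measurable lebesgue" "b \<in> borel_measurable lebesgue"
    by (simp_all add: measurable_completion)
  have Fa: "fourier_integral f = fourier_integral a" and Fb: "fourier_integral g = fourier_integral b"
    by (rule fourier_integral_cong_AE; use a b in simp)+
  have Fm: "fourier_integral a \<in> borel_measurable borel" "fourier_integral b \<in> borel_measurable borel"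
    by (simp_all add: borel_measurable_fourier_integral measurable_completion)
  have [measurable]: "fourier_integral a \<in> borel_measurable lebesgue" "fourier_integral b \<in> borel_measurable lebesgue"
    by (simp_all add: measurable_completion borel_measurable_fourier_integral)
  have "integrable lebesgue a"
    by (rule integrable_cong_AE_imp[OF f]) (use a in auto)
  moreover have "integrable lebesgue b"
    by (rule integrable_cong_AE_imp[OF g]) (use b in auto)
  ultimately have ai: "integrable lborel a" and bi: "integrable lborel b" by (simp_all add: integrable_completion)
  let ?C = "complex_of_real (fourier_const TYPE('d))"
  have "(LINT x|lebesgue. fourier_integral f x * g x) = (LINT x|lebesgue. fourier_integral a x * b x)"
    unfolding Fa by (rule integral_cong_AE) (use b in auto)
  also have "\<dots> = (LINT x|lborel. fourier_integral a x * b x)"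
    by (rule integral_completion) (use Fm bm in simp)
  also have "\<dots> = ?C * (LINT x|lborel. b x * (LINT y|lborel. iexp (- (x \<bullet> y)) * a y))"
  proof -
    have "fourier_integral a x * b x = ?C * (b x * (LINT y|lborel. iexp (- (x \<bullet> y)) * a y))" for x
      by (simp add: fourier_integral_borel[OF am])
    then show ?thesis by (simp only: integral_mult_right_zero)
  qed
  also have "\<dots> = ?C * (LINT y|lborel. (LINT x|lborel. b x * iexp (- (x \<bullet> y))) * a y)"
    by (subst Fubini_bounded_kernel[OF bi ai, where B=1]) auto
  also have "\<dots> = (LINT x|lborel. a x * fourier_integral b x)"
  proof -
    have "(LINT x|lborel. b x * iexp (- (x \<bullet> y))) = (LINT x|lborel. iexp (- (y \<bullet> x)) * b x)" for y
      by (simp add: mult.commute inner_commute)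
    then have "a y * fourier_integral b y = ?C * ((LINT x|lborel. b x * iexp (- (x \<bullet> y))) * a y)" for y
      by (simp add: fourier_integral_borel[OF bm])
    then show ?thesis by (simp only: integral_mult_right_zero)
  qed
  also have "\<dots> = (LINT x|lebesgue. a x * fourier_integral b x)"
    by (rule integral_completion[symmetric]) (use Fm am in simp)
  also have "\<dots> = (LINT x|lebesgue. f x * fourier_integral g x)"
    unfolding Fb by (rule integral_cong_AE) (use a in auto)
  finally show ?thesis .
qed

lemma fourier_multiplication:
  assumes u: "u \<in> L2 UNIV" and v: "v \<in> L2 UNIV"
  shows "(LINT x|lebesgue. fourier u x * v x) = (LINT x|lebesgue. u x * fourier v x)"
proof (rule LIMSEQ_unique)
  show "(\<lambda>R. LINT x|lebesgue. fourier_integral (truncate u R) x * truncate v R x) \<longlonglongrightarrow> (LINT x|lebesgue. fourier u x * v x)"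
    by (intro L2_strong_conv_integral_mult fourier_strong_conv truncate_strong_conv u v)
  show "(\<lambda>R. LINT x|lebesgue. fourier_integral (truncate u R) x * truncate v R x) \<longlonglongrightarrow> (LINT x|lebesgue. u x * fourier v x)"
    unfolding fourier_integral_multiplication[OF integrable_truncate[OF u] integrable_truncate[OF v]]
    by (intro L2_strong_conv_integral_mult fourier_strong_conv truncate_strong_conv u v)
qed

text \<open>The inverse transform. The multiplication formula identifies it as the Hilbert space
  adjoint, and this form inherits isometry from \<open>fourier\<close> directly.\<close>

definition fourier_adjoint :: "(real ^ 'd \<Rightarrow> complex) \<Rightarrow> real ^ 'd \<Rightarrow> complex" where
  "fourier_adjoint g x = cnj (fourier (\<lambda>y. cnj (g y)) x)"

lemma L2_fourier_adjoint: "g \<in> L2 UNIV \<Longrightarrow> fourier_adjoint g \<in> L2 UNIV"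
  unfolding fourier_adjoint_def by (intro L2_cnj L2_fourier)

lemma L2_norm_fourier_adjoint: "g \<in> L2 UNIV \<Longrightarrow> L2_norm (fourier_adjoint g) = L2_norm g"
  unfolding fourier_adjoint_def by (simp add: L2_norm_cnj L2_norm_fourier L2_cnj)

lemma L2_inner_fourier:
  assumes "u \<in> L2 UNIV" "g \<in> L2 UNIV"
  shows "L2_inner (fourier u) g = L2_inner u (fourier_adjoint g)"
  using fourier_multiplication[OF assms(1) L2_cnj[OF assms(2)]]
  by (simp add: L2_inner_def fourier_adjoint_def)

text \<open>
  Both the Fourier transform \<open>F\<close> and its adjoint \<open>J\<close> are isometric, so
  \<open>|F J g - g|\<^sup>2 = |J g|\<^sup>2 - 2 |J g|\<^sup>2 + |g|\<^sup>2 = 0\<close>; no inversion formula is needed.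
\<close>

lemma fourier_fourier_adjoint:
  assumes g: "g \<in> L2 UNIV"
  shows "AE x in lebesgue. fourier (fourier_adjoint g) x = g x"
proof -
  let ?J = "fourier_adjoint g"
  have J: "?J \<in> L2 UNIV" by (rule L2_fourier_adjoint[OF g])
  have "(L2_norm (\<lambda>x. fourier ?J x - g x))\<^sup>2 = 0"
    unfolding L2_norm_diff_power2[OF L2_fourier[OF J] g] L2_inner_fourier[OF J g] L2_inner_self
    by (simp add: L2_norm_fourier[OF J] L2_norm_fourier_adjoint[OF g])
  then show ?thesis using L2_norm_eq_0_iff[OF L2_diff[OF L2_fourier[OF J] g]] by simp
qed

section \<open>Reflection, conjugation and transforms of real functions\<close>

lemma
  shows measurable_uminus_lebesgue [measurable]: "uminus \<in> lebesgue \<rightarrow>\<^sub>M (lebesgue :: (real ^ 'd) measure)"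
    and distr_lebesgue_uminus: "distr lebesgue lebesgue uminus = (lebesgue :: (real ^ 'd) measure)"
proof -
  \<comment> \<open>Reflection is the affine map that scales every coordinate by \<open>-1\<close>;
    its Jacobian has modulus \<open>1\<close>.\<close>
  have T: "(\<lambda>x :: real ^ 'd. 0 + (\<Sum>j\<in>Basis. ((- 1) * (x \<bullet> j)) *\<^sub>R j)) = uminus"
    by (auto simp: sum_negf euclidean_representation)
  show "uminus \<in> lebesgue \<rightarrow>\<^sub>M (lebesgue :: (real ^ 'd) measure)"
    using lebesgue_affine_measurable[of "\<lambda>_ :: real ^ 'd. - 1" 0] unfolding T by simp
  show "distr lebesgue lebesgue uminus = (lebesgue :: (real ^ 'd) measure)"
    using lebesgue_affine_euclidean[of "\<lambda>_ :: real ^ 'd. - 1" 0] unfolding T by (simp add: density_1)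
qed

lemma lebesgue_integral_uminus:
  fixes f :: "real ^ 'd \<Rightarrow> 'b::{banach, second_countable_topology}"
  assumes [measurable]: "f \<in> borel_measurable lebesgue"
  shows "(LINT x|lebesgue. f (- x)) = (LINT x|lebesgue. f x)"
  by (subst (2) distr_lebesgue_uminus[symmetric]) (simp add: integral_distr)

lemma AE_lebesgue_uminus:
  assumes "AE x in (lebesgue :: (real ^ 'd) measure). P x"
  shows "AE x in lebesgue. P (- x)"
proof -
  have "AE x in distr lebesgue lebesgue (uminus :: real ^ 'd \<Rightarrow> _). P x"
    using assms by (simp only: distr_lebesgue_uminus)
  then show ?thesis by (rule AE_distrD[OF measurable_uminus_lebesgue])
qed

lemma
  assumes u: "u \<in> L2 UNIV"
  shows L2_reflect: "(\<lambda>x. u (- x)) \<in> L2 UNIV" and L2_norm_reflect: "L2_norm (\<lambda>x. u (- x)) = L2_norm u"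
proof -
  note [measurable] = L2_measurable[OF u]
  have "integrable (distr lebesgue lebesgue uminus) (\<lambda>x. (cmod (u x))\<^sup>2)"
    using L2_integrable[OF u] by (simp only: distr_lebesgue_uminus)
  then show "(\<lambda>x. u (- x)) \<in> L2 UNIV" by (simp add: L2_UNIV_iff integrable_distr_eq)
  show "L2_norm (\<lambda>x. u (- x)) = L2_norm u"
    unfolding L2_norm_def by (subst lebesgue_integral_uminus[where f="\<lambda>x. (cmod (u x))\<^sup>2"]) auto
qed

text \<open>Reflection and conjugation are isometries, so the rule for Fourier integrals passes to
  the strong limit.\<close>

lemma fourier_cnj:
  assumes u: "u \<in> L2 UNIV"
  shows "AE x in lebesgue. fourier (\<lambda>x. cnj (u x)) x = cnj (fourier u (- x))"
proof (rule L2_strong_conv_unique)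
  show "L2_strong_conv UNIV (\<lambda>R. fourier_integral (truncate (\<lambda>x. cnj (u x)) R)) (fourier (\<lambda>x. cnj (u x)))"
    by (intro fourier_strong_conv L2_cnj u)
  have "truncate (\<lambda>x. cnj (u x)) R = (\<lambda>x. cnj (truncate u R x))" for R
    by (auto simp: truncate_def)
  then have eq: "fourier_integral (truncate (\<lambda>x. cnj (u x)) R) = (\<lambda>x. cnj (fourier_integral (truncate u R) (- x)))" for R
    by (auto simp: fourier_integral_cnj)
  let ?f = "\<lambda>R. fourier_integral (truncate u R)"
  have f: "?f R \<in> L2 UNIV" and lim: "(\<lambda>R. L2_norm (\<lambda>x. ?f R x - fourier u x)) \<longlonglongrightarrow> 0" for R
    using fourier_strong_conv[OF u] by (auto simp: L2_strong_conv_def)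
  have "L2_norm (\<lambda>x. cnj (?f R (- x)) - cnj (fourier u (- x))) = L2_norm (\<lambda>x. ?f R x - fourier u x)" for R
    using L2_norm_cnj[of "\<lambda>x. ?f R (- x) - fourier u (- x)"]
      L2_norm_reflect[OF L2_diff[OF f[of R] L2_fourier[OF u]]] by simp
  then show "L2_strong_conv UNIV (\<lambda>R. fourier_integral (truncate (\<lambda>x. cnj (u x)) R)) (\<lambda>x. cnj (fourier u (- x)))"
    using L2_cnj[OF L2_reflect[OF f]] L2_cnj[OF L2_reflect[OF L2_fourier[OF u]]] lim
    unfolding L2_strong_conv_def eq by simp
qed

lemma fourier_L2_real:
  assumes "u \<in> L2 \<real>"
  shows "AE x in lebesgue. fourier u (- x) = cnj (fourier u x)"
proof -
  have u: "u \<in> L2 UNIV" using assms by (simp add: L2_def)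
  have "cnj (u x) = u x" for x using assms by (auto simp: L2_def Reals_cnj_iff)
  with AE_lebesgue_uminus[OF fourier_cnj[OF u]] show ?thesis by simp
qed

text \<open>In the real case the preimage is the real part of \<open>fourier_adjoint g\<close>. Its
  transform is the average of \<open>g x\<close> and \<open>cnj (g (- x))\<close>, which is
  \<open>g x\<close> by symmetry.\<close>

lemma fourier_surj:
  assumes K: "K = UNIV \<or> K = \<real>" and g: "g \<in> L2 UNIV"
    and sym: "K = \<real> \<Longrightarrow> AE x in lebesgue. g (- x) = cnj (g x)"
  obtains w where "w \<in> L2 K" "AE x in lebesgue. fourier w x = g x"
proof (cases "K = UNIV")
  case True
  with L2_fourier_adjoint[OF g] fourier_fourier_adjoint[OF g] that show thesis by blast
next
  case False
  then have K: "K = \<real>" using K by simp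
  let ?w = "fourier_adjoint g" and ?v = "\<lambda>x. complex_of_real (Re (fourier_adjoint g x))"
  have w: "?w \<in> L2 UNIV" by (rule L2_fourier_adjoint[OF g])
  have v_eq: "?v = (\<lambda>x. (1/2) * (?w x + cnj (?w x)))"
    by (auto simp: complex_eq_iff)
  have v: "?v \<in> L2 K"
    using L2_norm_Re_diff_le(1)[OF w, of "\<lambda>_. 0"] unfolding K by (simp add: L2_def)
  note wc = L2_add[OF w L2_cnj[OF w]]
  have "AE x in lebesgue. fourier ?v x = g x"
    unfolding v_eq
    using fourier_cmult[OF wc, of "1/2"] fourier_add[OF w L2_cnj[OF w]] fourier_fourier_adjoint[OF g]
      fourier_cnj[OF w] AE_lebesgue_uminus[OF fourier_fourier_adjoint[OF g]] sym[OF K]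
    by eventually_elim simp
  with v show thesis by (rule that)
qed

section \<open>Fourier multiplier forms\<close>

text \<open>The quadratic form with values in \<open>ennreal\<close>: infinity, the value outside
  the domain, is included, so inequalities need no case distinction on membership in the
  domain.\<close>

definition energy :: "(real ^ 'd \<Rightarrow> real) \<Rightarrow> (real ^ 'd \<Rightarrow> complex) \<Rightarrow> ennreal" where
  "energy \<phi> u = (\<integral>\<^sup>+x. ennreal ((cmod (fourier u x))\<^sup>2 * \<phi> x) \<partial>lebesgue)"

lemma multiplier_domain_iff: "u \<in> multiplier_domain K \<phi> \<longleftrightarrow> u \<in> L2 K \<and> energy \<phi> u < \<infinity>"
  by (auto simp: multiplier_domain_def energy_def)

lemma energy_cong_AE:
  assumes "AE x in lebesgue. fourier u x = v x"
  shows "energy \<phi> u = (\<integral>\<^sup>+x. ennreal ((cmod (v x))\<^sup>2 * \<phi> x) \<partial>lebesgue)"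
  unfolding energy_def by (rule nn_integral_cong_AE) (use assms in eventually_elim, simp)

lemma multiplier_form_self:
  "multiplier_form \<phi> u u = complex_of_real (LINT x|lebesgue. (cmod (fourier u x))\<^sup>2 * \<phi> x)"
  unfolding multiplier_form_def integral_complex_of_real[symmetric] of_real_mult complex_norm_square[symmetric]
  by simp

text \<open>The sign and the evenness are required almost everywhere, which is all that an L1 limit
  inherits. Evenness makes the form real on real functions.\<close>

locale multiplier =
  fixes \<phi> :: "real ^ 'd \<Rightarrow> real"
  assumes measurable_multiplier [measurable]: "\<phi> \<in> borel_measurable lebesgue"
    and nonneg: "AE x in lebesgue. 0 \<le> \<phi> x"
    and even: "AE x in lebesgue. \<phi> (- x) = \<phi> x"
begin

text \<open>Covers infinite energy too: both sides are then \<open>0\<close>, by the conventions for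
  \<open>LINT\<close> and \<open>enn2real\<close>.\<close>

lemma Re_multiplier_form_self:
  assumes u: "u \<in> L2 UNIV"
  shows "Re (multiplier_form \<phi> u u) = enn2real (energy \<phi> u)"
proof -
  note [measurable] = L2_measurable[OF L2_fourier[OF u]]
  show ?thesis
    unfolding multiplier_form_self energy_def
    by (simp, rule integral_eq_nn_integral) (use nonneg in auto)
qed

lemma extended_form_multiplier:
  assumes u: "u \<in> L2 K"
  shows "extended_form (multiplier_domain K \<phi>) (multiplier_form \<phi>) u = enn2ereal (energy \<phi> u)"
proof -
  have u': "u \<in> L2 UNIV" using u by (simp add: L2_def)
  show ?thesis
  proof (cases "energy \<phi> u < \<infinity>")
    case True
    then have "enn2ereal (energy \<phi> u) = ereal (enn2real (energy \<phi> u))"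
      by (cases "energy \<phi> u") auto
    with True u show ?thesis
      by (simp add: extended_form_def multiplier_domain_iff Re_multiplier_form_self[OF u'])
  next
    case False
    then have "energy \<phi> u = \<infinity>" by (metis infinity_ennreal_def less_top)
    then show ?thesis by (simp add: extended_form_def multiplier_domain_iff)
  qed
qed

lemma energy_add_finite:
  assumes u: "u \<in> L2 UNIV" and v: "v \<in> L2 UNIV" and fin: "energy \<phi> u < \<infinity>" "energy \<phi> v < \<infinity>"
  shows "energy \<phi> (\<lambda>x. u x + v x) < \<infinity>"
proof -
  note [measurable] = L2_measurable[OF L2_fourier[OF u]] L2_measurable[OF L2_fourier[OF v]]
  have "energy \<phi> (\<lambda>x. u x + v x) = (\<integral>\<^sup>+x. ennreal ((cmod (fourier u x + fourier v x))\<^sup>2 * \<phi> x) \<partial>lebesgue)"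
    by (rule energy_cong_AE[OF fourier_add[OF u v]])
  also have "\<dots> \<le> (\<integral>\<^sup>+x. 2 * ennreal ((cmod (fourier u x))\<^sup>2 * \<phi> x) + 2 * ennreal ((cmod (fourier v x))\<^sup>2 * \<phi> x) \<partial>lebesgue)"
  proof (rule nn_integral_mono_AE, use nonneg in eventually_elim)
    case (elim x)
    have "ennreal ((cmod (fourier u x + fourier v x))\<^sup>2 * \<phi> x) \<le>
        ennreal (2 * ((cmod (fourier u x))\<^sup>2 * \<phi> x) + 2 * ((cmod (fourier v x))\<^sup>2 * \<phi> x))"
      using mult_right_mono[OF power2_norm_add_le[of "fourier u x" "fourier v x"] elim]
      by (intro ennreal_leI) (simp add: algebra_simps)
    also have "\<dots> = 2 * ennreal ((cmod (fourier u x))\<^sup>2 * \<phi> x) + 2 * ennreal ((cmod (fourier v x))\<^sup>2 * \<phi> x)"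
      using elim by (simp add: ennreal_plus ennreal_mult'')
    finally show ?case .
  qed
  also have "\<dots> = 2 * energy \<phi> u + 2 * energy \<phi> v"
    unfolding energy_def by (simp add: nn_integral_add nn_integral_cmult)
  also have "\<dots> < \<infinity>" using fin by (simp add: ennreal_mult_less_top)
  finally show ?thesis .
qed

lemma energy_cmult_finite:
  assumes u: "u \<in> L2 UNIV" and fin: "energy \<phi> u < \<infinity>"
  shows "energy \<phi> (\<lambda>x. c * u x) < \<infinity>"
proof -
  note [measurable] = L2_measurable[OF L2_fourier[OF u]]
  have "energy \<phi> (\<lambda>x. c * u x) = (\<integral>\<^sup>+x. ennreal ((cmod (c * fourier u x))\<^sup>2 * \<phi> x) \<partial>lebesgue)"
    by (rule energy_cong_AE[OF fourier_cmult[OF u]])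
  also have "\<dots> = (\<integral>\<^sup>+x. ennreal ((cmod c)\<^sup>2) * ennreal ((cmod (fourier u x))\<^sup>2 * \<phi> x) \<partial>lebesgue)"
    by (intro nn_integral_cong) (simp add: norm_mult power_mult_distrib ennreal_mult'[symmetric] mult.assoc)
  also have "\<dots> = ennreal ((cmod c)\<^sup>2) * energy \<phi> u"
    unfolding energy_def by (simp add: nn_integral_cmult)
  also have "\<dots> < \<infinity>" using fin by (simp add: ennreal_mult_less_top)
  finally show ?thesis .
qed

lemma integrable_multiplier_form:
  assumes u: "u \<in> L2 UNIV" and v: "v \<in> L2 UNIV" and fin: "energy \<phi> u < \<infinity>" "energy \<phi> v < \<infinity>"
  shows "integrable lebesgue (\<lambda>x. fourier u x * cnj (fourier v x) * complex_of_real (\<phi> x))"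
proof (rule Bochner_Integration.integrable_bound)
  note [measurable] = L2_measurable[OF L2_fourier[OF u]] L2_measurable[OF L2_fourier[OF v]]
  show "(\<lambda>x. fourier u x * cnj (fourier v x) * complex_of_real (\<phi> x)) \<in> borel_measurable lebesgue" by measurable
  have "integrable lebesgue (\<lambda>x. (cmod (fourier u x))\<^sup>2 * \<phi> x)" "integrable lebesgue (\<lambda>x. (cmod (fourier v x))\<^sup>2 * \<phi> x)"
    by (rule integrableI_nonneg, measurable, use nonneg fin in \<open>auto simp: energy_def\<close>)+
  then show "integrable lebesgue (\<lambda>x. (cmod (fourier u x))\<^sup>2 * \<phi> x + (cmod (fourier v x))\<^sup>2 * \<phi> x)"
    by (rule Bochner_Integration.integrable_add)
  show "AE x in lebesgue. norm (fourier u x * cnj (fourier v x) * complex_of_real (\<phi> x)) \<le>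
      norm ((cmod (fourier u x))\<^sup>2 * \<phi> x + (cmod (fourier v x))\<^sup>2 * \<phi> x)"
    using nonneg
  proof eventually_elim
    case (elim x)
    have "cmod (fourier u x) * cmod (fourier v x) \<le> (cmod (fourier u x))\<^sup>2 + (cmod (fourier v x))\<^sup>2"
      using sum_squares_bound[of "cmod (fourier u x)" "cmod (fourier v x)"]
        mult_nonneg_nonneg[OF norm_ge_zero norm_ge_zero, of "fourier u x" "fourier v x"] by linarith
    from mult_right_mono[OF this elim] elim show ?case
      by (simp add: norm_mult distrib_right)
  qed
qed

lemma multiplier_form_add_left:
  assumes u: "u \<in> L2 UNIV" "energy \<phi> u < \<infinity>" and v: "v \<in> L2 UNIV" "energy \<phi> v < \<infinity>"
    and w: "w \<in> L2 UNIV" "energy \<phi> w < \<infinity>"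
  shows "multiplier_form \<phi> (\<lambda>x. u x + v x) w = multiplier_form \<phi> u w + multiplier_form \<phi> v w"
proof -
  note [measurable] = L2_measurable[OF L2_fourier] u v w L2_add
  have "multiplier_form \<phi> (\<lambda>x. u x + v x) w =
      (LINT x|lebesgue. fourier u x * cnj (fourier w x) * complex_of_real (\<phi> x) + fourier v x * cnj (fourier w x) * complex_of_real (\<phi> x))"
    unfolding multiplier_form_def
  proof (rule integral_cong_AE)
    show "AE x in lebesgue. fourier (\<lambda>x. u x + v x) x * cnj (fourier w x) * complex_of_real (\<phi> x) =
        fourier u x * cnj (fourier w x) * complex_of_real (\<phi> x) + fourier v x * cnj (fourier w x) * complex_of_real (\<phi> x)"
      using fourier_add[OF u(1) v(1)] by eventually_elim (simp add: distrib_right)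
  qed measurable
  also have "\<dots> = multiplier_form \<phi> u w + multiplier_form \<phi> v w"
    unfolding multiplier_form_def
    using assms by (intro Bochner_Integration.integral_add integrable_multiplier_form)
  finally show ?thesis .
qed

lemma multiplier_form_cmult_left:
  assumes u: "u \<in> L2 UNIV" and w: "w \<in> L2 UNIV"
  shows "multiplier_form \<phi> (\<lambda>x. c * u x) w = c * multiplier_form \<phi> u w"
proof -
  note [measurable] = L2_measurable[OF L2_fourier] u w L2_cmult
  have "multiplier_form \<phi> (\<lambda>x. c * u x) w =
      (LINT x|lebesgue. c * (fourier u x * cnj (fourier w x) * complex_of_real (\<phi> x)))"
    unfolding multiplier_form_def
  proof (rule integral_cong_AE)
    show "AE x in lebesgue. fourier (\<lambda>x. c * u x) x * cnj (fourier w x) * complex_of_real (\<phi> x) =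
        c * (fourier u x * cnj (fourier w x) * complex_of_real (\<phi> x))"
      using fourier_cmult[OF u, of c] by eventually_elim (simp add: mult_ac)
  qed measurable
  then show ?thesis by (simp add: multiplier_form_def)
qed

lemma multiplier_form_commute: "multiplier_form \<phi> v u = cnj (multiplier_form \<phi> u v)"
  unfolding multiplier_form_def
  by (subst Bochner_Integration.integral_cnj[symmetric]) (simp add: mult_ac)

text \<open>Reflecting the variable turns the integrand into its conjugate, by the symmetry of
  transforms of real functions and evenness of \<open>\<phi>\<close>.\<close>

lemma multiplier_form_real:
  assumes u: "u \<in> L2 \<real>" and v: "v \<in> L2 \<real>"
  shows "multiplier_form \<phi> u v \<in> \<real>"
proof -
  have u': "u \<in> L2 UNIV" and v': "v \<in> L2 UNIV" using u v by (auto simp: L2_def)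
  note [measurable] = L2_measurable[OF L2_fourier] u' v'
  let ?f = "\<lambda>x. fourier u x * cnj (fourier v x) * complex_of_real (\<phi> x)"
  have f [measurable]: "?f \<in> borel_measurable lebesgue" by measurable
  have "(LINT x|lebesgue. ?f x) = (LINT x|lebesgue. ?f (- x))"
    by (rule lebesgue_integral_uminus[OF f, symmetric])
  also have "\<dots> = (LINT x|lebesgue. cnj (?f x))"
  proof (rule integral_cong_AE)
    show "(\<lambda>x. ?f (- x)) \<in> borel_measurable lebesgue"
      by (rule measurable_compose[OF measurable_uminus_lebesgue f])
    show "AE x in lebesgue. ?f (- x) = cnj (?f x)"
      using fourier_L2_real[OF u] fourier_L2_real[OF v] even by eventually_elim simp
  qed measurable
  finally have "multiplier_form \<phi> u v = cnj (multiplier_form \<phi> u v)"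
    unfolding multiplier_form_def Bochner_Integration.integral_cnj .
  then show ?thesis by (metis Reals_cnj_iff)
qed

lemma energy_Fatou:
  assumes v: "\<And>k. v k \<in> borel_measurable lebesgue" and lim: "AE x in lebesgue. (\<lambda>k. v k x) \<longlonglongrightarrow> f x"
    and bd: "\<forall>\<^sub>F k in sequentially. (\<integral>\<^sup>+x. ennreal ((cmod (v k x))\<^sup>2 * \<phi> x) \<partial>lebesgue) \<le> B"
  shows "(\<integral>\<^sup>+x. ennreal ((cmod (f x))\<^sup>2 * \<phi> x) \<partial>lebesgue) \<le> B"
proof -
  note [measurable] = v
  have "(\<integral>\<^sup>+x. ennreal ((cmod (f x))\<^sup>2 * \<phi> x) \<partial>lebesgue) =
      (\<integral>\<^sup>+x. liminf (\<lambda>k. ennreal ((cmod (v k x))\<^sup>2 * \<phi> x)) \<partial>lebesgue)"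
  proof (rule nn_integral_cong_AE, use lim in eventually_elim)
    case (elim x)
    then have "(\<lambda>k. ennreal ((cmod (v k x))\<^sup>2 * \<phi> x)) \<longlonglongrightarrow> ennreal ((cmod (f x))\<^sup>2 * \<phi> x)"
      by (intro tendsto_ennrealI tendsto_intros)
    then show ?case by (rule lim_imp_Liminf[OF trivial_limit_sequentially, symmetric])
  qed
  also have "\<dots> \<le> liminf (\<lambda>k. (\<integral>\<^sup>+x. ennreal ((cmod (v k x))\<^sup>2 * \<phi> x) \<partial>lebesgue))"
    by (intro nn_integral_liminf) auto
  also have "\<dots> \<le> liminf (\<lambda>k::nat. B)"
    by (rule Liminf_mono[OF bd])
  finally show ?thesis by (simp add: Liminf_const)
qed

text \<open>The L2 limit \<open>u\<close> is the only candidate. Along a subsequence the transforms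
  converge almost everywhere, and Fatou in the second index bounds the energy of
  \<open>us n - u\<close>. The same estimate puts \<open>u\<close> into the domain.\<close>

lemma multiplier_form_complete:
  assumes K: "K = UNIV \<or> K = \<real>" and us: "\<And>n. us n \<in> multiplier_domain K \<phi>"
    and cauchy: "\<And>e. e > 0 \<Longrightarrow> \<exists>N. \<forall>m\<ge>N. \<forall>n\<ge>N.
      enn2real (energy \<phi> (\<lambda>x. us m x - us n x)) + (L2_norm (\<lambda>x. us m x - us n x))\<^sup>2 < e"
  obtains u where "u \<in> multiplier_domain K \<phi>"
    "(\<lambda>n. enn2real (energy \<phi> (\<lambda>x. us n x - u x)) + (L2_norm (\<lambda>x. us n x - u x))\<^sup>2) \<longlonglongrightarrow> 0"
proof -
  have usK: "us n \<in> L2 K" and us2: "us n \<in> L2 UNIV" and fin: "energy \<phi> (us n) < \<infinity>" for n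
    using us[of n] by (auto simp: multiplier_domain_iff L2_def)
  have diff_eq: "(\<lambda>x. a x - b x) = (\<lambda>x. a x + (-1) * b x)" for a b :: "real ^ 'd \<Rightarrow> complex" by auto
  have dfin: "energy \<phi> (\<lambda>x. us m x - us n x) < \<infinity>" for m n
    unfolding diff_eq by (intro energy_add_finite energy_cmult_finite L2_cmult us2 fin)
  have cauchy2: "\<exists>N. \<forall>m\<ge>N. \<forall>n\<ge>N. L2_norm (\<lambda>x. us m x - us n x) < e" if "e > 0" for e
  proof -
    from cauchy[of "e\<^sup>2"] that obtain N where N: "\<And>m n. m \<ge> N \<Longrightarrow> n \<ge> N \<Longrightarrow>
        enn2real (energy \<phi> (\<lambda>x. us m x - us n x)) + (L2_norm (\<lambda>x. us m x - us n x))\<^sup>2 < e\<^sup>2"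
      by auto
    have "L2_norm (\<lambda>x. us m x - us n x) < e" if "m \<ge> N" "n \<ge> N" for m n
    proof -
      have "(L2_norm (\<lambda>x. us m x - us n x))\<^sup>2 < e\<^sup>2"
        using N[OF that] enn2real_nonneg[of "energy \<phi> (\<lambda>x. us m x - us n x)"] by linarith
      then show ?thesis using \<open>e > 0\<close> by (intro power2_less_imp_less[of _ e]) auto
    qed
    then show ?thesis by blast
  qed
  obtain u where "L2_strong_conv K us u" using L2_complete[OF K usK cauchy2] by blast
  then have uK: "u \<in> L2 K" and ulim: "(\<lambda>n. L2_norm (\<lambda>x. us n x - u x)) \<longlonglongrightarrow> 0"
    by (auto simp: L2_strong_conv_def)
  have u2: "u \<in> L2 UNIV" using uK by (simp add: L2_def)
  have Fnorm: "L2_norm (\<lambda>x. fourier a x - fourier b x) = L2_norm (\<lambda>x. a x - b x)" if "a \<in> L2 UNIV" "b \<in> L2 UNIV" for a b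
  proof -
    have "L2_norm (\<lambda>x. fourier a x - fourier b x) = L2_norm (fourier (\<lambda>x. a x - b x))"
      using fourier_diff[OF that] that
      by (intro L2_norm_cong_AE) (auto intro: L2_diff L2_fourier)
    then show ?thesis using that by (simp add: L2_norm_fourier L2_diff)
  qed
  have Fu: "L2_strong_conv UNIV (\<lambda>n. fourier (us n)) (fourier u)"
    using ulim us2 u2 by (simp add: L2_strong_conv_def L2_fourier Fnorm)
  \<comment> \<open>\<open>v\<close> is auxiliary: completeness supplies the subsequence, and
    uniqueness of strong limits then identifies \<open>v\<close> with
    \<open>fourier u\<close>.\<close>
  obtain v r where v: "L2_strong_conv UNIV (\<lambda>n. fourier (us n)) v" and r: "strict_mono (r :: nat \<Rightarrow> nat)"
    and rlim: "AE x in lebesgue. (\<lambda>k. fourier (us (r k)) x) \<longlonglongrightarrow> v x"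
    using L2_complete_AE[where us="\<lambda>n. fourier (us n)"] us2 cauchy2 by (auto simp: L2_fourier Fnorm)
  from L2_strong_conv_unique[OF Fu v] rlim have rlim: "AE x in lebesgue. (\<lambda>k. fourier (us (r k)) x) \<longlonglongrightarrow> fourier u x"
    by eventually_elim simp
  have small: "energy \<phi> (\<lambda>x. us n x - u x) \<le> ennreal e"
    if N: "\<forall>m\<ge>N. \<forall>n\<ge>N. enn2real (energy \<phi> (\<lambda>x. us m x - us n x)) + (L2_norm (\<lambda>x. us m x - us n x))\<^sup>2 < e"
      and n: "n \<ge> N" for N n e
  proof -
    note [measurable] = L2_measurable[OF L2_fourier[OF us2]]
    have e0: "0 \<le> e"
      using N[rule_format, OF n n] enn2real_nonneg[of "energy \<phi> (\<lambda>x. us n x - us n x)"] zero_le_power2[of "L2_norm (\<lambda>x. us n x - us n x)"] by linarith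
    have "energy \<phi> (\<lambda>x. us n x - u x) = (\<integral>\<^sup>+x. ennreal ((cmod (fourier (us n) x - fourier u x))\<^sup>2 * \<phi> x) \<partial>lebesgue)"
      by (rule energy_cong_AE[OF fourier_diff[OF us2 u2]])
    also have "\<dots> \<le> ennreal e"
    proof (rule energy_Fatou[where v="\<lambda>k x. fourier (us n) x - fourier (us (r k)) x"])
      show "AE x in lebesgue. (\<lambda>k. fourier (us n) x - fourier (us (r k)) x) \<longlonglongrightarrow> fourier (us n) x - fourier u x"
        using rlim by eventually_elim (intro tendsto_intros)
      show "\<forall>\<^sub>F k in sequentially. (\<integral>\<^sup>+x. ennreal ((cmod (fourier (us n) x - fourier (us (r k)) x))\<^sup>2 * \<phi> x) \<partial>lebesgue) \<le> ennreal e"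
        using eventually_ge_at_top[of N]
      proof eventually_elim
        case (elim k)
        then have "r k \<ge> N" using seq_suble[OF r, of k] by simp
        then have "enn2real (energy \<phi> (\<lambda>x. us n x - us (r k) x)) \<le> e"
          using N[rule_format, OF n \<open>r k \<ge> N\<close>] zero_le_power2[of "L2_norm (\<lambda>x. us n x - us (r k) x)"] by linarith
        then have "energy \<phi> (\<lambda>x. us n x - us (r k) x) \<le> ennreal e"
          using dfin[of n "r k"] e0 by (cases "energy \<phi> (\<lambda>x. us n x - us (r k) x)") auto
        then show ?case by (simp add: energy_cong_AE[OF fourier_diff[OF us2 us2]])
      qed
    qed measurable
    finally show ?thesis .
  qed
  have "energy \<phi> u < \<infinity>"
  proof -
    obtain N where N: "\<forall>m\<ge>N. \<forall>n\<ge>N. enn2real (energy \<phi> (\<lambda>x. us m x - us n x)) + (L2_norm (\<lambda>x. us m x - us n x))\<^sup>2 < 1"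
      using cauchy[of 1] by auto
    have 1: "energy \<phi> (\<lambda>x. us N x - u x) < \<infinity>"
      using small[OF N order_refl] by (rule le_less_trans) simp
    \<comment> \<open>This function is \<open>u\<close>, written as a combination of two functions
      of finite energy.\<close>
    have "energy \<phi> (\<lambda>x. us N x + (-1) * (us N x - u x)) < \<infinity>"
      by (intro energy_add_finite energy_cmult_finite L2_cmult L2_diff us2 u2 fin 1)
    then show ?thesis by simp
  qed
  then have "u \<in> multiplier_domain K \<phi>" using uK by (simp add: multiplier_domain_iff)
  moreover have Elim: "(\<lambda>n. enn2real (energy \<phi> (\<lambda>x. us n x - u x))) \<longlonglongrightarrow> 0"
  proof (rule LIMSEQ_I)
    fix e :: real assume "e > 0"
    then obtain N where N: "\<forall>m\<ge>N. \<forall>n\<ge>N. enn2real (energy \<phi> (\<lambda>x. us m x - us n x)) + (L2_norm (\<lambda>x. us m x - us n x))\<^sup>2 < e / 2"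
      using cauchy[of "e / 2"] by auto
    have "enn2real (energy \<phi> (\<lambda>x. us n x - u x)) \<le> e / 2" if "n \<ge> N" for n
      using small[OF N that] \<open>e > 0\<close> by (intro enn2real_leI) auto
    then show "\<exists>N. \<forall>n\<ge>N. norm (enn2real (energy \<phi> (\<lambda>x. us n x - u x)) - 0) < e"
      using \<open>e > 0\<close> by (intro exI[of _ N]) (force simp: enn2real_nonneg)
  qed
  note tendsto_add[OF Elim tendsto_power[OF ulim, of 2]]
  ultimately show thesis by (intro that) simp_all
qed

lemma closed_form_multiplier:
  assumes K: "K = UNIV \<or> K = \<real>"
  shows "closed_form K (multiplier_domain K \<phi>) (multiplier_form \<phi>)"
proof -
  let ?F = "multiplier_domain K \<phi>" and ?E = "multiplier_form \<phi>"
  have F2: "u \<in> L2 UNIV" "energy \<phi> u < \<infinity>" if "u \<in> ?F" for u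
    using that by (auto simp: multiplier_domain_iff L2_def)
  have K0: "0 \<in> K" and Kadd: "a \<in> K \<Longrightarrow> b \<in> K \<Longrightarrow> a + b \<in> K" and Kmult: "a \<in> K \<Longrightarrow> b \<in> K \<Longrightarrow> a * b \<in> K" for a b
    using K by auto
  have zero: "(\<lambda>x. 0) \<in> ?F"
  proof -
    have "AE x in lebesgue. fourier (\<lambda>x. 0 :: complex) x = (0 :: complex)"
      using fourier_cmult[OF L2_zero, of 0] by simp
    from energy_cong_AE[OF this] have "energy \<phi> (\<lambda>x. 0) = 0" by simp
    then show ?thesis using L2_zero K0 by (simp add: multiplier_domain_iff L2_iff[of _ K])
  qed
  have add: "(\<lambda>x. u x + v x) \<in> ?F" if u: "u \<in> ?F" and v: "v \<in> ?F" for u v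
    unfolding multiplier_domain_iff L2_iff[of _ K]
    using energy_add_finite[OF F2(1)[OF u] F2(1)[OF v] F2(2)[OF u] F2(2)[OF v]] L2_add[OF F2(1)[OF u] F2(1)[OF v]] u v
    by (auto simp: multiplier_domain_iff L2_def intro!: Kadd)
  have cmult: "(\<lambda>x. c * u x) \<in> ?F" if c: "c \<in> K" and u: "u \<in> ?F" for c u
    unfolding multiplier_domain_iff L2_iff[of _ K]
    using energy_cmult_finite[OF F2[OF u]] L2_cmult[OF F2(1)[OF u]] u c
    by (auto simp: multiplier_domain_iff L2_def intro!: Kmult)
  have cong: "fourier u = fourier u'" if "u \<in> L2 K" "u' \<in> L2 K" "AE x in lebesgue. u x = u' x" for u u' :: "real ^ 'd \<Rightarrow> complex"
    using that by (intro fourier_cong_AE) (auto simp: L2_measurable)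
  have FK: "u \<in> L2 K" if "u \<in> ?F" for u using that by (simp add: multiplier_domain_iff)
  have complete: "\<exists>u\<in>?F. (\<lambda>n. let w = (\<lambda>x. us n x - u x) in Re (?E w w) + (L2_norm w)\<^sup>2) \<longlonglongrightarrow> 0"
    if us: "\<forall>n. us n \<in> ?F" and cauchy: "\<forall>e>0. \<exists>N. \<forall>m\<ge>N. \<forall>n\<ge>N.
      (let w = (\<lambda>x. us m x - us n x) in Re (?E w w) + (L2_norm w)\<^sup>2 < e)" for us
  proof -
    have us2: "us n \<in> L2 UNIV" for n using us F2 by blast
    have "\<exists>N. \<forall>m\<ge>N. \<forall>n\<ge>N. enn2real (energy \<phi> (\<lambda>x. us m x - us n x)) + (L2_norm (\<lambda>x. us m x - us n x))\<^sup>2 < e"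
      if "e > 0" for e
      using cauchy that by (simp add: Let_def Re_multiplier_form_self L2_diff us2)
    from multiplier_form_complete[OF K us[rule_format] this] obtain u where u: "u \<in> ?F" and
      "(\<lambda>n. enn2real (energy \<phi> (\<lambda>x. us n x - u x)) + (L2_norm (\<lambda>x. us n x - u x))\<^sup>2) \<longlonglongrightarrow> 0" by blast
    then show ?thesis
      by (intro bexI[OF _ u]) (simp add: Let_def Re_multiplier_form_self L2_diff us2 F2)
  qed
  show ?thesis
    unfolding closed_form_def
  proof (intro conjI)
    show "?F \<subseteq> L2 K" using FK by blast
    show "\<forall>u\<in>?F. \<forall>u'\<in>L2 K. (AE x in lebesgue. u x = u' x) \<longrightarrow> u' \<in> ?F"
    proof (intro ballI impI)
      fix u u' assume u: "u \<in> ?F" and u': "u' \<in> L2 K" and ae: "AE x in lebesgue. u x = u' x"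
      show "u' \<in> ?F" using u u' cong[OF FK[OF u] u' ae] by (simp add: multiplier_domain_def)
    qed
    show "\<forall>u\<in>?F. \<forall>u'\<in>?F. \<forall>v\<in>?F. (AE x in lebesgue. u x = u' x) \<longrightarrow> ?E u v = ?E u' v"
    proof (intro ballI impI)
      fix u u' v assume "u \<in> ?F" "u' \<in> ?F" "AE x in lebesgue. u x = u' x"
      then have "fourier u = fourier u'" by (intro cong FK)
      then show "?E u v = ?E u' v" by (simp add: multiplier_form_def)
    qed
    show "\<forall>u\<in>?F. \<forall>v\<in>?F. ?E u v \<in> K"
      using K FK multiplier_form_real by auto
    show "\<forall>u\<in>?F. 0 \<le> Re (?E u u)"
      using F2 by (simp add: Re_multiplier_form_self enn2real_nonneg)
    show "\<forall>u\<in>?F. \<forall>v\<in>?F. ?E v u = cnj (?E u v)"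
      by (intro ballI multiplier_form_commute)
    show "\<forall>u\<in>?F. \<forall>v\<in>?F. \<forall>w\<in>?F. ?E (\<lambda>x. u x + v x) w = ?E u w + ?E v w"
      using F2 by (intro ballI multiplier_form_add_left) auto
    show "\<forall>c\<in>K. \<forall>u\<in>?F. \<forall>v\<in>?F. ?E (\<lambda>x. c * u x) v = c * ?E u v"
      using F2 by (intro ballI multiplier_form_cmult_left) auto
  qed (use zero add cmult complete in blast)+
qed

end

section \<open>Mosco convergence of multiplier forms\<close>

text \<open>The level grows so slowly that, eventually, the sequence of level
  \<open>\<kappa> n\<close> is already below \<open>1 / (\<kappa> n + 1)\<close> at
  \<open>n\<close>. Values lie in \<open>ennreal\<close> because the errors are nonnegative
  integrals, possibly infinite.\<close>

lemma diagonal_null_sequence: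
  fixes b :: "nat \<Rightarrow> nat \<Rightarrow> ennreal"
  assumes b: "\<And>k. b k \<longlonglongrightarrow> 0"
  obtains \<kappa> where "filterlim \<kappa> at_top sequentially" "(\<lambda>n. b (\<kappa> n) n) \<longlonglongrightarrow> 0"
proof -
  have "\<exists>N. \<forall>n\<ge>N. b k n < ennreal (1 / real (Suc k))" for k
    using order_tendstoD(2)[OF b[of k], of "ennreal (1 / real (Suc k))"] by (auto simp: eventually_sequentially)
  then obtain N where N: "\<And>k n. n \<ge> N k \<Longrightarrow> b k n < ennreal (1 / real (Suc k))" by metis
  \<comment> \<open>The levels whose threshold has been passed at time \<open>n\<close>. The
    condition \<open>k \<le> n\<close> keeps the set finite, and \<open>0\<close> keeps it nonempty;
    that \<open>0\<close> carries no estimate, so the bound is used only once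
    \<open>\<kappa> n\<close> is at least \<open>1\<close>.\<close>
  define S where "S n = insert 0 {k. k \<le> n \<and> N k \<le> n}" for n
  define \<kappa> where "\<kappa> n = Max (S n)" for n
  have fin: "finite (S n)" for n unfolding S_def by simp
  have lim: "filterlim \<kappa> at_top sequentially"
    unfolding filterlim_at_top
  proof
    fix k
    have "k \<le> \<kappa> n" if "n \<ge> max k (N k)" for n
      unfolding \<kappa>_def using that fin by (intro Max_ge) (auto simp: S_def)
    then show "\<forall>\<^sub>F n in sequentially. k \<le> \<kappa> n" by (rule eventually_sequentiallyI)
  qed
  have "(\<lambda>n. b (\<kappa> n) n) \<longlonglongrightarrow> 0"
  proof (rule tendsto_sandwich[OF _ _ tendsto_const])
    have "(\<lambda>k. ennreal (1 / real (Suc k))) \<longlonglongrightarrow> ennreal 0"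
      by (intro tendsto_ennrealI LIMSEQ_Suc[OF lim_1_over_n])
    from filterlim_compose[OF this lim] show "(\<lambda>n. ennreal (1 / real (Suc (\<kappa> n)))) \<longlonglongrightarrow> 0" by simp
    have "\<forall>\<^sub>F n in sequentially. 1 \<le> \<kappa> n" using lim unfolding filterlim_at_top by blast
    then show "\<forall>\<^sub>F n in sequentially. b (\<kappa> n) n \<le> ennreal (1 / real (Suc (\<kappa> n)))"
    proof eventually_elim
      case (elim n)
      have "\<kappa> n \<in> S n" unfolding \<kappa>_def by (rule Max_in[OF fin]) (simp add: S_def)
      with elim show ?case by (intro less_imp_le[OF N]) (auto simp: S_def)
    qed
  qed simp
  with lim show thesis by (rule that)
qed

text \<open>The lower end \<open>0\<close> matters on the null set where the limit multiplier may be
  negative: clipped weights are nonnegative at every point.\<close>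

definition clip :: "nat \<Rightarrow> real \<Rightarrow> real" where
  "clip k t = max 0 (min t (real k))"

lemma clip_bounds: "0 \<le> clip k t" "clip k t \<le> real k" "\<bar>clip k s - clip k t\<bar> \<le> \<bar>s - t\<bar>" "0 \<le> t \<Longrightarrow> clip k t \<le> t"
  by (auto simp: clip_def)

lemma borel_measurable_clip [measurable]: "clip k \<in> borel_measurable borel"
  unfolding clip_def by measurable

text \<open>The condition depends only on \<open>norm x\<close> and \<open>cmod (v x)\<close>, so
  the symmetry \<open>v (- x) = cnj (v x)\<close> survives. Large values become \<open>0\<close>
  instead of being scaled down, so \<open>v * cnj g\<close> equals \<open>|g|^2\<close>. The ball is
  closed to be compact.\<close>

definition cutoff :: "(real ^ 'd \<Rightarrow> complex) \<Rightarrow> nat \<Rightarrow> real ^ 'd \<Rightarrow> complex" where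
  "cutoff v k x = (if x \<in> cball 0 (real k) \<and> cmod (v x) \<le> real k then v x else 0)"

lemma norm_cutoff_le: "cmod (cutoff v k x) \<le> cmod (v x)" "cmod (cutoff v k x) \<le> real k"
  by (auto simp: cutoff_def)

lemma borel_measurable_cutoff:
  assumes [measurable]: "v \<in> borel_measurable lebesgue"
  shows "cutoff v k \<in> borel_measurable lebesgue"
proof -
  have [measurable]: "cball (0 :: real ^ 'd) (real k) \<in> sets lebesgue" by simp
  show ?thesis unfolding cutoff_def by measurable
qed

lemma eventually_cutoff: "\<forall>\<^sub>F k in sequentially. cutoff v k x = v x"
proof -
  obtain k where "max (norm x) (cmod (v x)) \<le> real k" using real_arch_simple by blast
  then show ?thesis by (intro eventually_sequentiallyI[of k]) (auto simp: cutoff_def)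
qed

lemma cutoff_strong_conv:
  assumes v: "v \<in> L2 UNIV"
  shows "L2_strong_conv UNIV (cutoff v) v"
  by (rule L2_strong_conv_dominated[OF v])
    (auto simp: norm_cutoff_le tendsto_eventually[OF eventually_cutoff] intro: borel_measurable_cutoff L2_measurable[OF v])

lemma L2_cutoff: "v \<in> L2 UNIV \<Longrightarrow> cutoff v k \<in> L2 UNIV"
  using cutoff_strong_conv by (auto simp: L2_strong_conv_def)

locale multiplier_sequence = multiplier \<phi> for \<phi> :: "real ^ 'd \<Rightarrow> real" +
  fixes \<phi>s :: "nat \<Rightarrow> real ^ 'd \<Rightarrow> real"
  assumes measurable_multipliers [measurable]: "\<And>n. \<phi>s n \<in> borel_measurable lebesgue"
    and nonneg_multipliers: "\<And>n x. 0 \<le> \<phi>s n x"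
    and L1_loc: "\<And>C. compact C \<Longrightarrow> (\<lambda>n. \<integral>\<^sup>+x\<in>C. ennreal \<bar>\<phi>s n x - \<phi> x\<bar> \<partial>lebesgue) \<longlonglongrightarrow> 0"
begin

text \<open>The squared cutoff is at most \<open>k^2\<close> on the compact ball of radius
  \<open>k\<close> and \<open>0\<close> elsewhere. Both the lower bound and the recovery sequence
  draw on local L1 convergence through this limit.\<close>

lemma cutoff_energy_diff:
  assumes v [measurable]: "v \<in> borel_measurable lebesgue"
  shows "(\<lambda>n. \<integral>\<^sup>+x. ennreal ((cmod (cutoff v k x))\<^sup>2 * \<bar>\<phi>s n x - \<phi> x\<bar>) \<partial>lebesgue) \<longlonglongrightarrow> 0"
proof (rule tendsto_sandwich[OF _ _ tendsto_const])
  note [measurable] = borel_measurable_cutoff[OF v]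
  have [measurable]: "cball (0 :: real ^ 'd) (real k) \<in> sets lebesgue" by simp
  let ?D = "\<lambda>n. \<integral>\<^sup>+x\<in>cball 0 (real k). ennreal \<bar>\<phi>s n x - \<phi> x\<bar> \<partial>lebesgue"
  have "(\<lambda>n. ennreal ((real k)\<^sup>2) * ?D n) \<longlonglongrightarrow> ennreal ((real k)\<^sup>2) * 0"
    by (intro ennreal_tendsto_cmult L1_loc) auto
  then show "(\<lambda>n. ennreal ((real k)\<^sup>2) * ?D n) \<longlonglongrightarrow> 0" by simp
  have "(\<integral>\<^sup>+x. ennreal ((cmod (cutoff v k x))\<^sup>2 * \<bar>\<phi>s n x - \<phi> x\<bar>) \<partial>lebesgue) \<le>
      (\<integral>\<^sup>+x. ennreal ((real k)\<^sup>2) * (ennreal \<bar>\<phi>s n x - \<phi> x\<bar> * indicator (cball 0 (real k)) x) \<partial>lebesgue)" for n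
  proof (rule nn_integral_mono)
    fix x
    have "(cmod (cutoff v k x))\<^sup>2 \<le> (real k)\<^sup>2" by (intro power_mono norm_cutoff_le) simp
    then show "ennreal ((cmod (cutoff v k x))\<^sup>2 * \<bar>\<phi>s n x - \<phi> x\<bar>) \<le>
        ennreal ((real k)\<^sup>2) * (ennreal \<bar>\<phi>s n x - \<phi> x\<bar> * indicator (cball 0 (real k)) x)"
      by (cases "x \<in> cball 0 (real k)")
        (auto simp: ennreal_mult[symmetric] cutoff_def intro!: ennreal_leI mult_right_mono)
  qed
  then show "\<forall>\<^sub>F n in sequentially. (\<integral>\<^sup>+x. ennreal ((cmod (cutoff v k x))\<^sup>2 * \<bar>\<phi>s n x - \<phi> x\<bar>) \<partial>lebesgue) \<le> ennreal ((real k)\<^sup>2) * ?D n"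
    by (simp add: nn_integral_cmult)
qed simp

text \<open>
  Clipping makes up for the missing \<open>L\<^sup>2\<close> bounds on the multipliers: on bounded sets, \<open>L\<^sup>1\<close>
  convergence of the multipliers gives \<open>L\<^sup>2\<close> convergence of the clipped ones.
\<close>

lemma cutoff_clip_strong_conv:
  assumes v2: "v \<in> L2 UNIV"
  shows "L2_strong_conv UNIV (\<lambda>n x. cutoff v k x * complex_of_real (clip k (\<phi>s n x)))
    (\<lambda>x. cutoff v k x * complex_of_real (clip k (\<phi> x)))"
proof -
  note v [measurable] = L2_measurable[OF v2]
  note [measurable] = borel_measurable_cutoff[OF v]
  have h: "(\<lambda>x. cutoff v k x * complex_of_real (clip k (f x))) \<in> L2 UNIV"
    if [measurable]: "f \<in> borel_measurable lebesgue" for f :: "real ^ 'd \<Rightarrow> real"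
  proof (rule L2_dominated[OF L2_cmult[OF L2_cutoff[OF v2], of "of_nat k"]])
    show "cmod (cutoff v k x * complex_of_real (clip k (f x))) \<le> cmod (of_nat k * cutoff v k x)" for x
      using mult_left_mono[OF clip_bounds(2)[of k "f x"] norm_ge_zero[of "cutoff v k x"]] clip_bounds(1)[of k "f x"]
      by (simp add: norm_mult mult.commute)
  qed measurable
  let ?d = "\<lambda>n x. cutoff v k x * complex_of_real (clip k (\<phi>s n x)) - cutoff v k x * complex_of_real (clip k (\<phi> x))"
  have d: "?d n \<in> L2 UNIV" for n by (intro L2_diff h) measurable
  have "(\<lambda>n. \<integral>\<^sup>+x. ennreal ((cmod (?d n x))\<^sup>2) \<partial>lebesgue) \<longlonglongrightarrow> 0"
  proof (rule tendsto_sandwich[OF _ _ tendsto_const])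
    let ?D = "\<lambda>n. \<integral>\<^sup>+x. ennreal ((cmod (cutoff v k x))\<^sup>2 * \<bar>\<phi>s n x - \<phi> x\<bar>) \<partial>lebesgue"
    have "(\<lambda>n. ennreal (real k) * ?D n) \<longlonglongrightarrow> ennreal (real k) * 0"
      by (intro ennreal_tendsto_cmult cutoff_energy_diff v) auto
    then show "(\<lambda>n. ennreal (real k) * ?D n) \<longlonglongrightarrow> 0" by simp
    have "(\<integral>\<^sup>+x. ennreal ((cmod (?d n x))\<^sup>2) \<partial>lebesgue) \<le>
        (\<integral>\<^sup>+x. ennreal (real k) * ennreal ((cmod (cutoff v k x))\<^sup>2 * \<bar>\<phi>s n x - \<phi> x\<bar>) \<partial>lebesgue)" for n
    proof (rule nn_integral_mono)
      fix x
      have "\<bar>clip k (\<phi>s n x) - clip k (\<phi> x)\<bar> \<le> real k"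
        using clip_bounds(1,2)[of k "\<phi>s n x"] clip_bounds(1,2)[of k "\<phi> x"] by linarith
      \<comment> \<open>Of the two equal factors one is bounded by the level \<open>k\<close>, the
        other by the Lipschitz property of \<open>clip\<close>; so the square is controlled by a
        first power.\<close>
      then have "\<bar>clip k (\<phi>s n x) - clip k (\<phi> x)\<bar> * \<bar>clip k (\<phi>s n x) - clip k (\<phi> x)\<bar> \<le> real k * \<bar>\<phi>s n x - \<phi> x\<bar>"
        by (intro mult_mono clip_bounds) auto
      then have "(cmod (cutoff v k x))\<^sup>2 * (\<bar>clip k (\<phi>s n x) - clip k (\<phi> x)\<bar> * \<bar>clip k (\<phi>s n x) - clip k (\<phi> x)\<bar>)
          \<le> (cmod (cutoff v k x))\<^sup>2 * (real k * \<bar>\<phi>s n x - \<phi> x\<bar>)"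
        by (intro mult_left_mono) auto
      moreover have "(cmod (?d n x))\<^sup>2 = (cmod (cutoff v k x))\<^sup>2 * (\<bar>clip k (\<phi>s n x) - clip k (\<phi> x)\<bar> * \<bar>clip k (\<phi>s n x) - clip k (\<phi> x)\<bar>)"
        unfolding right_diff_distrib[symmetric] norm_mult power_mult_distrib of_real_diff[symmetric] norm_of_real
        by (simp add: power2_eq_square)
      ultimately show "ennreal ((cmod (?d n x))\<^sup>2) \<le> ennreal (real k) * ennreal ((cmod (cutoff v k x))\<^sup>2 * \<bar>\<phi>s n x - \<phi> x\<bar>)"
        by (simp add: ennreal_mult[symmetric] mult.left_commute ennreal_leI)
    qed
    then show "\<forall>\<^sub>F n in sequentially. (\<integral>\<^sup>+x. ennreal ((cmod (?d n x))\<^sup>2) \<partial>lebesgue) \<le> ennreal (real k) * ?D n"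
      by (simp add: nn_integral_cmult)
  qed simp
  then have "(\<lambda>n. ennreal ((L2_norm (?d n))\<^sup>2)) \<longlonglongrightarrow> ennreal 0"
    by (simp add: nn_integral_L2[OF d])
  then have "(\<lambda>n. (L2_norm (?d n))\<^sup>2) \<longlonglongrightarrow> 0" by (rule tendsto_ennrealD[OF _ _]) auto
  then have "(\<lambda>n. sqrt ((L2_norm (?d n))\<^sup>2)) \<longlonglongrightarrow> sqrt 0" by (rule tendsto_real_sqrt)
  then have "(\<lambda>n. L2_norm (?d n)) \<longlonglongrightarrow> 0" by simp
  then show ?thesis by (simp add: L2_strong_conv_def h)
qed

lemma energy_liminf:
  assumes weak: "L2_weak_conv UNIV us u"
  shows "energy \<phi> u \<le> liminf (\<lambda>n. energy (\<phi>s n) (us n))"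
proof -
  have us2: "us n \<in> L2 UNIV" and u2: "u \<in> L2 UNIV" for n
    using weak by (auto simp: L2_weak_conv_def)
  define v where "v = fourier u"
  define vs where "vs n = fourier (us n)" for n
  have v2: "v \<in> L2 UNIV" and vs2: "vs n \<in> L2 UNIV" for n
    by (simp_all add: v_def vs_def L2_fourier u2 us2)
  note vm [measurable] = L2_measurable[OF v2] L2_measurable[OF vs2]
  note [measurable] = borel_measurable_cutoff[OF vm(1)]
  \<comment> \<open>Testing against \<open>g\<close> on the Fourier side is testing against
    \<open>fourier_adjoint g\<close> on the original side.\<close>
  have vweak: "L2_weak_conv UNIV vs v"
    unfolding L2_weak_conv_def
  proof (intro conjI allI ballI vs2 v2)
    fix g :: "real ^ 'd \<Rightarrow> complex" assume g: "g \<in> L2 UNIV"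
    show "(\<lambda>n. L2_inner (vs n) g) \<longlonglongrightarrow> L2_inner v g"
      using weak L2_fourier_adjoint[OF g]
      by (simp add: v_def vs_def L2_inner_fourier us2 u2 g L2_weak_conv_def)
  qed
  have step: "(\<integral>\<^sup>+x. ennreal ((cmod (cutoff v k x))\<^sup>2 * clip k (\<phi> x)) \<partial>lebesgue) \<le> liminf (\<lambda>n. energy (\<phi>s n) (us n))" for k
  proof -
    let ?g = "cutoff v k"
    let ?h = "\<lambda>f x. ?g x * complex_of_real (clip k (f x))"
    note conv = cutoff_clip_strong_conv[OF v2, of k]
    have h2: "?h (\<phi>s n) \<in> L2 UNIV" "?h \<phi> \<in> L2 UNIV" for n
      using conv by (auto simp: L2_strong_conv_def)
    \<comment> \<open>A constant sequence converges weakly, so the second term of \<open>?a\<close>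
      is covered by the same limit lemma as the first.\<close>
    have gweak: "L2_weak_conv UNIV (\<lambda>n. ?g) ?g"
      using L2_cutoff[OF v2] by (simp add: L2_weak_conv_def)
    let ?a = "\<lambda>n. 2 * Re (L2_inner (vs n) (?h (\<phi>s n))) - Re (L2_inner ?g (?h (\<phi>s n)))"
    have "?a \<longlonglongrightarrow> 2 * Re (L2_inner v (?h \<phi>)) - Re (L2_inner ?g (?h \<phi>))"
      by (intro tendsto_intros L2_weak_strong_inner[OF vweak conv] L2_weak_strong_inner[OF gweak conv])
    \<comment> \<open>\<open>v\<close> and its cutoff agree wherever the other factor is nonzero;
      twice the integral minus the integral then leaves it once.\<close>
    also have "L2_inner v (?h \<phi>) = L2_inner ?g (?h \<phi>)"
      unfolding L2_inner_def by (intro Bochner_Integration.integral_cong) (auto simp: cutoff_def)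
    also have "L2_inner ?g (?h \<phi>) = complex_of_real (LINT x|lebesgue. (cmod (?g x))\<^sup>2 * clip k (\<phi> x))"
      unfolding L2_inner_def integral_complex_of_real[symmetric] of_real_mult complex_norm_square
      by (simp add: mult.assoc)
    finally have lim: "?a \<longlonglongrightarrow> (LINT x|lebesgue. (cmod (?g x))\<^sup>2 * clip k (\<phi> x))" by simp
    have int: "integrable lebesgue (\<lambda>x. (cmod (w x))\<^sup>2 * clip k (f x))"
      if "w \<in> L2 UNIV" and [measurable]: "f \<in> borel_measurable lebesgue" for w :: "real ^ 'd \<Rightarrow> complex" and f :: "real ^ 'd \<Rightarrow> real"
    proof (rule Bochner_Integration.integrable_bound)
      note [measurable] = L2_measurable[OF that(1)]
      show "integrable lebesgue (\<lambda>x. (cmod (w x))\<^sup>2 * real k)" using L2_integrable[OF that(1)] by simp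
      show "(\<lambda>x. (cmod (w x))\<^sup>2 * clip k (f x)) \<in> borel_measurable lebesgue" by measurable
      show "AE x in lebesgue. norm ((cmod (w x))\<^sup>2 * clip k (f x)) \<le> norm ((cmod (w x))\<^sup>2 * real k)"
        using clip_bounds by (auto simp: abs_mult intro!: mult_left_mono)
    qed
    \<comment> \<open>\<open>?a n\<close> may be negative; \<open>ennreal\<close> then sends it to
      \<open>0\<close> and the bound is trivial.\<close>
    have le: "ennreal (?a n) \<le> energy (\<phi>s n) (us n)" for n
    proof -
      define p where "p x = Re (vs n x * cnj (?h (\<phi>s n) x))" for x
      define q where "q x = Re (?g x * cnj (?h (\<phi>s n) x))" for x
      have i1: "integrable lebesgue p" and i2: "integrable lebesgue q"
        unfolding p_def q_def by (intro integrable_Re integrable_L2_mult L2_cnj vs2 h2 L2_cutoff v2)+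
      have "?a n = 2 * (LINT x|lebesgue. p x) - (LINT x|lebesgue. q x)"
        unfolding p_def q_def L2_inner_def
        by (simp only: integral_Re[OF integrable_L2_mult[OF vs2 L2_cnj[OF h2(1)]]]
            integral_Re[OF integrable_L2_mult[OF L2_cutoff[OF v2] L2_cnj[OF h2(1)]]])
      also have "\<dots> = (LINT x|lebesgue. 2 * p x - q x)"
        using i1 i2 by simp
      also have "\<dots> \<le> (LINT x|lebesgue. (cmod (vs n x))\<^sup>2 * clip k (\<phi>s n x))"
      proof (intro integral_mono Bochner_Integration.integrable_diff integrable_mult_right i1 i2 int vs2 measurable_multipliers)
        fix x
        have "2 * Re (a * cnj b) - Re (b * cnj b) \<le> (cmod a)\<^sup>2" for a b
        proof -
          have "0 \<le> (cmod (a - b))\<^sup>2" by simp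
          also have "(cmod (a - b))\<^sup>2 = (cmod a)\<^sup>2 - 2 * Re (a * cnj b) + Re (b * cnj b)"
            unfolding cmod_power2 by (simp add: power2_eq_square algebra_simps)
          finally show ?thesis by simp
        qed
        from mult_right_mono[OF this clip_bounds(1), of "vs n x" "?g x" k "\<phi>s n x"]
        show "2 * p x - q x \<le> (cmod (vs n x))\<^sup>2 * clip k (\<phi>s n x)"
          by (simp add: p_def q_def algebra_simps)
      qed
      finally have "ennreal (?a n) \<le> ennreal (LINT x|lebesgue. (cmod (vs n x))\<^sup>2 * clip k (\<phi>s n x))"
        by (rule ennreal_leI)
      also have "\<dots> = (\<integral>\<^sup>+x. ennreal ((cmod (vs n x))\<^sup>2 * clip k (\<phi>s n x)) \<partial>lebesgue)"
        by (rule nn_integral_eq_integral[symmetric, OF int[OF vs2 measurable_multipliers]]) (auto simp: clip_bounds)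
      also have "\<dots> \<le> energy (\<phi>s n) (us n)"
        unfolding energy_def vs_def
        by (intro nn_integral_mono ennreal_leI mult_left_mono clip_bounds nonneg_multipliers) simp
      finally show ?thesis .
    qed
    have "(\<integral>\<^sup>+x. ennreal ((cmod (?g x))\<^sup>2 * clip k (\<phi> x)) \<partial>lebesgue) = ennreal (LINT x|lebesgue. (cmod (?g x))\<^sup>2 * clip k (\<phi> x))"
      by (rule nn_integral_eq_integral[OF int[OF L2_cutoff[OF v2] measurable_multiplier]]) (auto simp: clip_bounds)
    also have "\<dots> = liminf (\<lambda>n. ennreal (?a n))"
      by (rule lim_imp_Liminf[OF trivial_limit_sequentially tendsto_ennrealI[OF lim], symmetric])
    also have "\<dots> \<le> liminf (\<lambda>n. energy (\<phi>s n) (us n))"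
      by (intro Liminf_mono always_eventually allI le)
    finally show ?thesis .
  qed
  \<comment> \<open>Using one level for cutoff and clipping makes both factors increase together, so
    a single monotone limit removes them.\<close>
  have "(\<lambda>k. \<integral>\<^sup>+x. ennreal ((cmod (cutoff v k x))\<^sup>2 * clip k (\<phi> x)) \<partial>lebesgue) \<longlonglongrightarrow>
      (\<integral>\<^sup>+x. ennreal ((cmod (v x))\<^sup>2 * max 0 (\<phi> x)) \<partial>lebesgue)"
  proof (rule nn_integral_LIMSEQ)
    show "incseq (\<lambda>k x. ennreal ((cmod (cutoff v k x))\<^sup>2 * clip k (\<phi> x)))"
    proof (intro incseq_SucI le_funI ennreal_leI mult_mono power_mono)
      show "cmod (cutoff v k x) \<le> cmod (cutoff v (Suc k) x)" for k x by (auto simp: cutoff_def)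
      show "clip k (\<phi> x) \<le> clip (Suc k) (\<phi> x)" for k x by (auto simp: clip_def)
    qed (auto simp: clip_bounds)
    fix x
    obtain k0 where k0: "\<phi> x \<le> real k0" using real_arch_simple by blast
    have "\<forall>\<^sub>F k in sequentially. ennreal ((cmod (cutoff v k x))\<^sup>2 * clip k (\<phi> x)) = ennreal ((cmod (v x))\<^sup>2 * max 0 (\<phi> x))"
      using eventually_cutoff[of v x] eventually_ge_at_top[of k0]
    proof eventually_elim
      case (elim k)
      then have "clip k (\<phi> x) = max 0 (\<phi> x)" using k0 by (auto simp: clip_def)
      with elim show ?case by simp
    qed
    then show "(\<lambda>k. ennreal ((cmod (cutoff v k x))\<^sup>2 * clip k (\<phi> x))) \<longlonglongrightarrow> ennreal ((cmod (v x))\<^sup>2 * max 0 (\<phi> x))"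
      by (rule tendsto_eventually)
  qed measurable
  moreover have "energy \<phi> u = (\<integral>\<^sup>+x. ennreal ((cmod (v x))\<^sup>2 * max 0 (\<phi> x)) \<partial>lebesgue)"
    unfolding energy_def v_def by (rule nn_integral_cong_AE) (use nonneg in eventually_elim, simp)
  ultimately show ?thesis
    using step by (intro LIMSEQ_le_const2) auto
qed

text \<open>The cutoffs of the transform have preimages in \<open>L2 K\<close>, in the real case
  because cutting off preserves the symmetry. Plancherel brings their strong convergence back to the
  original side.\<close>

lemma cutoff_approximation:
  assumes K: "K = UNIV \<or> K = \<real>" and u: "u \<in> L2 K"
  obtains w where "L2_strong_conv K w u"
    "\<And>k. AE x in lebesgue. fourier (w k) x = cutoff (fourier u) k x"
proof -
  have u2: "u \<in> L2 UNIV" using u by (simp add: L2_def)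
  let ?g = "cutoff (fourier u)"
  note F = L2_fourier[OF u2]
  have g2: "?g k \<in> L2 UNIV" for k by (rule L2_cutoff[OF F])
  have "\<exists>w. w \<in> L2 K \<and> (AE x in lebesgue. fourier w x = ?g k x)" for k
  proof (rule fourier_surj[OF K g2])
    show "AE x in lebesgue. ?g k (- x) = cnj (?g k x)" if "K = \<real>"
      using fourier_L2_real[OF u[unfolded that]] by eventually_elim (auto simp: cutoff_def)
  qed blast
  then obtain w where w: "\<And>k. w k \<in> L2 K" and Fw: "\<And>k. AE x in lebesgue. fourier (w k) x = ?g k x" by metis
  have w2: "w k \<in> L2 UNIV" for k using w[of k] by (simp add: L2_def)
  have "L2_norm (\<lambda>x. w k x - u x) = L2_norm (\<lambda>x. ?g k x - fourier u x)" for k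
  proof -
    have "L2_norm (\<lambda>x. w k x - u x) = L2_norm (fourier (\<lambda>x. w k x - u x))"
      by (intro L2_norm_fourier[symmetric] L2_diff w2 u2)
    also have "\<dots> = L2_norm (\<lambda>x. ?g k x - fourier u x)"
    proof (rule L2_norm_cong_AE)
      show "AE x in lebesgue. fourier (\<lambda>x. w k x - u x) x = ?g k x - fourier u x"
        using fourier_diff[OF w2[of k] u2] Fw[of k] by eventually_elim simp
    qed (intro L2_fourier L2_diff w2 u2 g2)+
    finally show ?thesis .
  qed
  then have "L2_strong_conv K w u"
    using cutoff_strong_conv[OF F] w u by (simp add: L2_strong_conv_def)
  then show thesis using Fw by (rule that)
qed

text \<open>Trade \<open>\<phi>s n\<close> for \<open>\<phi>\<close> at the cost of
  \<open>|\<phi>s n - \<phi>|\<close>, then drop the cutoff in the main term only. The error term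
  keeps it, since local convergence controls the error only there.\<close>

lemma energy_cutoff_le:
  assumes u: "u \<in> L2 UNIV" and w: "AE x in lebesgue. fourier w x = cutoff (fourier u) k x"
  shows "energy (\<phi>s n) w \<le> energy \<phi> u +
    (\<integral>\<^sup>+x. ennreal ((cmod (cutoff (fourier u) k x))\<^sup>2 * \<bar>\<phi>s n x - \<phi> x\<bar>) \<partial>lebesgue)"
proof -
  let ?g = "cutoff (fourier u) k"
  note Fm [measurable] = L2_measurable[OF L2_fourier[OF u]]
  note [measurable] = borel_measurable_cutoff[OF Fm]
  have "energy (\<phi>s n) w = (\<integral>\<^sup>+x. ennreal ((cmod (?g x))\<^sup>2 * \<phi>s n x) \<partial>lebesgue)"
    by (rule energy_cong_AE[OF w])
  also have "\<dots> \<le> (\<integral>\<^sup>+x. ennreal ((cmod (fourier u x))\<^sup>2 * \<phi> x) + ennreal ((cmod (?g x))\<^sup>2 * \<bar>\<phi>s n x - \<phi> x\<bar>) \<partial>lebesgue)"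
  proof (rule nn_integral_mono_AE, use nonneg in eventually_elim)
    case (elim x)
    have "(cmod (?g x))\<^sup>2 * \<phi>s n x \<le> (cmod (?g x))\<^sup>2 * (\<phi> x + \<bar>\<phi>s n x - \<phi> x\<bar>)"
      by (intro mult_left_mono) auto
    also have "\<dots> \<le> (cmod (fourier u x))\<^sup>2 * \<phi> x + (cmod (?g x))\<^sup>2 * \<bar>\<phi>s n x - \<phi> x\<bar>"
      using mult_right_mono[OF power_mono[OF norm_cutoff_le(1) norm_ge_zero, of "fourier u" k x 2] elim]
      by (simp add: distrib_left)
    finally show ?case using elim by (simp add: ennreal_plus[symmetric] ennreal_leI del: ennreal_plus)
  qed
  also have "\<dots> = energy \<phi> u + (\<integral>\<^sup>+x. ennreal ((cmod (?g x))\<^sup>2 * \<bar>\<phi>s n x - \<phi> x\<bar>) \<partial>lebesgue)"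
    unfolding energy_def by (rule nn_integral_add) measurable
  finally show ?thesis .
qed

text \<open>For a fixed level the error vanishes as \<open>n\<close> grows, while approximating
  \<open>u\<close> needs growing levels; the diagonal choice reconciles the two. The estimate stays
  in \<open>ennreal\<close>, so infinite energy of \<open>u\<close> is included.\<close>

lemma recovery_sequence:
  assumes K: "K = UNIV \<or> K = \<real>" and u: "u \<in> L2 K"
  obtains us where "L2_strong_conv K us u" "\<And>n. us n \<in> L2 K"
    "limsup (\<lambda>n. enn2ereal (energy (\<phi>s n) (us n))) \<le> enn2ereal (energy \<phi> u)"
proof -
  have u2: "u \<in> L2 UNIV" using u by (simp add: L2_def)
  obtain w where w: "L2_strong_conv K w u" and Fw: "\<And>k. AE x in lebesgue. fourier (w k) x = cutoff (fourier u) k x"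
    using cutoff_approximation[OF K u] by blast
  define b where "b k n = (\<integral>\<^sup>+x. ennreal ((cmod (cutoff (fourier u) k x))\<^sup>2 * \<bar>\<phi>s n x - \<phi> x\<bar>) \<partial>lebesgue)" for k n
  have b: "b k \<longlonglongrightarrow> 0" for k
    unfolding b_def by (intro cutoff_energy_diff L2_measurable[OF L2_fourier[OF u2]])
  obtain \<kappa> where \<kappa>: "filterlim \<kappa> at_top sequentially" and bk: "(\<lambda>n. b (\<kappa> n) n) \<longlonglongrightarrow> 0"
    by (rule diagonal_null_sequence[where b=b, OF b])
  show thesis
  proof
    show "L2_strong_conv K (\<lambda>n. w (\<kappa> n)) u"
    proof -
      have "(\<lambda>k. L2_norm (\<lambda>x. w k x - u x)) \<longlonglongrightarrow> 0" using w by (simp add: L2_strong_conv_def)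
      from filterlim_compose[OF this \<kappa>] w show ?thesis by (simp add: L2_strong_conv_def)
    qed
    show "w (\<kappa> n) \<in> L2 K" for n using w by (auto simp: L2_strong_conv_def)
    have "limsup (\<lambda>n. enn2ereal (energy (\<phi>s n) (w (\<kappa> n)))) \<le> limsup (\<lambda>n. enn2ereal (energy \<phi> u + b (\<kappa> n) n))"
      using energy_cutoff_le[OF u2 Fw] unfolding b_def
      by (intro Limsup_mono always_eventually allI) (simp add: less_eq_ennreal.rep_eq[symmetric])
    also have "\<dots> = enn2ereal (energy \<phi> u + 0)"
      by (intro lim_imp_Limsup tendsto_enn2erealI tendsto_add tendsto_const bk) auto
    finally show "limsup (\<lambda>n. enn2ereal (energy (\<phi>s n) (w (\<kappa> n)))) \<le> enn2ereal (energy \<phi> u)" by simp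
  qed
qed

end

section \<open>Characteristic exponents\<close>

text \<open>The characteristic function of \<open>\<nu> 1\<close> is
  \<open>exp (- \<phi> x)\<close>. A logarithm gives measurability, modulus at most \<open>1\<close>
  gives the sign, and evenness holds because reflecting the frequency conjugates a value that is
  real.\<close>

lemma characteristic_exponent_facts:
  fixes \<nu> :: "real \<Rightarrow> (real ^ 'd) measure"
  assumes sg: "symmetric_convolution_semigroup \<nu>" and ce: "characteristic_exponent \<nu> \<phi>"
  shows "\<phi> \<in> borel_measurable borel" "0 \<le> \<phi> x" "\<phi> (- x) = \<phi> x"
proof -
  have ps: "prob_space (\<nu> 1)" and [measurable_cong]: "sets (\<nu> 1) = sets borel"
    using sg by (auto simp: symmetric_convolution_semigroup_def)
  interpret prob_space "\<nu> 1" by (rule ps)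
  have eq: "complex_of_real (exp (- \<phi> x)) = (LINT y|\<nu> 1. iexp (x \<bullet> y))" for x
    using ce by (auto simp: characteristic_exponent_def dest: spec[of _ 1])
  have phi: "\<phi> = (\<lambda>x. - ln (Re (LINT y|\<nu> 1. iexp (x \<bullet> y))))"
    by (simp flip: eq)
  show "\<phi> \<in> borel_measurable borel" by (subst phi) measurable
  have "cmod (complex_of_real (exp (- \<phi> x))) \<le> (LINT y|\<nu> 1. cmod (iexp (x \<bullet> y)))"
    unfolding eq by (rule integral_norm_bound)
  also have "\<dots> = 1" by (simp add: prob_space)
  finally show "0 \<le> \<phi> x" by simp
  have "complex_of_real (exp (- \<phi> (- x))) = (LINT y|\<nu> 1. cnj (iexp (x \<bullet> y)))"
    unfolding eq by (intro Bochner_Integration.integral_cong) (auto simp: exp_cnj)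
  also have "\<dots> = complex_of_real (exp (- \<phi> x))"
    unfolding Bochner_Integration.integral_cnj eq[symmetric] by simp
  finally have "exp (- \<phi> (- x)) = exp (- \<phi> x)" by (simp only: of_real_eq_iff)
  then show "\<phi> (- x) = \<phi> x" by simp
qed

section \<open>What the local L1 limit inherits, and the conclusion\<close>

lemma AE_lebesgue_cballs:
  assumes "\<And>k::nat. AE x in lebesgue. x \<in> cball 0 (real k) \<longrightarrow> P x"
  shows "AE x in (lebesgue :: (real ^ 'd) measure). P x"
proof -
  have "AE x in (lebesgue :: (real ^ 'd) measure). \<forall>k::nat. x \<in> cball 0 (real k) \<longrightarrow> P x"
    unfolding AE_all_countable using assms by blast
  then show ?thesis
  proof eventually_elim
    case (elim x)
    obtain k where "norm x \<le> real k" using real_arch_simple by blast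
    with elim show ?case by auto
  qed
qed

text \<open>On each ball the defect of \<open>\<phi>\<close> is bounded in L1 by the distance to
  approximants that have no defect, so it vanishes almost everywhere.\<close>

lemma L1_loc_limit_facts:
  fixes \<phi> :: "real ^ 'd \<Rightarrow> real"
  assumes \<phi> [measurable]: "\<phi> \<in> borel_measurable lebesgue"
    and \<phi>s [measurable]: "\<And>n. \<phi>s n \<in> borel_measurable lebesgue"
    and nonneg: "\<And>n x. 0 \<le> \<phi>s n x" and even: "\<And>n x. \<phi>s n (- x) = \<phi>s n x"
    and L1: "\<And>C. compact C \<Longrightarrow> (\<lambda>n. \<integral>\<^sup>+x\<in>C. ennreal \<bar>\<phi>s n x - \<phi> x\<bar> \<partial>lebesgue) \<longlonglongrightarrow> 0"
  shows "AE x in lebesgue. 0 \<le> \<phi> x" "AE x in lebesgue. \<phi> (- x) = \<phi> x"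
proof -
  have ball [measurable]: "cball (0 :: real ^ 'd) r \<in> sets lebesgue" for r by simp
  let ?D = "\<lambda>k n. \<integral>\<^sup>+x\<in>cball 0 (real k). ennreal \<bar>\<phi>s n x - \<phi> x\<bar> \<partial>lebesgue"
  have D: "?D k \<longlonglongrightarrow> 0" for k by (rule L1) simp
  show "AE x in lebesgue. 0 \<le> \<phi> x"
  proof (rule AE_lebesgue_cballs)
    fix k :: nat
    \<comment> \<open>\<open>ennreal\<close> clamps at \<open>0\<close>, so this is the integral of
      the negative part of \<open>\<phi>\<close>.\<close>
    let ?I = "\<integral>\<^sup>+x\<in>cball 0 (real k). ennreal (- \<phi> x) \<partial>lebesgue"
    have "?I \<le> ?D k n" for n
    proof (intro nn_integral_mono mult_right_mono ennreal_leI)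
      show "- \<phi> x \<le> \<bar>\<phi>s n x - \<phi> x\<bar>" for x using nonneg[of n x] by linarith
    qed simp
    then have "?I \<le> 0" by (intro LIMSEQ_le_const[OF D]) auto
    then have "?I = 0" by simp
    then have "AE x in lebesgue. ennreal (- \<phi> x) * indicator (cball 0 (real k)) x = 0"
      by (subst (asm) nn_integral_0_iff_AE) measurable
    then show "AE x in lebesgue. x \<in> cball 0 (real k) \<longrightarrow> 0 \<le> \<phi> x"
      by eventually_elim (auto simp: indicator_def ennreal_eq_0_iff)
  qed
  have refl [measurable]: "(\<lambda>x. \<phi> (- x)) \<in> borel_measurable lebesgue"
    by (rule measurable_compose[OF measurable_uminus_lebesgue \<phi>])
  show "AE x in lebesgue. \<phi> (- x) = \<phi> x"
  proof (rule AE_lebesgue_cballs)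
    fix k :: nat
    let ?I = "\<integral>\<^sup>+x\<in>cball 0 (real k). ennreal \<bar>\<phi> (- x) - \<phi> x\<bar> \<partial>lebesgue"
    have "?I \<le> ?D k n + ?D k n" for n
    proof -
      let ?f = "\<lambda>x. ennreal \<bar>\<phi>s n x - \<phi> x\<bar> * indicator (cball 0 (real k)) x"
      have f [measurable]: "?f \<in> borel_measurable lebesgue" by measurable
      have f' [measurable]: "(\<lambda>x. ?f (- x)) \<in> borel_measurable lebesgue"
        by (rule measurable_compose[OF measurable_uminus_lebesgue f])
      \<comment> \<open>Insert the even function \<open>\<phi>s n\<close>. The ball is symmetric, so
        the second error term is the reflection of the first, indicator included.\<close>
      have "?I \<le> (\<integral>\<^sup>+x. ?f x + ?f (- x) \<partial>lebesgue)"
      proof (rule nn_integral_mono)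
        fix x
        have "ennreal \<bar>\<phi> (- x) - \<phi> x\<bar> \<le> ennreal (\<bar>\<phi>s n x - \<phi> x\<bar> + \<bar>\<phi>s n (- x) - \<phi> (- x)\<bar>)"
          by (intro ennreal_leI) (simp add: even)
        then show "ennreal \<bar>\<phi> (- x) - \<phi> x\<bar> * indicator (cball 0 (real k)) x \<le> ?f x + ?f (- x)"
          by (auto simp: indicator_def)
      qed
      also have "\<dots> = ?D k n + (\<integral>\<^sup>+x. ?f (- x) \<partial>lebesgue)"
        by (rule nn_integral_add) measurable
      also have "(\<integral>\<^sup>+x. ?f (- x) \<partial>lebesgue) = (\<integral>\<^sup>+x. ?f x \<partial>distr lebesgue lebesgue uminus)"
        by (rule nn_integral_distr[symmetric]) measurable
      finally show ?thesis unfolding distr_lebesgue_uminus .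
    qed
    moreover have "(\<lambda>n. ?D k n + ?D k n) \<longlonglongrightarrow> 0 + 0" by (intro tendsto_add D)
    ultimately have "?I \<le> 0 + 0" by (intro LIMSEQ_le_const) auto
    then have "?I = 0" by simp
    then have "AE x in lebesgue. ennreal \<bar>\<phi> (- x) - \<phi> x\<bar> * indicator (cball 0 (real k)) x = 0"
      by (subst (asm) nn_integral_0_iff_AE) measurable
    then show "AE x in lebesgue. x \<in> cball 0 (real k) \<longrightarrow> \<phi> (- x) = \<phi> x"
      by eventually_elim (auto simp: indicator_def ennreal_eq_0_iff)
  qed
qed

theorem theorem1p3:
  fixes \<nu> :: "nat \<Rightarrow> real \<Rightarrow> (real ^ 'd) measure"
    and \<phi>s :: "nat \<Rightarrow> real ^ 'd \<Rightarrow> real"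
    and \<phi> :: "real ^ 'd \<Rightarrow> real"
    and K :: "complex set"
  assumes "\<And>n. symmetric_convolution_semigroup (\<nu> n)"
    and "\<And>n. characteristic_exponent (\<nu> n) (\<phi>s n)"
    and "\<phi> \<in> borel_measurable lebesgue"
    and "\<And>C. compact C \<Longrightarrow>
           (\<lambda>n. \<integral>\<^sup>+x\<in>C. ennreal \<bar>\<phi>s n x - \<phi> x\<bar> \<partial>lebesgue) \<longlonglongrightarrow> 0"
    and "K = UNIV \<or> K = \<real>"
  shows "mosco_convergent K
           (\<lambda>n. multiplier_domain K (\<phi>s n)) (\<lambda>n. multiplier_form (\<phi>s n))
           (multiplier_domain K \<phi>) (multiplier_form \<phi>)"
proof -
  have s1: "\<phi>s n \<in> borel_measurable lebesgue" and s2: "0 \<le> \<phi>s n x" and s3: "\<phi>s n (- x) = \<phi>s n x" for n x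
    using characteristic_exponent_facts[OF assms(1,2)] by (auto intro: measurable_completion)
  note lim = L1_loc_limit_facts[OF assms(3) s1 s2 s3 assms(4)]
  interpret multiplier_sequence \<phi> \<phi>s
    by unfold_locales (use assms(3,4) s1 s2 lim in auto)
  \<comment> \<open>Each approximating form also needs its own closedness and its extension by
    infinity.\<close>
  interpret M: multiplier "\<phi>s n" for n
    by unfold_locales (use s1 s2 s3 in auto)
  note K = assms(5)
  show ?thesis
    unfolding mosco_convergent_def
  proof (intro conjI allI ballI impI)
    fix u :: "real ^ 'd \<Rightarrow> complex" and us assume u: "u \<in> L2 K" and weak: "L2_weak_conv K us u"
    have us: "us n \<in> L2 K" for n using weak by (simp add: L2_weak_conv_def)
    have "enn2ereal (energy \<phi> u) \<le> enn2ereal (liminf (\<lambda>n. energy (\<phi>s n) (us n)))"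
      using energy_liminf[OF L2_weak_conv_UNIV[OF K weak]] by (simp add: less_eq_ennreal.rep_eq)
    also have "\<dots> = liminf (\<lambda>n. enn2ereal (energy (\<phi>s n) (us n)))"
      by (rule Liminf_compose_continuous_mono[symmetric])
        (auto simp: continuous_on_enn2ereal mono_def less_eq_ennreal.rep_eq)
    finally show "extended_form (multiplier_domain K \<phi>) (multiplier_form \<phi>) u \<le>
        liminf (\<lambda>n. extended_form (multiplier_domain K (\<phi>s n)) (multiplier_form (\<phi>s n)) (us n))"
      by (simp add: extended_form_multiplier[OF u] M.extended_form_multiplier[OF us])
  next
    fix u :: "real ^ 'd \<Rightarrow> complex" assume u: "u \<in> L2 K"
    obtain us where "L2_strong_conv K us u" and us: "\<And>n. us n \<in> L2 K"
      and "limsup (\<lambda>n. enn2ereal (energy (\<phi>s n) (us n))) \<le> enn2ereal (energy \<phi> u)"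
      using recovery_sequence[OF K u] by blast
    then show "\<exists>us. L2_strong_conv K us u \<and>
        limsup (\<lambda>n. extended_form (multiplier_domain K (\<phi>s n)) (multiplier_form (\<phi>s n)) (us n))
          \<le> extended_form (multiplier_domain K \<phi>) (multiplier_form \<phi>) u"
      by (auto simp: extended_form_multiplier[OF u] M.extended_form_multiplier[OF us])
  qed (intro M.closed_form_multiplier closed_form_multiplier K)+
qed

end
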